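(* Let $K\subset\mathbb{R}^n$ ($n\geqslant2$) be a convex body of constant width $2r$, and write $h_K=r+h_{\mathrm{odd}}$ with $h_{\mathrm{odd}}$ odd. For $p=0,\ldots,\lfloor n/2\rfloor$ put $\mathcal Q_{2p}(h_{\mathrm{odd}})=V\left(h_{\mathrm{odd}}^{[2p]},1^{[n-2p]}\right)$. If $n=2m\geqslant4$, then $$\mathrm{Vol}_n(K)=\frac{r}{n-2}S(K)-\frac{2\kappa_n}{n-2}r^n+\frac{2}{n-2}\sum_{p=2}^{m-1}(p-1)\binom{n}{2p}r^{n-2p}\mathcal Q_{2p}(h_{\mathrm{odd}})+V(h_{\mathrm{odd}}^{[n]}).$$ The final summand $V(h_{\mathrm{odd}}^{[n]})$ is the Gauss-cover algebraic $n$-volume of the Wigner hedgehog and occurs with coefficient one; its projectively reduced normalization is $\frac12V(h_{\mathrm{odd}}^{[n]})$, because $\mathbb{RP}^{n-1}$ is orientable and the antipodal cover $\mathbb{S}^{n-1}\to\mathbb{RP}^{n-1}$ is orientation preserving. If $n$ is odd, then $V(h_{\mathrm{odd}}^{[n]})=0$ and $\mathbb{RP}^{n-1}$ is non-orientable.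
   Context: A convex body in $\mathbb{R}^n$ is a compact convex set with non-empty interior; $h_K(u)=\max_{x\in K}\langle x,u\rangle$, $u\in\mathbb{S}^{n-1}$, is its support function. $K$ has constant width $2r$ ($r>0$) if $h_K(u)+h_K(-u)=2r$ for all $u$. $B=B^n$ is the unit ball, $\kappa_n=\mathrm{Vol}_n(B^n)$. $V$ is the mixed volume, normalized by $V(K,\ldots,K)=\mathrm{Vol}_n(K)$; $[m]$ denotes repetition $m$ times. $S(K)=nV(K^{[n-1]},B)=\mathcal H^{n-1}(\partial K)$ is the surface area. Identifying bodies with their support functions, mixed volume is extended multilinearly to linear combinations (formal differences) of support functions on $\mathbb{S}^{n-1}$; the function $1$ is the support function of $B^n$. Terminology: the Wigner hedgehog of $K$ (for smooth $K$) is the map $x_{h_{\mathrm{odd}}}(u)=h_{\mathrm{odd}}(u)u+\nabla_{\mathbb{S}^{n-1}}h_{\mathrm{odd}}(u)$, which satisfies $x_{h_{\mathrm{odd}}}(-u)=x_{h_{\mathrm{odd}}}(u)$ and so factors through $\mathbb{RP}^{n-1}$. Its Gauss-cover algebraic volume is by definition $V(h_{\mathrm{odd}}^{[n]})$, which for $C^2$ functions equals $\frac1n\int_{\mathbb{S}^{n-1}}h_{\mathrm{odd}}\det(\nabla^2 h_{\mathrm{odd}}+h_{\mathrm{odd}}\mathrm{Id})\,\mathrm{d}\sigma$; the projectively reduced normalization is half of it (counting each point of $\mathbb{RP}^{n-1}$ once). "The antipodal cover is orientation preserving" means that the antipodal map of $\mathbb{S}^{n-1}$ preserves orientation. *)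

theory Defs
  imports "HOL-Analysis.Analysis" "HOL-Homology.Homology"
begin

section \<open>Convex bodies and mixed volumes\<close>

definition convex_body :: "'a::euclidean_space set \<Rightarrow> bool" where
  "convex_body K \<longleftrightarrow> compact K \<and> convex K \<and> interior K \<noteq> {}"

definition support_function :: "'a::euclidean_space set \<Rightarrow> 'a \<Rightarrow> real" where
  "support_function K u = (SUP x\<in>K. x \<bullet> u)"

definition constant_width :: "'a::euclidean_space set \<Rightarrow> real \<Rightarrow> bool" where
  "constant_width K w \<longleftrightarrow> (\<forall>u\<in>sphere 0 1. support_function K u + support_function K (- u) = w)"

text \<open>Minkowski's definition: mixed volumes are the symmetric coefficients of the polynomial
  \<open>Vol (t\<^sub>1 K\<^sub>1 + \<dots> + t\<^sub>k K\<^sub>k)\<close> in \<open>t\<^sub>1, \<dots>, t\<^sub>k \<ge> 0\<close>. The outer sum on the left is the Minkowski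
  sum of sets; \<open>js\<close> ranges over all \<open>n\<close>-tuples of indices. The equation constrains \<open>V\<close> only on lists
  of exactly \<open>n = DIM('a)\<close> convex bodies, and determines it there.\<close>

definition mixed_volume_form :: "('a::euclidean_space set list \<Rightarrow> real) \<Rightarrow> bool" where
  "mixed_volume_form V \<longleftrightarrow>
     (\<forall>Ks Ls. mset Ks = mset Ls \<longrightarrow> V Ks = V Ls) \<and>
     (\<forall>Ks t. (\<forall>K\<in>set Ks. convex_body K) \<and> (\<forall>i<length Ks. 0 \<le> t i) \<longrightarrow>
        measure lebesgue (\<Sum>i<length Ks. (\<lambda>x. t i *\<^sub>R x) ` (Ks ! i)) =
          (\<Sum>js | length js = DIM('a) \<and> set js \<subseteq> {..<length Ks}.
             prod_list (map t js) * V (map (\<lambda>j. Ks ! j) js)))"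

definition mixed_volume :: "'a::euclidean_space set list \<Rightarrow> real" where
  "mixed_volume Ks = (THE v. \<exists>V. mixed_volume_form V \<and> v = V Ks)"

text \<open>Multilinear extension to functions which on the unit sphere are differences
  \<open>h\<^sub>K - h\<^sub>L\<close> of support functions of convex bodies (every linear combination of support functions
  is of this form); \<open>J\<close> is the set of slots in which the subtrahend is taken. Only the values on
  the sphere matter.\<close>

definition mixed_volume_ext :: "('a::euclidean_space \<Rightarrow> real) list \<Rightarrow> real" where
  "mixed_volume_ext fs = (THE v. \<exists>Ks Ls.
     length Ks = length fs \<and> length Ls = length fs \<and>
     (\<forall>i<length fs. convex_body (Ks ! i) \<and> convex_body (Ls ! i) \<and>
        (\<forall>u\<in>sphere 0 1. (fs ! i) u = support_function (Ks ! i) u - support_function (Ls ! i) u)) \<and>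
     v = (\<Sum>J\<in>Pow {..<length fs}. (- 1) ^ card J *
            mixed_volume (map (\<lambda>i. if i \<in> J then Ls ! i else Ks ! i) [0..<length fs])))"

definition surface_area :: "'a::euclidean_space set \<Rightarrow> real" where
  "surface_area K = real DIM('a) * mixed_volume (replicate (DIM('a) - 1) K @ [cball 0 1])"

text \<open>\<open>mixed_quermass k h\<close> is \<open>V(h[k], 1[n-k])\<close>; the constant function 1 is the support function
  of the unit ball.\<close>

definition mixed_quermass :: "nat \<Rightarrow> ('a::euclidean_space \<Rightarrow> real) \<Rightarrow> real" where
  "mixed_quermass k h = mixed_volume_ext (replicate k h @ replicate (DIM('a) - k) (\<lambda>_. 1))"

text \<open>Algebraic volumes of the hedgehog with support function \<open>h\<close>. No smoothness is assumed: the
  Gauss-cover volume is by definition the mixed volume. In the projectively reduced normalization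
  each point of projective space is counted once, although it has two preimages on the sphere.\<close>

definition gauss_cover_volume :: "('a::euclidean_space \<Rightarrow> real) \<Rightarrow> real" where
  "gauss_cover_volume h = mixed_volume_ext (replicate DIM('a) h)"

definition projective_volume :: "('a::euclidean_space \<Rightarrow> real) \<Rightarrow> real" where
  "projective_volume h = gauss_cover_volume h / 2"


section \<open>Real projective space and orientations\<close>

definition quotient_topology :: "'a topology \<Rightarrow> ('a \<Rightarrow> 'b) \<Rightarrow> 'b topology" where
  "quotient_topology X f =
     topology (\<lambda>U. U \<subseteq> f ` topspace X \<and> openin X {x \<in> topspace X. f x \<in> U})"

lemma openin_quotient_topology:
  "openin (quotient_topology X f) U \<longleftrightarrow>
     U \<subseteq> f ` topspace X \<and> openin X {x \<in> topspace X. f x \<in> U}"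
proof -
  have "istopology (\<lambda>U. U \<subseteq> f ` topspace X \<and> openin X {x \<in> topspace X. f x \<in> U})"
    unfolding istopology_def
  proof (rule conjI; intro allI impI)
    fix S T
    assume S: "S \<subseteq> f ` topspace X \<and> openin X {x \<in> topspace X. f x \<in> S}"
      and T: "T \<subseteq> f ` topspace X \<and> openin X {x \<in> topspace X. f x \<in> T}"
    have "openin X ({x \<in> topspace X. f x \<in> S} \<inter> {x \<in> topspace X. f x \<in> T})"
      using S T by blast
    moreover have "{x \<in> topspace X. f x \<in> S \<inter> T} =
        {x \<in> topspace X. f x \<in> S} \<inter> {x \<in> topspace X. f x \<in> T}"
      by blast
    ultimately show "S \<inter> T \<subseteq> f ` topspace X \<and> openin X {x \<in> topspace X. f x \<in> S \<inter> T}"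
      using S by (simp only: le_infI1)
  next
    fix \<K>
    assume K: "\<forall>S\<in>\<K>. S \<subseteq> f ` topspace X \<and> openin X {x \<in> topspace X. f x \<in> S}"
    have "openin X (\<Union>S\<in>\<K>. {x \<in> topspace X. f x \<in> S})"
      using K by (intro openin_Union) blast
    moreover have "{x \<in> topspace X. f x \<in> \<Union>\<K>} = (\<Union>S\<in>\<K>. {x \<in> topspace X. f x \<in> S})"
      by auto
    ultimately show "\<Union>\<K> \<subseteq> f ` topspace X \<and> openin X {x \<in> topspace X. f x \<in> \<Union>\<K>}"
      using K by (simp only: Union_least)
  qed
  then show ?thesis
    by (simp only: quotient_topology_def topology_inverse')
qed

lemma topspace_quotient_topology [simp]: "topspace (quotient_topology X f) = f ` topspace X"
proof
  show "topspace (quotient_topology X f) \<subseteq> f ` topspace X"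
    using openin_topspace[of "quotient_topology X f"]
    unfolding openin_quotient_topology by (rule conjunct1)
  have "{x \<in> topspace X. f x \<in> f ` topspace X} = topspace X"
    by auto
  then have "openin (quotient_topology X f) (f ` topspace X)"
    by (simp add: openin_quotient_topology)
  then show "f ` topspace X \<subseteq> topspace (quotient_topology X f)"
    by (rule openin_subset)
qed

lemma quotient_map_quotient_topology: "quotient_map X (quotient_topology X f) f"
  unfolding quotient_map_def topspace_quotient_topology openin_quotient_topology by blast

abbreviation unit_sphere :: "'a::euclidean_space topology" where
  "unit_sphere \<equiv> top_of_set (sphere 0 1)"

definition projective_space :: "'a::euclidean_space set topology" where
  "projective_space = quotient_topology unit_sphere (\<lambda>u. {u, - u})"

text \<open>Orientations of a topological \<open>d\<close>-manifold \<open>X\<close>: a choice of generators \<open>\<mu> x\<close> of the local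
  homology groups \<open>H\<^sub>d (X, X - {x})\<close> that is locally induced by a single class.\<close>

definition orientation :: "nat \<Rightarrow> 'a topology \<Rightarrow> ('a \<Rightarrow> 'a chain set) \<Rightarrow> bool" where
  "orientation d X \<mu> \<longleftrightarrow>
     (\<forall>x\<in>topspace X.
        \<mu> x \<in> carrier (relative_homology_group (int d) X (topspace X - {x})) \<and>
        carrier (relative_homology_group (int d) X (topspace X - {x})) =
          generate (relative_homology_group (int d) X (topspace X - {x})) {\<mu> x}) \<and>
     (\<forall>x\<in>topspace X. \<exists>U. openin X U \<and> x \<in> U \<and>
        (\<exists>c\<in>carrier (relative_homology_group (int d) X (topspace X - U)).
           \<forall>y\<in>U. hom_induced (int d) X (topspace X - U) X (topspace X - {y}) id c = \<mu> y))"

definition orientable :: "nat \<Rightarrow> 'a topology \<Rightarrow> bool" where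
  "orientable d X \<longleftrightarrow> (\<exists>\<mu>. orientation d X \<mu>)"

text \<open>For a self-homeomorphism \<open>f\<close> of a connected manifold this does not depend on the choice of
  the orientation.\<close>

definition orientation_preserving :: "nat \<Rightarrow> 'a topology \<Rightarrow> ('a \<Rightarrow> 'a) \<Rightarrow> bool" where
  "orientation_preserving d X f \<longleftrightarrow>
     homeomorphic_map X X f \<and> orientable d X \<and>
     (\<forall>\<mu>. orientation d X \<mu> \<longrightarrow>
        (\<forall>x\<in>topspace X.
           hom_induced (int d) X (topspace X - {x}) X (topspace X - {f x}) f (\<mu> x) = \<mu> (f x)))"

end

theory Submission
  imports Defs "HOL-Combinatorics.List_Permutation" "HOL-Computational_Algebra.Polynomial"
begin

text \<open>Minkowski's polynomiality of the volume comes from a change of variables. For a convex body \<open>K\<close>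
  the gradient of \<open>f\<^sub>K(x) = ln (\<integral>\<^sub>K exp \<langle>x, y\<rangle> dy)\<close> is a diffeomorphism onto the interior of \<open>K\<close>, and
  the gradient of \<open>\<Sum> t\<^sub>i f\<^bsub>K\<^sub>i\<^esub>\<close> maps onto the interior of \<open>\<Sum> t\<^sub>i K\<^sub>i\<close> (up to a null set). Hence the volume
  of \<open>\<Sum> t\<^sub>i K\<^sub>i\<close> is the integral of \<open>det (\<Sum> t\<^sub>i Hess f\<^bsub>K\<^sub>i\<^esub>)\<close>, whose integrand is a homogeneous polynomial
  in \<open>t\<close>; polarizing it pointwise shows that the polarized volume is the mixed volume.

  For a body of constant width, expand \<open>Vol K = V((r + h)[n])\<close> and \<open>S(K) = n V((r + h)[n-1], 1)\<close>
  binomially. Replacing \<open>K\<close> by \<open>-K\<close> changes the sign of \<open>h\<close>, so the terms of odd degree in \<open>h\<close> vanish,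
  and \<open>(n - 2) Vol K - r S(K)\<close> no longer contains the term of degree two.

  The local homology of the sphere at a point is its top homology, so an orientation of the sphere is
  a constant multiple of the fundamental class, and the antipodal map acts on it by its degree
  \<open>(-1)\<^sup>n\<close>. Excision on evenly covered sets identifies orientations of projective space with those
  orientations of the sphere that the antipodal map preserves.\<close>

section \<open>Polarization\<close>

text \<open>Log-Laplace transforms serve because they are smooth and strictly convex on the whole
  space for every convex body, smooth or not: the second derivative is a covariance matrix. All
  gradient maps share one domain, so weighted sums of bodies become weighted sums of maps, and
  positive definiteness survives such sums. The coefficients of the resulting determinant are never
  integrated one by one; polarization rewrites them through determinants of unweighted sums, whose
  integrals are volumes.

  \<open>mixed_volume\<close> and \<open>mixed_volume_ext\<close> are definite descriptions, so each
  needs uniqueness as well as existence. For the extension this rests on cancellation: if h_A - h_B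
  = h_C - h_D then C + B = A + D as sets, and additivity in each slot makes the signed sums agree.

  No homology of projective space is computed. Local classes upstairs and downstairs are compared
  through open sets without antipodal pairs, and every orientation of the sphere has one integer
  exponent; on an even-dimensional sphere an orientation lifted from projective space would have an
  exponent equal to its negative.\<close>

lemma sum_neg_one_power_card_Pow:
  assumes "finite B"
  shows "(\<Sum>X\<in>Pow B. (- 1) ^ card X) = (if B = {} then 1 else 0 :: 'b::comm_ring_1)"
  using assms
proof (induction B rule: finite_induct)
  case (insert b B)
  have inj: "inj_on (insert b) (Pow B)" using insert(2) by (auto simp: inj_on_def)
  have "Pow B \<inter> insert b ` Pow B = {}" using insert(2) by auto
  then have "(\<Sum>X\<in>Pow (insert b B). (- 1) ^ card X) = (\<Sum>X\<in>Pow B. (- 1) ^ card X) + (\<Sum>X\<in>insert b ` Pow B. (- 1 :: 'b) ^ card X)"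
    unfolding Pow_insert using insert(1) by (subst sum.union_disjoint) auto
  also have "(\<Sum>X\<in>insert b ` Pow B. (- 1 :: 'b) ^ card X) = (\<Sum>X\<in>Pow B. - ((- 1) ^ card X))"
    unfolding sum.reindex[OF inj] o_def
  proof (rule sum.cong)
    fix X assume "X \<in> Pow B"
    then have "b \<notin> X" "finite X" using insert finite_subset by auto
    then show "(- 1 :: 'b) ^ card (insert b X) = - ((- 1) ^ card X)" by simp
  qed simp
  finally show ?case by (simp add: sum_negf)
qed simp

text \<open>Passing to complements turns supersets of \<open>R\<close> into subsets of the
  complement of \<open>R\<close>, whose signed count vanishes unless the empty set is the only
  one.\<close>

lemma sum_neg_one_power_card_supersets:
  assumes "R \<subseteq> {..<n}"
  shows "(\<Sum>J\<in>Pow {..<n}. if R \<subseteq> J then (- 1) ^ (n - card J) else 0) = (if R = {..<n} then 1 else 0 :: 'b::comm_ring_1)"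
proof -
  have "(\<Sum>J\<in>Pow {..<n}. if R \<subseteq> J then (- 1) ^ (n - card J) else 0 :: 'b) =
      (\<Sum>J\<in>{J \<in> Pow {..<n}. R \<subseteq> J}. (- 1) ^ (n - card J))"
    by (rule sum.inter_filter [symmetric]) simp
  also have "\<dots> = (\<Sum>X\<in>Pow ({..<n} - R). (- 1) ^ card X)"
  proof (rule sum.reindex_bij_witness[of _ "\<lambda>X. {..<n} - X" "\<lambda>J. {..<n} - J"])
    fix J assume "J \<in> {J \<in> Pow {..<n}. R \<subseteq> J}"
    then have "card ({..<n} - J) = n - card J"
      by (subst card_Diff_subset) (auto intro: finite_subset)
    then show "(- 1 :: 'b) ^ card ({..<n} - J) = (- 1) ^ (n - card J)" by simp
  qed (use assms in auto)
  also have "\<dots> = (if R = {..<n} then 1 else 0)"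
    using assms by (subst sum_neg_one_power_card_Pow) auto
  finally show ?thesis .
qed

text \<open>Expanding the product over all maps g into \<open>J\<close> and exchanging the sums
  leaves the signed count of the sets \<open>J\<close> that contain the image of g. That count
  vanishes unless g is onto, that is, a permutation, so the right-hand side is the permanent of the
  matrix \<open>a\<close>.\<close>

lemma ryser_formula:
  fixes a :: "nat \<Rightarrow> nat \<Rightarrow> 'b::comm_ring_1"
  shows "(\<Sum>J\<in>Pow {..<n}. (- 1) ^ (n - card J) * (\<Prod>i<n. \<Sum>j\<in>J. a i j)) =
    (\<Sum>\<pi> | \<pi> permutes {..<n}. \<Prod>i<n. a i (\<pi> i))"
proof -
  let ?F = "PiE {..<n} (\<lambda>_. {..<n})"
  have finF: "finite ?F" by (simp add: finite_PiE)
  have "(\<Sum>J\<in>Pow {..<n}. (- 1) ^ (n - card J) * (\<Prod>i<n. \<Sum>j\<in>J. a i j)) =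
     (\<Sum>J\<in>Pow {..<n}. \<Sum>g\<in>?F. (if g ` {..<n} \<subseteq> J then (- 1) ^ (n - card J) else 0) * (\<Prod>i<n. a i (g i)))"
  proof (rule sum.cong)
    fix J assume J: "J \<in> Pow {..<n}"
    then have "finite J" by (auto intro: finite_subset)
    then have "(\<Prod>i<n. \<Sum>j\<in>J. a i j) = (\<Sum>g\<in>PiE {..<n} (\<lambda>_. J). \<Prod>i<n. a i (g i))"
      by (subst prod_sum_PiE) auto
    also have "PiE {..<n} (\<lambda>_. J) = {g \<in> ?F. g ` {..<n} \<subseteq> J}"
      using J by (fastforce simp: PiE_iff extensional_def)
    finally have "(\<Prod>i<n. \<Sum>j\<in>J. a i j) = (\<Sum>g\<in>{g \<in> ?F. g ` {..<n} \<subseteq> J}. \<Prod>i<n. a i (g i))" .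
    also have "\<dots> = (\<Sum>g\<in>?F. if g ` {..<n} \<subseteq> J then \<Prod>i<n. a i (g i) else 0)"
      by (rule sum.inter_filter[OF finF])
    finally show "(- 1) ^ (n - card J) * (\<Prod>i<n. \<Sum>j\<in>J. a i j) =
      (\<Sum>g\<in>?F. (if g ` {..<n} \<subseteq> J then (- 1) ^ (n - card J) else 0) * (\<Prod>i<n. a i (g i)))"
      by (simp add: sum_distrib_left) (rule sum.cong, auto)
  qed simp
  also have "\<dots> = (\<Sum>g\<in>?F. (\<Sum>J\<in>Pow {..<n}. if g ` {..<n} \<subseteq> J then (- 1) ^ (n - card J) else 0) * (\<Prod>i<n. a i (g i)))"
    by (subst sum.swap) (simp add: sum_distrib_right)
  also have "\<dots> = (\<Sum>g\<in>?F. if g ` {..<n} = {..<n} then \<Prod>i<n. a i (g i) else 0)"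
  proof (rule sum.cong)
    fix g assume "g \<in> ?F"
    then have "g ` {..<n} \<subseteq> {..<n}" by auto
    from sum_neg_one_power_card_supersets[OF this, where 'b = 'b]
    show "(\<Sum>J\<in>Pow {..<n}. if g ` {..<n} \<subseteq> J then (- 1) ^ (n - card J) else 0) * (\<Prod>i<n. a i (g i)) =
      (if g ` {..<n} = {..<n} then \<Prod>i<n. a i (g i) else 0)" by simp
  qed simp
  also have "\<dots> = (\<Sum>g\<in>{g \<in> ?F. g ` {..<n} = {..<n}}. \<Prod>i<n. a i (g i))"
    by (rule sum.inter_filter[OF finF, symmetric])
  also have "\<dots> = (\<Sum>\<pi> | \<pi> permutes {..<n}. \<Prod>i<n. a i (\<pi> i))"
  \<comment> \<open>Extensional functions are undefined outside the index set, permutations are the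
    identity there; the two witnesses exchange these conventions.\<close>
  proof (rule sum.reindex_bij_witness[of _ "\<lambda>\<pi>. restrict \<pi> {..<n}" "\<lambda>g i. if i < n then g i else i"])
    fix g assume g: "g \<in> {g \<in> ?F. g ` {..<n} = {..<n}}"
    then have "inj_on g {..<n}" by (intro eq_card_imp_inj_on) auto
    then have "bij_betw (\<lambda>i. if i < n then g i else i) {..<n} {..<n}"
      using g by (subst bij_betw_cong[where g = g]) (auto simp: bij_betw_def)
    then show "(\<lambda>i. if i < n then g i else i) \<in> {\<pi>. \<pi> permutes {..<n}}"
      by (intro CollectI bij_imp_permutes) auto
    show "restrict (\<lambda>i. if i < n then g i else i) {..<n} = g"
      using g by (auto simp: restrict_def PiE_iff extensional_def)
  next
    fix \<pi> assume p: "\<pi> \<in> {\<pi>. \<pi> permutes {..<n}}"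
    then show "(\<lambda>i. if i < n then restrict \<pi> {..<n} i else i) = \<pi>"
      using permutes_not_in by fastforce
    have "restrict \<pi> {..<n} ` {..<n} = {..<n}" using p permutes_image by force
    then show "restrict \<pi> {..<n} \<in> {g \<in> ?F. g ` {..<n} = {..<n}}" by auto
  qed auto
  finally show ?thesis .
qed

text \<open>If \<open>q J\<close> is the value of a homogeneous polynomial of degree
  \<open>n\<close> at the sum of the vectors x_j with j in \<open>J\<close>, this is its polar form
  at x_0, ..., x_(n-1). Taking \<open>q\<close> as a function of index sets lets one definition
  serve determinants, volumes and abstract coefficient forms.\<close>

definition polarization :: "nat \<Rightarrow> (nat set \<Rightarrow> real) \<Rightarrow> real" where
  "polarization n q = (\<Sum>J\<in>Pow {..<n}. (- 1) ^ (n - card J) * q J) / fact n"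

lemma polarization_cong:
  "(\<And>J. J \<subseteq> {..<n} \<Longrightarrow> q J = q' J) \<Longrightarrow> polarization n q = polarization n q'"
  by (simp add: polarization_def)

text \<open>The inner sum is a homogeneous polynomial whose coefficients need not be symmetric, such
  as the row expansion of a determinant. Ryser's formula, applied for each f, shows that
  polarization symmetrizes it.\<close>

lemma polarization_form:
  fixes c :: "(nat \<Rightarrow> 'i) \<Rightarrow> real"
  assumes "finite I"
  shows "polarization n (\<lambda>J. \<Sum>f\<in>PiE {..<n} (\<lambda>_. I). (\<Prod>i<n. \<Sum>j\<in>J. v j (f i)) * c f) =
    (\<Sum>\<pi> | \<pi> permutes {..<n}. \<Sum>f\<in>PiE {..<n} (\<lambda>_. I). (\<Prod>i<n. v (\<pi> i) (f i)) * c f) / fact n"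
proof -
  have "(\<Sum>J\<in>Pow {..<n}. (- 1) ^ (n - card J) * (\<Sum>f\<in>PiE {..<n} (\<lambda>_. I). (\<Prod>i<n. \<Sum>j\<in>J. v j (f i)) * c f)) =
    (\<Sum>f\<in>PiE {..<n} (\<lambda>_. I). (\<Sum>J\<in>Pow {..<n}. (- 1) ^ (n - card J) * (\<Prod>i<n. \<Sum>j\<in>J. v j (f i))) * c f)"
    unfolding sum_distrib_left sum_distrib_right by (subst sum.swap) (simp add: mult.assoc)
  also have "\<dots> = (\<Sum>f\<in>PiE {..<n} (\<lambda>_. I). (\<Sum>\<pi> | \<pi> permutes {..<n}. \<Prod>i<n. v (\<pi> i) (f i)) * c f)"
    by (simp only: ryser_formula[of n "\<lambda>i j. v j (_ i)"])
  also have "\<dots> = (\<Sum>\<pi> | \<pi> permutes {..<n}. \<Sum>f\<in>PiE {..<n} (\<lambda>_. I). (\<Prod>i<n. v (\<pi> i) (f i)) * c f)"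
    unfolding sum_distrib_right by (rule sum.swap)
  finally show ?thesis by (simp add: polarization_def)
qed

lemma bij_betw_PiE_comp_permutes:
  assumes "\<pi> permutes A"
  shows "bij_betw (\<lambda>f. f \<circ> \<pi>) (PiE A (\<lambda>_. I)) (PiE A (\<lambda>_. I))"
proof -
  have c: "f \<circ> \<sigma> \<in> PiE A (\<lambda>_. I)" if "\<sigma> permutes A" "f \<in> PiE A (\<lambda>_. I)" for f \<sigma>
    using that permutes_in_image[OF that(1)] permutes_not_in[OF that(1)]
    by (auto simp: PiE_iff extensional_def)
  show ?thesis
  proof (rule bij_betwI[where g = "\<lambda>f. f \<circ> inv_into UNIV \<pi>"])
    show "f \<circ> \<pi> \<circ> inv_into UNIV \<pi> = f" for f :: "'a \<Rightarrow> 'b"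
      using permutes_inv_o[OF assms] by (simp add: comp_assoc)
    show "f \<circ> inv_into UNIV \<pi> \<circ> \<pi> = f" for f :: "'a \<Rightarrow> 'b"
      using permutes_inv_o[OF assms] by (simp add: comp_assoc)
  qed (use c assms permutes_inv[OF assms] in auto)
qed

lemma prod_permutes: "\<pi> permutes A \<Longrightarrow> (\<Prod>i\<in>A. g (\<pi> i)) = (\<Prod>i\<in>A. g i)"
  using prod.permute[of \<pi> A g] by (simp add: o_def)

text \<open>Reindexing f by a permutation, under which \<open>c\<close> is invariant, makes all
  terms of the symmetrization equal, and the factorial cancels.\<close>

lemma polarization_symmetric_form:
  fixes c :: "(nat \<Rightarrow> 'i) \<Rightarrow> real"
  assumes "finite I"
    and sym: "\<And>\<pi> f. \<pi> permutes {..<n} \<Longrightarrow> f \<in> PiE {..<n} (\<lambda>_. I) \<Longrightarrow> c (f \<circ> \<pi>) = c f"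
  shows "polarization n (\<lambda>J. \<Sum>f\<in>PiE {..<n} (\<lambda>_. I). (\<Prod>i<n. \<Sum>j\<in>J. v j (f i)) * c f) =
    (\<Sum>f\<in>PiE {..<n} (\<lambda>_. I). (\<Prod>i<n. v i (f i)) * c f)"
proof -
  let ?F = "PiE {..<n} (\<lambda>_. I)"
  have "(\<Sum>f\<in>?F. (\<Prod>i<n. v (\<pi> i) (f i)) * c f) = (\<Sum>f\<in>?F. (\<Prod>i<n. v i (f i)) * c f)"
    if p: "\<pi> permutes {..<n}" for \<pi>
  proof -
    have "(\<Sum>f\<in>?F. (\<Prod>i<n. v (\<pi> i) (f i)) * c f) = (\<Sum>f\<in>?F. (\<Prod>i<n. v (\<pi> i) (f (\<pi> i))) * c (f \<circ> \<pi>))"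
      using sum.reindex_bij_betw[OF bij_betw_PiE_comp_permutes[OF p], symmetric] by (simp add: o_def)
    also have "\<dots> = (\<Sum>f\<in>?F. (\<Prod>i<n. v i (f i)) * c f)"
      using sym[OF p] by (intro sum.cong) (auto simp: prod_permutes[OF p, of "\<lambda>i. v i (_ i)"])
    finally show ?thesis .
  qed
  then have "(\<Sum>\<pi> | \<pi> permutes {..<n}. \<Sum>f\<in>?F. (\<Prod>i<n. v (\<pi> i) (f i)) * c f) =
    fact n * (\<Sum>f\<in>?F. (\<Prod>i<n. v i (f i)) * c f)"
    by (simp add: card_permutations)
  then show ?thesis unfolding polarization_form[OF assms(1)] by simp
qed

text \<open>The coefficients \<open>c\<close> are not determined by the polynomial, but their
  symmetrization is: it is read off from the values of \<open>q\<close> at vectors counting how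
  often k occurs among the f j with j in J. Thus \<open>q\<close> is expressed through its own
  values alone, a form that survives integration.\<close>

lemma polarization_recovers_form:
  fixes c :: "(nat \<Rightarrow> 'i) \<Rightarrow> real" and t :: "'i \<Rightarrow> real" and n :: nat
  assumes "finite I"
  defines "q \<equiv> \<lambda>t. \<Sum>f\<in>PiE {..<n} (\<lambda>_. I). (\<Prod>i<n. t (f i)) * c f"
  shows "q t = (\<Sum>f\<in>PiE {..<n} (\<lambda>_. I). (\<Prod>i<n. t (f i)) *
    polarization n (\<lambda>J. q (\<lambda>k. \<Sum>j\<in>J. of_bool (f j = k))))"
proof -
  let ?F = "PiE {..<n} (\<lambda>_. I)"
  have finF: "finite ?F" by (simp add: finite_PiE assms)
  have pol: "polarization n (\<lambda>J. q (\<lambda>k. \<Sum>j\<in>J. of_bool (f j = k))) = (\<Sum>\<pi> | \<pi> permutes {..<n}. c (f \<circ> \<pi>)) / fact n"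
    if f: "f \<in> ?F" for f
  proof -
    have "(\<Sum>g\<in>?F. (\<Prod>i<n. of_bool (f (\<pi> i) = g i)) * c g) = c (f \<circ> \<pi>)" if p: "\<pi> permutes {..<n}" for \<pi>
    proof -
      have m: "f \<circ> \<pi> \<in> ?F" using bij_betw_apply[OF bij_betw_PiE_comp_permutes[OF p] f] .
      have "(\<Prod>i<n. of_bool (f (\<pi> i) = g i) :: real) = of_bool (g = f \<circ> \<pi>)" if g: "g \<in> ?F" for g
      proof (cases "g = f \<circ> \<pi>")
        case False
        then obtain i where "i < n" "g i \<noteq> f (\<pi> i)"
          using PiE_ext[OF g m] by fastforce
        then show ?thesis using False by (auto intro!: prod_zero)
      qed auto
      then have "(\<Sum>g\<in>?F. (\<Prod>i<n. of_bool (f (\<pi> i) = g i)) * c g) = (\<Sum>g\<in>?F. if g = f \<circ> \<pi> then c g else 0)"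
        by (intro sum.cong) auto
      then show ?thesis using m finF by simp
    qed
    then show ?thesis
      unfolding q_def polarization_form[OF assms(1), of n "\<lambda>j k. of_bool (f j = k)"] by simp
  qed
  have inv: "(\<Sum>f\<in>?F. (\<Prod>i<n. t (f i)) * c (f \<circ> \<pi>)) = q t" if p: "\<pi> permutes {..<n}" for \<pi>
  proof -
    have "(\<Sum>f\<in>?F. (\<Prod>i<n. t (f i)) * c (f \<circ> \<pi>)) = (\<Sum>f\<in>?F. (\<Prod>i<n. t ((f \<circ> \<pi>) i)) * c (f \<circ> \<pi>))"
      by (simp add: prod_permutes[OF p, of "\<lambda>i. t (_ i)"])
    also have "\<dots> = q t"
      unfolding q_def by (rule sum.reindex_bij_betw[OF bij_betw_PiE_comp_permutes[OF p]])
    finally show ?thesis .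
  qed
  have "(\<Sum>f\<in>?F. (\<Prod>i<n. t (f i)) * polarization n (\<lambda>J. q (\<lambda>k. \<Sum>j\<in>J. of_bool (f j = k)))) =
    (\<Sum>f\<in>?F. \<Sum>\<pi> | \<pi> permutes {..<n}. (\<Prod>i<n. t (f i)) * c (f \<circ> \<pi>) / fact n)"
    by (intro sum.cong) (auto simp: pol sum_distrib_left sum_divide_distrib)
  also have "\<dots> = (\<Sum>\<pi> | \<pi> permutes {..<n}. (\<Sum>f\<in>?F. (\<Prod>i<n. t (f i)) * c (f \<circ> \<pi>)) / fact n)"
    by (subst sum.swap) (simp add: sum_divide_distrib)
  also have "\<dots> = q t" by (simp add: inv card_permutations)
  finally show ?thesis ..
qed

lemma sum_lists_eq_sum_PiE:
  "(\<Sum>js | length js = n \<and> set js \<subseteq> I. F js) = (\<Sum>f\<in>PiE {..<n} (\<lambda>_. I). F (map f [0..<n]))"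
proof (rule sum.reindex_bij_witness[of _ "\<lambda>f. map f [0..<n]" "\<lambda>js. restrict ((!) js) {..<n}"])
  fix f assume "f \<in> PiE {..<n} (\<lambda>_. I)"
  then show "restrict ((!) (map f [0..<n])) {..<n} = f"
    by (auto simp: PiE_iff extensional_def restrict_def fun_eq_iff)
next
  fix js assume "js \<in> {js. length js = n \<and> set js \<subseteq> I}"
  then show m: "map (restrict ((!) js) {..<n}) [0..<n] = js"
    by (auto intro!: nth_equalityI)
  then show "F (map (restrict ((!) js) {..<n}) [0..<n]) = F js" by simp
qed (auto simp: PiE_iff)

section \<open>The log-Laplace transform of a convex body\<close>

lemma integrable_lebesgue_on_compact:
  fixes \<phi> :: "'a::euclidean_space \<Rightarrow> 'b::euclidean_space"
  assumes "compact K" "continuous_on K \<phi>"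
  shows "integrable (lebesgue_on K) \<phi>"
proof -
  have K: "K \<in> lmeasurable" using assms(1) by (rule lmeasurable_compact)
  then interpret finite_measure "lebesgue_on K" by (rule finite_measure_lebesgue_on)
  obtain B where B: "norm (\<phi> y) \<le> B" if "y \<in> K" for y
    using compact_imp_bounded[OF compact_continuous_image[OF assms(2,1)]] by (auto simp: bounded_iff)
  show ?thesis
  proof (rule integrable_const_bound[where B = B])
    show "\<phi> \<in> borel_measurable (lebesgue_on K)"
      using K by (intro continuous_imp_measurable_on_sets_lebesgue assms fmeasurableD)
  qed (use B in \<open>auto intro!: AE_I2\<close>)
qed

lemma norm_lebesgue_on_integral_le:
  fixes \<phi> :: "'a::euclidean_space \<Rightarrow> 'b::euclidean_space"
  assumes "compact K" "continuous_on K \<phi>" "\<And>y. y \<in> K \<Longrightarrow> norm (\<phi> y) \<le> B"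
  shows "norm (integral\<^sup>L (lebesgue_on K) \<phi>) \<le> B * measure lebesgue K"
proof -
  have "norm (integral\<^sup>L (lebesgue_on K) \<phi>) \<le> (\<integral>y. B \<partial>lebesgue_on K)"
  proof (rule Bochner_Integration.integral_norm_bound_integral)
    show "integrable (lebesgue_on K) \<phi>" by (rule integrable_lebesgue_on_compact[OF assms(1,2)])
    show "integrable (lebesgue_on K) (\<lambda>y. B)" by (rule integrable_lebesgue_on_compact[OF assms(1)]) auto
  qed (use assms in auto)
  also have "\<dots> = B * measure lebesgue K"
    using lmeasurable_compact[OF assms(1)] by (simp add: measure_restrict_space)
  finally show ?thesis .
qed

text \<open>Unnormalized moments of the probability measure on \<open>K\<close> with density
  proportional to exp (x . y). A vector-valued \<open>\<phi>\<close> covers mass, mean and second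
  moments with one definition.\<close>

definition exp_moment :: "'a::euclidean_space set \<Rightarrow> ('a \<Rightarrow> 'b::euclidean_space) \<Rightarrow> 'a \<Rightarrow> 'b" where
  "exp_moment K \<phi> x = (\<integral>y. exp (x \<bullet> y) *\<^sub>R \<phi> y \<partial>lebesgue_on K)"

lemma integrable_exp_moment:
  fixes \<phi> :: "'a::euclidean_space \<Rightarrow> 'b::euclidean_space"
  shows "compact K \<Longrightarrow> continuous_on K \<phi> \<Longrightarrow> integrable (lebesgue_on K) (\<lambda>y. exp (x \<bullet> y) *\<^sub>R \<phi> y)"
  by (intro integrable_lebesgue_on_compact continuous_intros)

lemma exp_taylor2_bound: "\<bar>exp s - 1 - s\<bar> \<le> exp \<bar>s\<bar> * s\<^sup>2" for s :: real
proof -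
  obtain t where t: "\<bar>t\<bar> \<le> \<bar>s\<bar>" "exp s = (\<Sum>m<2. s ^ m / fact m) + exp t / fact 2 * s ^ 2"
    using Maclaurin_exp_le by blast
  then have "\<bar>exp s - 1 - s\<bar> = exp t / 2 * s\<^sup>2" by (simp add: numeral_2_eq_2)
  also have "\<dots> \<le> exp \<bar>s\<bar> * s\<^sup>2"
  proof (rule mult_right_mono)
    have "exp t \<le> exp \<bar>s\<bar>" using t(1) by simp
    then show "exp t / 2 \<le> exp \<bar>s\<bar>" using exp_gt_zero[of t] by linarith
  qed simp
  finally show ?thesis .
qed

text \<open>The Taylor remainder of the exponential is quadratic in x' - x with a constant uniform
  over the compact set \<open>K\<close>; integrating this bound justifies differentiation under the
  integral sign.\<close>

lemma exp_moment_has_derivative: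
  fixes \<phi> :: "'a::euclidean_space \<Rightarrow> 'b::euclidean_space"
  assumes K: "compact K" and \<phi>: "continuous_on K \<phi>"
  shows "(exp_moment K \<phi> has_derivative (\<lambda>v. exp_moment K (\<lambda>y. (v \<bullet> y) *\<^sub>R \<phi> y) x)) (at x)"
proof -
  obtain B where B: "norm (\<phi> y) \<le> B" if "y \<in> K" for y
    using compact_imp_bounded[OF compact_continuous_image[OF \<phi> K]] by (auto simp: bounded_iff)
  obtain R where R: "norm y \<le> R" if "y \<in> K" for y
    using compact_imp_bounded[OF K] by (auto simp: bounded_iff)
  \<comment> \<open>\<open>K\<close> may be empty, in which case the bounds obtained above can be
    negative.\<close>
  define B' where "B' = max B 0"
  define R' where "R' = max R 0"
  have B': "norm (\<phi> y) \<le> B'" and R': "norm y \<le> R'" if "y \<in> K" for y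
    using B[OF that] R[OF that] by (auto simp: B'_def R'_def)
  have pos: "B' \<ge> 0" "R' \<ge> 0" by (auto simp: B'_def R'_def)
  define C where "C = exp (norm x * R') * exp R' * R'\<^sup>2 * B' * measure lebesgue K"
  have int: "integrable (lebesgue_on K) (\<lambda>y. exp (x \<bullet> y) *\<^sub>R (v \<bullet> y) *\<^sub>R \<phi> y)" for v
    by (intro integrable_lebesgue_on_compact continuous_intros K \<phi>)
  have lin: "bounded_linear (\<lambda>v. exp_moment K (\<lambda>y. (v \<bullet> y) *\<^sub>R \<phi> y) x)"
    unfolding linear_conv_bounded_linear[symmetric] exp_moment_def
  proof (rule linearI)
    fix v w
    show "(\<integral>y. exp (x \<bullet> y) *\<^sub>R ((v + w) \<bullet> y) *\<^sub>R \<phi> y \<partial>lebesgue_on K) =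
      (\<integral>y. exp (x \<bullet> y) *\<^sub>R (v \<bullet> y) *\<^sub>R \<phi> y \<partial>lebesgue_on K) + (\<integral>y. exp (x \<bullet> y) *\<^sub>R (w \<bullet> y) *\<^sub>R \<phi> y \<partial>lebesgue_on K)"
      by (subst Bochner_Integration.integral_add[OF int int, symmetric])
        (simp add: inner_add_left scaleR_add_left scaleR_add_right)
  next
    fix r v
    show "(\<integral>y. exp (x \<bullet> y) *\<^sub>R ((r *\<^sub>R v) \<bullet> y) *\<^sub>R \<phi> y \<partial>lebesgue_on K) =
      r *\<^sub>R (\<integral>y. exp (x \<bullet> y) *\<^sub>R (v \<bullet> y) *\<^sub>R \<phi> y \<partial>lebesgue_on K)"
      by (subst integral_scaleR_right[symmetric]) (simp add: mult.left_commute)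
  qed
  have est: "norm (exp_moment K \<phi> x' - exp_moment K \<phi> x - exp_moment K (\<lambda>y. ((x' - x) \<bullet> y) *\<^sub>R \<phi> y) x)
     \<le> C * (norm (x' - x))\<^sup>2" if x': "dist x' x < 1" for x'
  proof -
    let ?v = "x' - x"
    let ?f = "\<lambda>y. (exp (x \<bullet> y) * (exp (?v \<bullet> y) - 1 - ?v \<bullet> y)) *\<^sub>R \<phi> y"
    have "exp_moment K \<phi> x' - exp_moment K \<phi> x - exp_moment K (\<lambda>y. (?v \<bullet> y) *\<^sub>R \<phi> y) x =
       (\<integral>y. exp (x' \<bullet> y) *\<^sub>R \<phi> y - exp (x \<bullet> y) *\<^sub>R \<phi> y - exp (x \<bullet> y) *\<^sub>R (?v \<bullet> y) *\<^sub>R \<phi> y \<partial>lebesgue_on K)"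
      unfolding exp_moment_def
      using integrable_exp_moment[OF K \<phi>, of x'] integrable_exp_moment[OF K \<phi>, of x] int[of ?v]
      by (simp only: Bochner_Integration.integral_diff Bochner_Integration.integrable_diff)
    also have "\<dots> = integral\<^sup>L (lebesgue_on K) ?f"
    proof (rule Bochner_Integration.integral_cong)
      fix y
      have "exp (x' \<bullet> y) = exp (x \<bullet> y) * exp (?v \<bullet> y)"
        by (simp flip: exp_add add: inner_diff_left)
      then show "exp (x' \<bullet> y) *\<^sub>R \<phi> y - exp (x \<bullet> y) *\<^sub>R \<phi> y - exp (x \<bullet> y) *\<^sub>R (?v \<bullet> y) *\<^sub>R \<phi> y = ?f y"
        by (simp add: algebra_simps)
    qed simp
    also have "norm \<dots> \<le> (exp (norm x * R') * (exp R' * (norm ?v * R')\<^sup>2) * B') * measure lebesgue K"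
    proof (rule norm_lebesgue_on_integral_le[OF K])
      show "continuous_on K ?f" by (intro continuous_intros \<phi>)
      fix y assume y: "y \<in> K"
      have s: "\<bar>?v \<bullet> y\<bar> \<le> norm ?v * R'"
        by (rule order_trans[OF Cauchy_Schwarz_ineq2]) (simp add: mult_left_mono R'[OF y])
      have "norm ?v * R' \<le> 1 * R'" using x' pos by (intro mult_right_mono) (auto simp: dist_norm)
      with s have s1: "\<bar>?v \<bullet> y\<bar> \<le> R'" by simp
      have "x \<bullet> y \<le> norm x * R'"
        by (rule order_trans[OF norm_cauchy_schwarz]) (simp add: mult_left_mono R'[OF y])
      then have "exp (x \<bullet> y) \<le> exp (norm x * R')" by simp
      moreover have "\<bar>exp (?v \<bullet> y) - 1 - ?v \<bullet> y\<bar> \<le> exp R' * (norm ?v * R')\<^sup>2"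
      proof (rule order_trans[OF exp_taylor2_bound], rule mult_mono)
        show "(?v \<bullet> y)\<^sup>2 \<le> (norm ?v * R')\<^sup>2"
          using s by (metis abs_ge_zero power2_abs power_mono)
      qed (use s1 in auto)
      ultimately have "exp (x \<bullet> y) * \<bar>exp (?v \<bullet> y) - 1 - ?v \<bullet> y\<bar> \<le> exp (norm x * R') * (exp R' * (norm ?v * R')\<^sup>2)"
        by (intro mult_mono) auto
      then show "norm (?f y) \<le> exp (norm x * R') * (exp R' * (norm ?v * R')\<^sup>2) * B'"
        using B'[OF y] by (auto simp: abs_mult intro!: mult_mono)
    qed
    also have "\<dots> = C * (norm ?v)\<^sup>2" by (simp add: C_def power_mult_distrib)
    finally show ?thesis .
  qed
  show ?thesis
  proof (rule has_derivativeI_sandwich[where e = 1 and H = "\<lambda>x'. C * norm (x' - x)"])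
    show "((\<lambda>x'. C * norm (x' - x)) \<longlongrightarrow> 0) (at x)"
      by (auto intro!: tendsto_eq_intros)
  next
    fix x' assume "x' \<noteq> x" "dist x' x < 1"
    then show "norm (exp_moment K \<phi> x' - exp_moment K \<phi> x - exp_moment K (\<lambda>y. ((x' - x) \<bullet> y) *\<^sub>R \<phi> y) x) / norm (x' - x) \<le> C * norm (x' - x)"
      using est[of x'] by (simp add: divide_le_eq power2_eq_square mult.assoc)
  qed (use lin in auto)
qed

lemma exp_moment_pos:
  fixes \<phi> :: "'a::euclidean_space \<Rightarrow> real"
  assumes K: "compact K" and \<phi>: "continuous_on K \<phi>" "\<And>y. y \<in> K \<Longrightarrow> 0 \<le> \<phi> y"
    and nz: "\<not> negligible {y \<in> K. \<phi> y \<noteq> 0}"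
  shows "0 < exp_moment K \<phi> x"
proof -
  have int: "integrable (lebesgue_on K) (\<lambda>y. exp (x \<bullet> y) *\<^sub>R \<phi> y)"
    by (rule integrable_exp_moment[OF K \<phi>(1)])
  have ge: "0 \<le> exp_moment K \<phi> x"
    unfolding exp_moment_def by (rule Bochner_Integration.integral_nonneg) (use \<phi> in auto)
  have "exp_moment K \<phi> x \<noteq> 0"
  proof
    assume "exp_moment K \<phi> x = 0"
    then have "AE y in lebesgue_on K. exp (x \<bullet> y) *\<^sub>R \<phi> y = 0"
      unfolding exp_moment_def
      by (subst (asm) integral_nonneg_eq_0_iff_AE[OF int]) (use \<phi> in \<open>auto intro!: AE_I2\<close>)
    then have "AE y in lebesgue. y \<in> K \<longrightarrow> \<phi> y = 0"
      using K by (subst (asm) AE_restrict_space_iff) (auto simp: lmeasurable_compact fmeasurableD)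
    then have "AE y in lebesgue. y \<notin> {y \<in> K. \<phi> y \<noteq> 0}" by (rule AE_mp) auto
    moreover have "{y \<in> K. \<phi> y \<noteq> 0} \<in> sets lebesgue"
    proof -
      have "{y \<in> K. \<phi> y = 0} \<in> sets lebesgue"
        using continuous_closedin_preimage_constant[OF \<phi>(1), of 0] K
        by (intro lmeasurable_compact fmeasurableD) (metis closedin_compact)
      moreover have "{y \<in> K. \<phi> y \<noteq> 0} = K - {y \<in> K. \<phi> y = 0}" by auto
      ultimately show ?thesis using K by (metis sets.Diff fmeasurableD lmeasurable_compact)
    qed
    ultimately have "negligible {y \<in> K. \<phi> y \<noteq> 0}"
      by (simp add: negligible_iff_null_sets AE_iff_null_sets)
    with nz show False by simp
  qed
  with ge show ?thesis by simp
qed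

context
  fixes K :: "'a::euclidean_space set"
  assumes K: "compact K" "convex K" "interior K \<noteq> {}"
begin

lemma body_not_negligible: "\<not> negligible K"
  using K(3) negligible_subset[OF _ interior_subset] open_not_negligible[OF open_interior] by blast

lemma exp_moment_one_pos: "0 < exp_moment K (\<lambda>_. 1::real) x"
  using body_not_negligible by (intro exp_moment_pos K) auto
end

definition log_laplace :: "'a::euclidean_space set \<Rightarrow> 'a \<Rightarrow> real" where
  "log_laplace K x = ln (exp_moment K (\<lambda>_. 1) x)"

text \<open>The mean of the probability measure with density proportional to exp (x . y) on
  \<open>K\<close>, which is the gradient of \<open>log_laplace K\<close>.\<close>

definition gradient_map :: "'a::euclidean_space set \<Rightarrow> 'a \<Rightarrow> 'a" where
  "gradient_map K x = inverse (exp_moment K (\<lambda>_. 1) x) *\<^sub>R exp_moment K (\<lambda>y. y) x"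

text \<open>The covariance operator of the same tilted measure, E[(v . y) y] - E[v . y] E[y], left
  in the shape that the product rule produces.\<close>

definition gradient_map_deriv :: "'a::euclidean_space set \<Rightarrow> 'a \<Rightarrow> 'a \<Rightarrow> 'a" where
  "gradient_map_deriv K x v =
     inverse (exp_moment K (\<lambda>_. 1) x) *\<^sub>R exp_moment K (\<lambda>y. (v \<bullet> y) *\<^sub>R y) x -
     (inverse (exp_moment K (\<lambda>_. 1) x) * exp_moment K (\<lambda>y. v \<bullet> y) x * inverse (exp_moment K (\<lambda>_. 1) x)) *\<^sub>R exp_moment K (\<lambda>y. y) x"

lemma inner_exp_moment:
  fixes \<phi> :: "'a::euclidean_space \<Rightarrow> 'b::euclidean_space"
  assumes "compact K" "continuous_on K \<phi>"
  shows "w \<bullet> exp_moment K \<phi> x = exp_moment K (\<lambda>y. w \<bullet> \<phi> y) x"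
  unfolding exp_moment_def
  using integral_inner_right[OF integrable_exp_moment[OF assms], of w] by simp

context
  fixes K :: "'a::euclidean_space set"
  assumes K: "compact K" "convex K" "interior K \<noteq> {}"
begin

lemma log_laplace_has_derivative:
  "(log_laplace K has_derivative (\<lambda>v. v \<bullet> gradient_map K x)) (at x)"
proof -
  have "(log_laplace K has_derivative (\<lambda>v. exp_moment K (\<lambda>y. (v \<bullet> y) *\<^sub>R 1) x * inverse (exp_moment K (\<lambda>_. 1) x))) (at x)"
    unfolding log_laplace_def
    using exp_moment_has_derivative[OF K(1), of "\<lambda>_. 1::real" x] exp_moment_one_pos[OF K, of x]
    by (auto intro!: derivative_eq_intros simp: divide_inverse mult.commute)
  also have "(\<lambda>v. exp_moment K (\<lambda>y. (v \<bullet> y) *\<^sub>R (1::real)) x * inverse (exp_moment K (\<lambda>_. 1) x)) = (\<lambda>v. v \<bullet> gradient_map K x)"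
    by (simp add: gradient_map_def inner_exp_moment[OF K(1) continuous_on_id] mult.commute)
  finally show ?thesis .
qed

lemma gradient_map_has_derivative:
  "(gradient_map K has_derivative gradient_map_deriv K x) (at x)"
proof -
  have 1: "(exp_moment K (\<lambda>_. 1::real) has_derivative (\<lambda>v. exp_moment K (\<lambda>y. v \<bullet> y) x)) (at x)"
    using exp_moment_has_derivative[OF K(1), of "\<lambda>_. 1::real" x] by simp
  have 2: "(exp_moment K (\<lambda>y. y) has_derivative (\<lambda>v. exp_moment K (\<lambda>y. (v \<bullet> y) *\<^sub>R y) x)) (at x)"
    by (rule exp_moment_has_derivative[OF K(1) continuous_on_id])
  show ?thesis
    unfolding gradient_map_def[abs_def] gradient_map_deriv_def[abs_def]
    using exp_moment_one_pos[OF K, of x]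
    by (auto intro!: derivative_eq_intros 1 2 simp: fun_eq_iff algebra_simps)
qed

text \<open>The quantity is the variance of v . y under the tilted measure. It is positive because v
  . y takes each value only on a hyperplane, which is a null set, while \<open>K\<close> is
  not.\<close>

lemma gradient_map_deriv_pos:
  assumes "v \<noteq> 0"
  shows "0 < v \<bullet> gradient_map_deriv K x v"
proof -
  define Z where "Z = exp_moment K (\<lambda>_. 1::real) x"
  define E where "E = exp_moment K (\<lambda>y. v \<bullet> y) x"
  define Q where "Q = exp_moment K (\<lambda>y. (v \<bullet> y)\<^sup>2) x"
  have Z: "Z > 0" unfolding Z_def by (rule exp_moment_one_pos[OF K])
  define m where "m = E / Z"
  have "0 < exp_moment K (\<lambda>y. (v \<bullet> y - m)\<^sup>2) x"
  proof (rule exp_moment_pos[OF K(1)])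
    show "\<not> negligible {y \<in> K. (v \<bullet> y - m)\<^sup>2 \<noteq> 0}"
    proof
      assume "negligible {y \<in> K. (v \<bullet> y - m)\<^sup>2 \<noteq> 0}"
      then have "negligible ({y \<in> K. (v \<bullet> y - m)\<^sup>2 \<noteq> 0} \<union> {y. v \<bullet> y = m})"
        using assms by (intro negligible_Un negligible_hyperplane) auto
      then have "negligible K" by (rule negligible_subset) auto
      then show False using body_not_negligible[OF K] by simp
    qed
  qed (auto intro!: continuous_intros)
  also have "exp_moment K (\<lambda>y. (v \<bullet> y - m)\<^sup>2) x = Q - 2 * m * E + m\<^sup>2 * Z"
  proof -
    have i: "integrable (lebesgue_on K) (\<lambda>y. exp (x \<bullet> y) *\<^sub>R (v \<bullet> y)\<^sup>2)"
      "integrable (lebesgue_on K) (\<lambda>y. exp (x \<bullet> y) *\<^sub>R (v \<bullet> y))"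
      "integrable (lebesgue_on K) (\<lambda>y. exp (x \<bullet> y) *\<^sub>R (1::real))"
      by (intro integrable_exp_moment K continuous_intros)+
    have "exp_moment K (\<lambda>y. (v \<bullet> y - m)\<^sup>2) x =
      (\<integral>y. exp (x \<bullet> y) *\<^sub>R (v \<bullet> y)\<^sup>2 - 2 * m * (exp (x \<bullet> y) *\<^sub>R (v \<bullet> y)) + m\<^sup>2 * (exp (x \<bullet> y) *\<^sub>R 1) \<partial>lebesgue_on K)"
      unfolding exp_moment_def by (rule Bochner_Integration.integral_cong) (auto simp: algebra_simps power2_eq_square)
    also have "\<dots> = Q - 2 * m * E + m\<^sup>2 * Z"
      unfolding Q_def E_def Z_def exp_moment_def
      by (subst Bochner_Integration.integral_add Bochner_Integration.integral_diff integral_mult_right_zero | (intro integrable_mult_right Bochner_Integration.integrable_diff i))+ simp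
    finally show ?thesis .
  qed
  also have "\<dots> = Z * (v \<bullet> gradient_map_deriv K x v)"
  proof -
    have "v \<bullet> exp_moment K (\<lambda>y. (v \<bullet> y) *\<^sub>R y) x = Q"
      unfolding Q_def by (subst inner_exp_moment[OF K(1)]) (auto intro!: continuous_intros simp: power2_eq_square)
    moreover have "v \<bullet> exp_moment K (\<lambda>y. y) x = E"
      unfolding E_def by (subst inner_exp_moment[OF K(1)]) (auto intro!: continuous_intros)
    ultimately have "v \<bullet> gradient_map_deriv K x v = inverse Z * Q - inverse Z * E * inverse Z * E"
      unfolding gradient_map_deriv_def Z_def[symmetric] E_def[symmetric] by (simp add: inner_diff_right)
    then show ?thesis using Z by (simp add: m_def field_simps power2_eq_square)
  qed
  finally show ?thesis using Z by (simp add: zero_less_mult_iff)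
qed

text \<open>A barycentre cannot be separated from a closed convex set that carries the whole mass:
  integrating the separating inequality over \<open>K\<close> gives a contradiction.\<close>

lemma gradient_map_mem: "gradient_map K x \<in> K"
proof (rule ccontr)
  assume "gradient_map K x \<notin> K"
  then obtain a b where ab: "a \<bullet> gradient_map K x < b" "\<And>y. y \<in> K \<Longrightarrow> b < a \<bullet> y"
    using separating_hyperplane_closed_point[OF K(2) compact_imp_closed[OF K(1)]] by blast
  define Z where "Z = exp_moment K (\<lambda>_. 1::real) x"
  have Z: "Z > 0" unfolding Z_def by (rule exp_moment_one_pos[OF K])
  have "b * Z = (\<integral>y. b * (exp (x \<bullet> y) *\<^sub>R 1) \<partial>lebesgue_on K)"
    unfolding Z_def exp_moment_def by simp
  also have "\<dots> \<le> (\<integral>y. exp (x \<bullet> y) *\<^sub>R (a \<bullet> y) \<partial>lebesgue_on K)"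
  proof (rule integral_mono)
    show "integrable (lebesgue_on K) (\<lambda>y. b * (exp (x \<bullet> y) *\<^sub>R 1))"
      by (intro integrable_mult_right integrable_exp_moment K continuous_intros)
    show "integrable (lebesgue_on K) (\<lambda>y. exp (x \<bullet> y) *\<^sub>R (a \<bullet> y))"
      by (intro integrable_exp_moment K continuous_intros)
  qed (use ab(2) in \<open>auto simp: less_imp_le mult.commute\<close>)
  also have "\<dots> = a \<bullet> exp_moment K (\<lambda>y. y) x"
    by (subst inner_exp_moment[OF K(1)]) (auto simp: exp_moment_def)
  also have "\<dots> = (a \<bullet> gradient_map K x) * Z"
    using Z by (simp add: gradient_map_def Z_def[symmetric])
  finally show False using ab(1) Z by simp
qed

text \<open>A finite cover gives an m > 0 such that within distance \<epsilon> of every point k of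
  \<open>K\<close> there is a part of \<open>K\<close> of volume at least m, and on it x . y is at
  least x . k - \<epsilon> |x|. So up to a small multiple of the norm and a constant,
  \<open>log_laplace K\<close> dominates the support function, uniformly in x and k, as coercivity
  will require.\<close>

lemma log_laplace_lower_bound:
  assumes "\<epsilon> > 0"
  obtains C where "\<And>x k. k \<in> K \<Longrightarrow> x \<bullet> k - \<epsilon> * norm x - C \<le> log_laplace K x"
proof -
  obtain F where F: "F \<subseteq> K" "finite F" "K \<subseteq> (\<Union>c\<in>F. ball c (\<epsilon> / 2))"
    using compactE_image[OF K(1), of K "\<lambda>c. ball c (\<epsilon> / 2)"] assms by force
  define \<mu> where "\<mu> c = measure lebesgue (K \<inter> cball c (\<epsilon> / 2))" for c
  have cK: "compact (K \<inter> cball c (\<epsilon> / 2))" for c using K(1) by (simp add: compact_Int)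
  have pos: "0 < \<mu> c" if "c \<in> K" for c
  proof -
    \<comment> \<open>The centre c may lie on the boundary of \<open>K\<close>; interior points
      accumulating at c give the intersection with the ball a positive volume.\<close>
    have "c \<in> closure (interior K)"
      using that convex_closure_interior[OF K(2,3)] closure_subset by blast
    then obtain z where "z \<in> interior K" "dist z c < \<epsilon> / 2"
      using closure_approachable[of c "interior K"] assms by (meson half_gt_zero)
    then have "interior K \<inter> ball c (\<epsilon> / 2) \<noteq> {}" by (auto simp: dist_commute)
    then have "\<not> negligible (interior K \<inter> ball c (\<epsilon> / 2))" by (intro open_not_negligible open_Int) auto
    moreover have "interior K \<inter> ball c (\<epsilon> / 2) \<subseteq> K \<inter> cball c (\<epsilon> / 2)"
      using interior_subset by auto
    ultimately have "\<not> negligible (K \<inter> cball c (\<epsilon> / 2))" using negligible_subset by blast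
    then show ?thesis unfolding \<mu>_def
      using cK[of c] by (simp add: lmeasurable_compact negligible_iff_measure zero_less_measure_iff less_le)
  qed
  \<comment> \<open>The extra element 1 keeps the set nonempty, so \<open>Min\<close> needs no case
    distinction on \<open>F\<close>.\<close>
  define m where "m = Min (insert 1 (\<mu> ` F))"
  have m: "m > 0" "\<And>c. c \<in> F \<Longrightarrow> m \<le> \<mu> c"
    using F pos by (auto simp: m_def)
  show ?thesis
  proof (rule that[of "- ln m"])
    fix x k assume k: "k \<in> K"
    then obtain c where c: "c \<in> F" "dist c k < \<epsilon> / 2" using F by auto
    let ?D = "K \<inter> cball c (\<epsilon> / 2)"
    have "m * exp (x \<bullet> k - \<epsilon> * norm x) \<le> \<mu> c * exp (x \<bullet> k - \<epsilon> * norm x)"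
      using m(2)[OF c(1)] by (intro mult_right_mono) auto
    also have "\<dots> = (\<integral>y. exp (x \<bullet> k - \<epsilon> * norm x) \<partial>lebesgue_on ?D)"
      using lmeasurable_compact[OF cK[of c]] by (simp add: \<mu>_def measure_restrict_space)
    also have "\<dots> = (\<integral>y. indicator ?D y *\<^sub>R exp (x \<bullet> k - \<epsilon> * norm x) \<partial>lebesgue)"
      using lmeasurable_compact[OF cK[of c]] by (subst integral_restrict_space) auto
    also have "\<dots> \<le> (\<integral>y. indicator K y *\<^sub>R exp (x \<bullet> y) \<partial>lebesgue)"
    proof (rule integral_mono)
      show "integrable lebesgue (\<lambda>y. indicat_real ?D y *\<^sub>R exp (x \<bullet> k - \<epsilon> * norm x))"
        using lmeasurable_compact[OF cK[of c]] integrable_lebesgue_on_compact[OF cK[of c], of "\<lambda>_. exp (x \<bullet> k - \<epsilon> * norm x)"]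
        by (subst integrable_restrict_space[symmetric]) auto
      show "integrable lebesgue (\<lambda>y. indicat_real K y *\<^sub>R exp (x \<bullet> y))"
        using lmeasurable_compact[OF K(1)] integrable_exp_moment[OF K(1), of "\<lambda>_. 1::real" x]
        by (subst integrable_restrict_space[symmetric]) auto
      fix y
      show "indicat_real ?D y *\<^sub>R exp (x \<bullet> k - \<epsilon> * norm x) \<le> indicat_real K y *\<^sub>R exp (x \<bullet> y)"
      proof (cases "y \<in> ?D")
        case True
        then have "dist k y \<le> \<epsilon>" using c(2) dist_triangle[of k y c] by (auto simp: dist_commute)
        then have "x \<bullet> (k - y) \<le> norm x * \<epsilon>"
          by (intro order_trans[OF norm_cauchy_schwarz] mult_left_mono) (auto simp: dist_norm)
        then show ?thesis using True by (simp add: inner_diff_right mult.commute)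
      qed (simp add: indicator_def)
    qed
    also have "\<dots> = exp_moment K (\<lambda>_. 1) x"
      unfolding exp_moment_def using lmeasurable_compact[OF K(1)] by (subst integral_restrict_space) auto
    finally have "ln (m * exp (x \<bullet> k - \<epsilon> * norm x)) \<le> log_laplace K x"
      unfolding log_laplace_def using m(1) exp_moment_one_pos[OF K, of x] by (subst ln_le_cancel_iff) auto
    then show "x \<bullet> k - \<epsilon> * norm x - - ln m \<le> log_laplace K x"
      using m(1) by (simp add: ln_mult)
  qed
qed

end

section \<open>Volumes of Minkowski combinations\<close>

lemma mem_sum_sets_iff:
  fixes S :: "'i \<Rightarrow> 'a::comm_monoid_add set"
  assumes "finite I"
  shows "x \<in> (\<Sum>i\<in>I. S i) \<longleftrightarrow> (\<exists>s. (\<forall>i\<in>I. s i \<in> S i) \<and> x = (\<Sum>i\<in>I. s i))"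
  using assms by (subst set_sum_alt) auto

lemma compact_sum_sets:
  fixes S :: "'i \<Rightarrow> 'a::real_normed_vector set"
  assumes "finite I" "\<And>i. i \<in> I \<Longrightarrow> compact (S i)"
  shows "compact (\<Sum>i\<in>I. S i)"
  using assms
proof (induction I rule: finite_induct)
  case (insert i I)
  have "compact {x + y | x y. x \<in> S i \<and> y \<in> (\<Sum>i\<in>I. S i)}"
    using insert by (intro compact_sums) auto
  moreover have "{x + y | x y. x \<in> S i \<and> y \<in> (\<Sum>i\<in>I. S i)} = (\<Sum>i\<in>insert i I. S i)"
    using insert by (auto simp: set_plus_def)
  ultimately show ?case by simp
qed (simp add: set_zero)

lemma convex_sum_sets:
  fixes S :: "'i \<Rightarrow> 'a::real_vector set"
  assumes "finite I" "\<And>i. i \<in> I \<Longrightarrow> convex (S i)"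
  shows "convex (\<Sum>i\<in>I. S i)"
  using assms by (induction I rule: finite_induct) (auto simp: set_zero intro: convex_set_plus)

text \<open>A positive weight keeps the summed covariance positive definite; the case of all weights
  zero is settled separately in \<open>volume_weighted_sum_has_integral\<close>.\<close>

locale weighted_bodies =
  fixes I :: "'i set" and K :: "'i \<Rightarrow> 'a::euclidean_space set" and t :: "'i \<Rightarrow> real"
  assumes finite_I: "finite I"
    and body: "\<And>i. i \<in> I \<Longrightarrow> compact (K i)" "\<And>i. i \<in> I \<Longrightarrow> convex (K i)" "\<And>i. i \<in> I \<Longrightarrow> interior (K i) \<noteq> {}"
    and t_nonneg: "\<And>i. i \<in> I \<Longrightarrow> 0 \<le> t i" and t_pos: "\<exists>i\<in>I. 0 < t i"
begin

definition "L = (\<Sum>i\<in>I. (\<lambda>x. t i *\<^sub>R x) ` K i)"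
definition "G x = (\<Sum>i\<in>I. t i *\<^sub>R gradient_map (K i) x)"
definition "G' x v = (\<Sum>i\<in>I. t i *\<^sub>R gradient_map_deriv (K i) x v)"
definition "F x = (\<Sum>i\<in>I. t i * log_laplace (K i) x)"

lemma compact_L: "compact L" unfolding L_def
  by (intro compact_sum_sets finite_I compact_scaling body)

lemma convex_L: "convex L" unfolding L_def
  by (intro convex_sum_sets finite_I convex_scaling body)

lemma G_has_derivative: "(G has_derivative G' x) (at x)"
  unfolding G_def[abs_def] G'_def[abs_def]
  by (intro has_derivative_sum has_derivative_scaleR_right gradient_map_has_derivative body)

lemma F_has_derivative: "(F has_derivative (\<lambda>v. v \<bullet> G x)) (at x)"
proof -
  have "(F has_derivative (\<lambda>v. \<Sum>i\<in>I. t i * (v \<bullet> gradient_map (K i) x))) (at x)"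
    unfolding F_def[abs_def]
    by (intro has_derivative_sum has_derivative_mult_right log_laplace_has_derivative body)
  then show ?thesis by (simp add: G_def inner_sum_right)
qed

lemma G'_pos: assumes "v \<noteq> 0" shows "0 < v \<bullet> G' x v"
proof -
  obtain i where "i \<in> I" "0 < t i" using t_pos by auto
  then show ?thesis
    unfolding G'_def inner_sum_right
    using t_nonneg gradient_map_deriv_pos[OF body assms]
    by (intro sum_pos2[of I i] finite_I) (auto intro!: mult_nonneg_nonneg simp: less_imp_le)
qed

text \<open>On the segment from x to x', with v = x' - x, the function v . G has derivative v . G' v
  > 0, so its values at the two ends differ.\<close>

lemma inj_G: "inj G"
proof (rule injI, rule ccontr)
  fix x x' assume eq: "G x = G x'" and ne: "x \<noteq> x'"
  define v where "v = x' - x"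
  have v: "v \<noteq> 0" using ne by (simp add: v_def)
  have "v \<bullet> G (x + 0 *\<^sub>R v) < v \<bullet> G (x + 1 *\<^sub>R v)"
  proof (rule DERIV_pos_imp_increasing[of 0 1 "\<lambda>s. v \<bullet> G (x + s *\<^sub>R v)"])
    fix s :: real
    have "((\<lambda>s. G (x + s *\<^sub>R v)) has_derivative (\<lambda>h. G' (x + s *\<^sub>R v) (h *\<^sub>R v))) (at s)"
      by (rule has_derivative_compose[OF _ G_has_derivative]) (auto intro!: derivative_eq_intros)
    then have "((\<lambda>s. v \<bullet> G (x + s *\<^sub>R v)) has_derivative (\<lambda>h. v \<bullet> G' (x + s *\<^sub>R v) (h *\<^sub>R v))) (at s)"
      by (rule has_derivative_inner_right)
    moreover have "(\<lambda>h. v \<bullet> G' (x + s *\<^sub>R v) (h *\<^sub>R v)) = (*) (v \<bullet> G' (x + s *\<^sub>R v) v)"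
      using linear_cmul[OF has_derivative_linear[OF G_has_derivative]] by (auto simp: fun_eq_iff)
    ultimately have "((\<lambda>s. v \<bullet> G (x + s *\<^sub>R v)) has_field_derivative v \<bullet> G' (x + s *\<^sub>R v) v) (at s)"
      by (simp add: has_field_derivative_def)
    then show "\<exists>y. ((\<lambda>s. v \<bullet> G (x + s *\<^sub>R v)) has_real_derivative y) (at s) \<and> 0 < y"
      using G'_pos[OF v] by blast
  qed simp
  then show False using eq by (simp add: v_def)
qed

lemma range_G_subset: "range G \<subseteq> L"
proof
  fix p assume "p \<in> range G"
  then obtain x where "p = (\<Sum>i\<in>I. t i *\<^sub>R gradient_map (K i) x)" by (auto simp: G_def)
  then show "p \<in> L"
    unfolding L_def mem_sum_sets_iff[OF finite_I]
    by (intro exI[of _ "\<lambda>i. t i *\<^sub>R gradient_map (K i) x"]) (auto intro!: imageI gradient_map_mem body)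
qed

lemma F_lower_bound:
  assumes "\<epsilon> > 0"
  obtains C where "\<And>x p. p \<in> L \<Longrightarrow> x \<bullet> p - \<epsilon> * norm x - C \<le> F x"
proof -
  \<comment> \<open>The errors \<eta> |x| of the individual bodies are weighted by
    \<open>t i\<close>, so dividing by the total weight makes them add up to \<epsilon> |x|.\<close>
  define \<eta> where "\<eta> = \<epsilon> / (\<Sum>i\<in>I. t i)"
  have S: "0 < (\<Sum>i\<in>I. t i)" using t_pos t_nonneg finite_I by (metis sum_pos2)
  then have "\<eta> > 0" using assms by (simp add: \<eta>_def)
  then have "\<exists>c. \<forall>x. \<forall>k\<in>K i. x \<bullet> k - \<eta> * norm x - c \<le> log_laplace (K i) x" if "i \<in> I" for i
    using log_laplace_lower_bound[OF body(1-3)[OF that]] by metis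
  then obtain c where c: "\<And>i x k. i \<in> I \<Longrightarrow> k \<in> K i \<Longrightarrow> x \<bullet> k - \<eta> * norm x - c i \<le> log_laplace (K i) x"
    by metis
  show ?thesis
  proof (rule that)
    fix x p assume "p \<in> L"
    then obtain s where s: "\<And>i. i \<in> I \<Longrightarrow> s i \<in> (\<lambda>x. t i *\<^sub>R x) ` K i" "p = (\<Sum>i\<in>I. s i)"
      unfolding L_def mem_sum_sets_iff[OF finite_I] by auto
    have "\<forall>i\<in>I. \<exists>k. k \<in> K i \<and> s i = t i *\<^sub>R k" using s(1) by blast
    then obtain k where k: "\<And>i. i \<in> I \<Longrightarrow> k i \<in> K i \<and> s i = t i *\<^sub>R k i"
      unfolding bchoice_iff by blast
    have "(\<Sum>i\<in>I. t i * (x \<bullet> k i - \<eta> * norm x - c i)) \<le> F x"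
      unfolding F_def using c k t_nonneg by (intro sum_mono mult_left_mono) auto
    also have "(\<Sum>i\<in>I. t i * (x \<bullet> k i - \<eta> * norm x - c i)) = x \<bullet> p - (\<Sum>i\<in>I. t i) * \<eta> * norm x - (\<Sum>i\<in>I. t i * c i)"
    proof -
      have "x \<bullet> p = (\<Sum>i\<in>I. t i * (x \<bullet> k i))"
        unfolding s(2) inner_sum_right using k by (intro sum.cong) auto
      moreover have "(\<Sum>i\<in>I. t i) * \<eta> * norm x = (\<Sum>i\<in>I. t i * (\<eta> * norm x))"
        by (simp add: sum_distrib_right mult.assoc)
      ultimately show ?thesis by (simp add: right_diff_distrib sum_subtractf)
    qed
    also have "(\<Sum>i\<in>I. t i) * \<eta> = \<epsilon>" using S by (simp add: \<eta>_def)
    finally show "x \<bullet> p - \<epsilon> * norm x - (\<Sum>i\<in>I. t i * c i) \<le> F x" .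
  qed
qed

text \<open>Every interior point \<open>p\<close> is a gradient: \<open>F - \<langle>\<cdot>, p\<rangle>\<close> is coercive and hence attains its minimum.\<close>

lemma interior_subset_range_G: "interior L \<subseteq> range G"
proof
  fix p assume "p \<in> interior L"
  then obtain \<delta> where \<delta>: "\<delta> > 0" "cball p \<delta> \<subseteq> L" by (meson mem_interior_cball)
  obtain C where C: "\<And>x p. p \<in> L \<Longrightarrow> x \<bullet> p - (\<delta> / 2) * norm x - C \<le> F x"
    using F_lower_bound[of "\<delta> / 2"] \<delta>(1) by auto
  define f where "f x = F x - x \<bullet> p" for x
  have f': "(f has_derivative (\<lambda>v. v \<bullet> (G x - p))) (at x)" for x
    unfolding f_def[abs_def] by (auto intro!: derivative_eq_intros F_has_derivative simp: inner_diff_right)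
  have coercive: "\<delta> / 2 * norm x - C \<le> f x" for x
  proof -
    \<comment> \<open>Pushing p by \<delta> in the direction of x stays in \<open>L\<close> and
      gains \<delta> |x|, half of which pays for the error term of the lower bound. For x = 0
      division by zero gives u = 0.\<close>
    define u where "u = (\<delta> / norm x) *\<^sub>R x"
    have "norm u \<le> \<delta>" using \<delta>(1) by (simp add: u_def)
    then have "p + u \<in> L" using \<delta>(2) by (auto simp: dist_norm)
    then have "x \<bullet> (p + u) - (\<delta> / 2) * norm x - C \<le> F x" by (rule C)
    moreover have "x \<bullet> u = \<delta> * norm x"
      by (simp add: u_def dot_square_norm power2_eq_square)
    ultimately show ?thesis by (simp add: f_def inner_add_right)
  qed
  \<comment> \<open>Outside this radius the coercive bound already exceeds f 0, so the minimum over
    the ball is global.\<close>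
  define R where "R = max 0 (2 / \<delta> * (f 0 + C))"
  have "continuous_on (cball 0 R) f"
    using has_derivative_continuous[OF f'] by (simp add: continuous_at_imp_continuous_on)
  then obtain x where x: "x \<in> cball 0 R" "\<And>y. y \<in> cball 0 R \<Longrightarrow> f x \<le> f y"
    using continuous_attains_inf[of "cball 0 R" f] by (auto simp: R_def)
  have min: "f x \<le> f y" for y
  proof (cases "y \<in> cball 0 R")
    case False
    then have "2 / \<delta> * (f 0 + C) < norm y" by (simp add: R_def)
    then have "f 0 < \<delta> / 2 * norm y - C" using \<delta>(1) by (simp add: field_simps)
    then have "f 0 \<le> f y" using coercive[of y] by simp
    moreover have "f x \<le> f 0" by (rule x(2)) (simp add: R_def)
    ultimately show ?thesis by simp
  qed (use x in auto)
  have "(\<lambda>v. v \<bullet> (G x - p)) = (\<lambda>v. 0)"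
    by (rule differential_zero_maxmin[OF _ _ f'[of x], of UNIV]) (use min in auto)
  then have "(G x - p) \<bullet> (G x - p) = 0" by metis
  then show "p \<in> range G" by auto
qed

text \<open>The range lies between the interior of \<open>L\<close> and \<open>L\<close> itself, and
  the boundary of a convex set is a null set.\<close>

lemma measure_range_G: "range G \<in> lmeasurable" "measure lebesgue (range G) = measure lebesgue L"
proof -
  have neg: "negligible (frontier L)" by (rule negligible_convex_frontier[OF convex_L])
  have "L - interior L \<subseteq> frontier L" using closure_subset by (auto simp: frontier_def)
  then have "negligible (sym_diff L (range G))"
    using range_G_subset interior_subset_range_G by (intro negligible_subset[OF neg]) auto
  then show "range G \<in> lmeasurable" "measure lebesgue (range G) = measure lebesgue L"
    using lmeasurable_compact[OF compact_L] lmeasurable_negligible_symdiff measure_negligible_symdiff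
    by blast+
qed

end

text \<open>Every matrix on the segment from the identity to \<open>A\<close> is positive definite
  in the same sense, hence invertible, so the determinant cannot change sign along it.\<close>

lemma det_pos_of_positive_definite:
  fixes A :: "real^'n^'n"
  assumes "\<And>v. v \<noteq> 0 \<Longrightarrow> 0 < v \<bullet> (A *v v)"
  shows "0 < det A"
proof -
  define B where "B s = s *\<^sub>R A + (1 - s) *\<^sub>R mat 1" for s :: real
  have nz: "det (B s) \<noteq> 0" if s: "0 \<le> s" "s \<le> 1" for s
  proof
    assume "det (B s) = 0"
    then obtain v where v: "B s *v v = 0" "v \<noteq> 0"
      using matrix_left_invertible_ker[of "B s"] invertible_det_nz[of "B s"] by (auto simp: invertible_left_inverse)
    have "v \<bullet> (B s *v v) = s * (v \<bullet> (A *v v)) + (1 - s) * (v \<bullet> v)"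
      by (simp add: B_def matrix_vector_mult_add_rdistrib scaleR_matrix_vector_assoc[symmetric] inner_add_right)
    also have "\<dots> > 0"
      using assms[OF v(2)] v(2) s by (cases "s = 0") (auto intro!: add_pos_nonneg)
    finally show False using v by simp
  qed
  have "continuous_on {0..1} (\<lambda>s. det (B s))"
    unfolding B_def det_def by (intro continuous_intros)
  moreover have "det (B 0) = 1" "B 1 = A" by (auto simp: B_def)
  ultimately have "\<not> det A \<le> 0"
    using IVT2'[of "\<lambda>s. det (B s)" 1 0 0] nz by force
  then show ?thesis by simp
qed

lemma det_zero_matrix: "det (0 :: 'a::comm_ring_1^'n^'n) = 0"
  using det_0[where 'n = 'n and 'a = 'a] by (simp add: mat_def zero_vec_def)

text \<open>\<open>G\<close> is injective, its derivative has positive determinant, and its range is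
  \<open>L\<close> up to a null set, so the change of variables formula applies over the whole
  space.\<close>

lemma volume_weighted_sum_has_integral:
  fixes K :: "'i \<Rightarrow> (real^'n::{finite,wellorder}) set"
  assumes I: "finite I"
    and body: "\<And>i. i \<in> I \<Longrightarrow> compact (K i)" "\<And>i. i \<in> I \<Longrightarrow> convex (K i)" "\<And>i. i \<in> I \<Longrightarrow> interior (K i) \<noteq> {}"
    and t: "\<And>i. i \<in> I \<Longrightarrow> 0 \<le> t i"
  shows "((\<lambda>x. det (\<Sum>i\<in>I. t i *\<^sub>R matrix (gradient_map_deriv (K i) x))) has_integral
    measure lebesgue (\<Sum>i\<in>I. (\<lambda>x. t i *\<^sub>R x) ` K i)) UNIV"
proof (cases "\<exists>i\<in>I. 0 < t i")
  case True
  then interpret weighted_bodies I K t by unfold_locales (use assms in auto)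
  have m: "matrix (G' x) = (\<Sum>i\<in>I. t i *\<^sub>R matrix (gradient_map_deriv (K i) x))" for x
    by (simp add: matrix_def G'_def vec_eq_iff)
  have lin: "linear (G' x)" for x by (rule has_derivative_linear[OF G_has_derivative])
  have "0 < det (matrix (G' x))" for x
    using G'_pos by (intro det_pos_of_positive_definite) (simp add: fun_cong[OF matrix_vector_mul(2)[OF lin]])
  moreover have "((\<lambda>x. \<bar>det (matrix (G' x))\<bar>) has_integral measure lebesgue L) UNIV"
    using has_measure_differentiable_image[of UNIV G G' "measure lebesgue L"] G_has_derivative inj_G measure_range_G
    by auto
  ultimately show ?thesis by (simp add: m L_def less_imp_le abs_of_pos)
next
  \<comment> \<open>All weights vanish: the Minkowski combination is the single point 0 and the
    integrand is the determinant of the zero matrix.\<close>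
  case False
  then have t0: "t i = 0" if "i \<in> I" for i using t[OF that] that by force
  have "(\<lambda>x. t i *\<^sub>R x) ` K i = 0" if "i \<in> I" for i
    using body(3)[OF that] interior_subset t0[OF that] by (force simp: set_zero)
  then have "(\<Sum>i\<in>I. (\<lambda>x. t i *\<^sub>R x) ` K i) = 0" by (intro sum.neutral ballI)
  then have "(\<Sum>i\<in>I. (\<lambda>x. t i *\<^sub>R x) ` K i) = {0}" by (simp only: set_zero)
  moreover have "(\<Sum>i\<in>I. t i *\<^sub>R matrix (gradient_map_deriv (K i) x)) = 0" for x by (simp add: t0)
  ultimately show ?thesis by (simp add: det_zero_matrix)
qed

text \<open>Expanding along the rows chooses one index per row. The rows are numbered by an
  arbitrary enumeration \<open>b\<close>, so \<open>c\<close> is in general not symmetric; being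
  obtained before t, it does not depend on t.\<close>

lemma det_weighted_sum:
  fixes A :: "'i \<Rightarrow> real^'n^'n"
  assumes I: "finite I"
  obtains c where "\<And>t. det (\<Sum>i\<in>I. t i *\<^sub>R A i) = (\<Sum>f\<in>PiE {..<CARD('n)} (\<lambda>_. I). (\<Prod>j<CARD('n). t (f j)) * c f)"
proof -
  obtain b :: "'n \<Rightarrow> nat" where b: "bij_betw b UNIV {..<CARD('n)}"
    using ex_bij_betw_finite_nat[of "UNIV :: 'n set"] by (auto simp: atLeast0LessThan)
  define b' where "b' = inv_into UNIV b"
  have b': "b (b' j) = j" "b' (b r) = r" if "j < CARD('n)" for j r
    using b that by (auto simp: b'_def bij_betw_def f_inv_into_f)
  define c where "c f = det (\<chi> r. A (f (b r)) $ r)" for f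
  show ?thesis
  proof (rule that)
    fix t :: "'i \<Rightarrow> real"
    let ?P = "{p. p permutes (UNIV :: 'n set)}" and ?G = "{g. \<forall>r\<in>UNIV. g r \<in> I} :: ('n \<Rightarrow> 'i) set"
    have "det (\<Sum>i\<in>I. t i *\<^sub>R A i) = (\<Sum>p\<in>?P. of_int (sign p) * (\<Prod>r\<in>UNIV. \<Sum>i\<in>I. t i * A i $ r $ p r))"
      by (simp add: det_def)
    also have "\<dots> = (\<Sum>p\<in>?P. of_int (sign p) * (\<Sum>g\<in>?G. \<Prod>r\<in>UNIV. t (g r) * A (g r) $ r $ p r))"
      using I by (subst prod_sum_PiE) (auto simp: PiE_def Pi_def)
    also have "\<dots> = (\<Sum>g\<in>?G. (\<Prod>r\<in>UNIV. t (g r)) * det (\<chi> r. A (g r) $ r))"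
      unfolding sum_distrib_left det_def
      by (subst sum.swap) (simp add: prod.distrib mult_ac)
    also have "\<dots> = (\<Sum>f\<in>PiE {..<CARD('n)} (\<lambda>_. I). (\<Prod>j<CARD('n). t (f j)) * c f)"
    proof (rule sum.reindex_bij_witness[of _ "\<lambda>f r. f (b r)" "\<lambda>g. restrict (g \<circ> b') {..<CARD('n)}"])
      have lt: "b r < CARD('n)" for r using b by (auto simp: bij_betw_def)
      fix f assume "f \<in> PiE {..<CARD('n)} (\<lambda>_. I)"
      then show "(\<lambda>r. f (b r)) \<in> {g. \<forall>r\<in>UNIV. g r \<in> I}"
        "restrict ((\<lambda>r. f (b r)) \<circ> b') {..<CARD('n)} = f"
        using lt b' by (auto simp: PiE_iff extensional_def restrict_def fun_eq_iff)
    next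
      have lt: "b r < CARD('n)" for r using b by (auto simp: bij_betw_def)
      fix g :: "'n \<Rightarrow> 'i" assume g: "g \<in> {g. \<forall>r\<in>UNIV. g r \<in> I}"
      then show
        "restrict (g \<circ> b') {..<CARD('n)} \<in> PiE {..<CARD('n)} (\<lambda>_. I)" by auto
      show e: "(\<lambda>r. restrict (g \<circ> b') {..<CARD('n)} (b r)) = g"
        using lt b'(2)[OF lt] by auto
      have "(\<Prod>j<CARD('n). t (g (b' j))) = (\<Prod>r\<in>UNIV. t (g (b' (b r))))"
        using prod.reindex_bij_betw[OF b, of "\<lambda>j. t (g (b' j))"] by simp
      also have "\<dots> = (\<Prod>r\<in>UNIV. t (g r))" using b'(2)[OF lt] by simp
      finally show "(\<Prod>j<CARD('n). t (restrict (g \<circ> b') {..<CARD('n)} j)) * c (restrict (g \<circ> b') {..<CARD('n)}) =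
        (\<Prod>r\<in>UNIV. t (g r)) * det (\<chi> r. A (g r) $ r)"
        using e by (simp add: c_def fun_eq_iff)
    qed
    finally show "det (\<Sum>i\<in>I. t i *\<^sub>R A i) = (\<Sum>f\<in>PiE {..<CARD('n)} (\<lambda>_. I). (\<Prod>j<CARD('n). t (f j)) * c f)" .
  qed
qed

text \<open>For each x the determinant is rewritten by \<open>polarization_recovers_form\<close>
  through determinants of unweighted sums. Those integrate to volumes, so the polarization of the
  volume appears without any integrability of the coefficients \<open>c\<close>.\<close>

lemma volume_weighted_sum_vec:
  fixes K :: "'i \<Rightarrow> (real^'n::{finite,wellorder}) set"
  assumes I: "finite I"
    and body: "\<And>i. i \<in> I \<Longrightarrow> compact (K i)" "\<And>i. i \<in> I \<Longrightarrow> convex (K i)" "\<And>i. i \<in> I \<Longrightarrow> interior (K i) \<noteq> {}"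
    and t: "\<And>i. i \<in> I \<Longrightarrow> 0 \<le> t i"
  shows "measure lebesgue (\<Sum>i\<in>I. (\<lambda>x. t i *\<^sub>R x) ` K i) =
    (\<Sum>f\<in>PiE {..<CARD('n)} (\<lambda>_. I). (\<Prod>j<CARD('n). t (f j)) *
       polarization CARD('n) (\<lambda>J. measure lebesgue (\<Sum>j\<in>J. K (f j))))"
proof -
  let ?n = "CARD('n)" and ?F = "PiE {..<CARD('n)} (\<lambda>_. I)"
  define A where "A i x = matrix (gradient_map_deriv (K i) x)" for i x
  have "((\<lambda>x. \<Sum>f\<in>?F. (\<Prod>j<?n. t (f j)) * polarization ?n (\<lambda>J. det (\<Sum>j\<in>J. A (f j) x))) has_integral
    (\<Sum>f\<in>?F. (\<Prod>j<?n. t (f j)) * polarization ?n (\<lambda>J. measure lebesgue (\<Sum>j\<in>J. K (f j))))) UNIV"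
  proof (intro has_integral_sum has_integral_mult_right)
    show "finite ?F" using I by (simp add: finite_PiE)
    fix f assume f: "f \<in> ?F"
    show "((\<lambda>x. polarization ?n (\<lambda>J. det (\<Sum>j\<in>J. A (f j) x))) has_integral
       polarization ?n (\<lambda>J. measure lebesgue (\<Sum>j\<in>J. K (f j)))) UNIV"
      unfolding polarization_def divide_inverse
    proof (intro has_integral_sum has_integral_mult_right has_integral_mult_left)
      fix J assume "J \<in> Pow {..<?n}"
      then show "((\<lambda>x. det (\<Sum>j\<in>J. A (f j) x)) has_integral measure lebesgue (\<Sum>j\<in>J. K (f j))) UNIV"
        using volume_weighted_sum_has_integral[of J "\<lambda>j. K (f j)" "\<lambda>_. 1"] f body
        finite_subset[of J "{..<?n}"]
        by (auto simp: A_def PiE_iff subset_iff)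
    qed simp
  qed
  moreover have "(\<Sum>f\<in>?F. (\<Prod>j<?n. t (f j)) * polarization ?n (\<lambda>J. det (\<Sum>j\<in>J. A (f j) x))) =
    det (\<Sum>i\<in>I. t i *\<^sub>R A i x)" for x
  proof -
    obtain c where c: "\<And>t. det (\<Sum>i\<in>I. t i *\<^sub>R A i x) = (\<Sum>f\<in>?F. (\<Prod>j<?n. t (f j)) * c f)"
      using det_weighted_sum[OF I, of "\<lambda>i. A i x"] by blast
    \<comment> \<open>Repetitions among the f j are collected: the matrix with index i is counted
      once for each j in \<open>J\<close> with f j = i.\<close>
    have "(\<Sum>j\<in>J. A (f j) x) = (\<Sum>i\<in>I. (\<Sum>j\<in>J. of_bool (f j = i)) *\<^sub>R A i x)"
      if f: "f \<in> ?F" and J: "J \<subseteq> {..<?n}" for f J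
    proof -
      have "(\<Sum>i\<in>I. (\<Sum>j\<in>J. of_bool (f j = i)) *\<^sub>R A i x) = (\<Sum>j\<in>J. \<Sum>i\<in>I. of_bool (f j = i) *\<^sub>R A i x)"
        unfolding scaleR_sum_left by (rule sum.swap)
      also have "\<dots> = (\<Sum>j\<in>J. A (f j) x)"
      proof (rule sum.cong)
        fix j assume "j \<in> J"
        then have "f j \<in> I" using f J by auto
        moreover have "(\<Sum>i\<in>I. of_bool (f j = i) *\<^sub>R A i x) = (\<Sum>i\<in>I. if i = f j then A i x else 0)"
          by (intro sum.cong) auto
        ultimately show "(\<Sum>i\<in>I. of_bool (f j = i) *\<^sub>R A i x) = A (f j) x" using I by simp
      qed simp
      finally show ?thesis ..
    qed
    then show ?thesis
      unfolding c[of t] polarization_recovers_form[OF I, where n = ?n and t = t and c = c] c[symmetric]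
      by (intro sum.cong arg_cong2[where f = "(*)"] polarization_cong) (auto simp: c)
  qed
  ultimately have "((\<lambda>x. det (\<Sum>i\<in>I. t i *\<^sub>R A i x)) has_integral
    (\<Sum>f\<in>?F. (\<Prod>j<?n. t (f j)) * polarization ?n (\<lambda>J. measure lebesgue (\<Sum>j\<in>J. K (f j))))) UNIV"
    by simp
  moreover have "((\<lambda>x. det (\<Sum>i\<in>I. t i *\<^sub>R A i x)) has_integral measure lebesgue (\<Sum>i\<in>I. (\<lambda>x. t i *\<^sub>R x) ` K i)) UNIV"
    unfolding A_def by (rule volume_weighted_sum_has_integral[OF assms])
  ultimately show ?thesis by (rule has_integral_unique[symmetric])
qed

text \<open>The change of variables above takes place in \<open>real^'n\<close> with a finite
  well-ordered index type. This type is such an index with as many elements as the dimension, so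
  that coordinates carry an arbitrary Euclidean space there.\<close>

typedef (overloaded) ('a::euclidean_space) basis_index = "{..<DIM('a)}"
  using DIM_positive by blast

instantiation basis_index :: (euclidean_space) "{finite, wellorder}"
begin

definition less_eq_basis_index :: "'a basis_index \<Rightarrow> 'a basis_index \<Rightarrow> bool" where
  "less_eq_basis_index x y \<longleftrightarrow> Rep_basis_index x \<le> Rep_basis_index y"
definition less_basis_index :: "'a basis_index \<Rightarrow> 'a basis_index \<Rightarrow> bool" where
  "less_basis_index x y \<longleftrightarrow> Rep_basis_index x < Rep_basis_index y"

instance
proof
  show "finite (UNIV :: 'a basis_index set)"
  proof -
    have eq: "(UNIV :: 'a basis_index set) = Abs_basis_index ` {..<DIM('a)}"
      by (rule type_definition.univ[OF type_definition_basis_index])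
    show ?thesis by (subst eq) simp
  qed
  fix P :: "'a basis_index \<Rightarrow> bool" and a :: "'a basis_index"
  assume step: "\<And>x. (\<And>y. y < x \<Longrightarrow> P y) \<Longrightarrow> P x"
  show "P a"
  proof (induction a rule: measure_induct_rule[of Rep_basis_index])
    case (less x)
    then show ?case unfolding less_basis_index_def[symmetric] by (rule step)
  qed
qed (auto simp: less_eq_basis_index_def less_basis_index_def Rep_basis_index_inject)

end

lemma card_basis_index: "CARD('a::euclidean_space basis_index) = DIM('a)"
  using type_definition.card[OF type_definition_basis_index] by simp

definition basis_vector :: "'a::euclidean_space basis_index \<Rightarrow> 'a" where
  "basis_vector = (SOME b. bij_betw b UNIV Basis)"

lemma bij_basis_vector: "bij_betw basis_vector (UNIV :: 'a::euclidean_space basis_index set) Basis"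
proof -
  have "\<exists>b. bij_betw b (UNIV :: 'a basis_index set) (Basis :: 'a set)"
    by (rule finite_same_card_bij) (auto simp: card_basis_index)
  then show ?thesis unfolding basis_vector_def by (rule someI_ex)
qed

definition coords :: "'a::euclidean_space \<Rightarrow> real ^ 'a basis_index" where
  "coords x = (\<chi> i. x \<bullet> basis_vector i)"

definition from_coords :: "real ^ ('a::euclidean_space basis_index) \<Rightarrow> 'a" where
  "from_coords v = (\<Sum>i\<in>UNIV. v $ i *\<^sub>R basis_vector i)"

lemma basis_vector_mem: "basis_vector i \<in> Basis"
  using bij_basis_vector by (auto simp: bij_betw_def)

lemma inner_basis_vector: "basis_vector i \<bullet> basis_vector j = of_bool (i = j)"
  using bij_basis_vector basis_vector_mem[of i] basis_vector_mem[of j]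
  by (auto simp: inner_Basis bij_betw_def inj_on_def)

lemma from_coords_coords [simp]: "from_coords (coords x) = x"
  unfolding from_coords_def coords_def
  using sum.reindex_bij_betw[OF bij_basis_vector, of "\<lambda>b. (x \<bullet> b) *\<^sub>R b"] by (simp add: euclidean_representation)

lemma from_coords_inner: "from_coords v \<bullet> basis_vector j = v $ j"
  by (simp add: from_coords_def inner_sum_left inner_basis_vector of_bool_def if_distrib cong: if_cong)

lemma coords_from_coords [simp]: "coords (from_coords v) = v"
  by (simp add: coords_def vec_eq_iff from_coords_inner)

lemma linear_coords: "linear coords"
  by (rule linearI) (auto simp: coords_def vec_eq_iff inner_add_left)

lemma linear_from_coords: "linear from_coords"
  by (rule linearI) (auto simp: from_coords_def scaleR_add_left sum.distrib scaleR_sum_right)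

lemma coords_image_eq_vimage: "coords ` S = from_coords -` S"
  by (force simp: image_iff)

text \<open>Lebesgue measure is determined by its values on boxes, and coordinates with respect to
  the standard basis carry boxes to boxes with the same side lengths.\<close>

lemma lborel_eq_distr_from_coords:
  "(lborel :: 'a::euclidean_space measure) = distr lborel borel from_coords"
proof (rule lborel_eqI)
  have m [measurable]: "from_coords \<in> borel_measurable (borel :: (real ^ ('a basis_index)) measure)"
    by (intro borel_measurable_continuous_onI linear_continuous_on linear_conv_bounded_linear[THEN iffD1] linear_from_coords)
  fix l u :: 'a assume lu: "\<And>b. b \<in> Basis \<Longrightarrow> l \<bullet> b \<le> u \<bullet> b"
  have "from_coords -` box l u = box (coords l) (coords u)"
  proof -
    have all: "(\<forall>b\<in>Basis. P b) \<longleftrightarrow> (\<forall>i. P (basis_vector i))" for P :: "'a \<Rightarrow> bool"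
      using bij_basis_vector by (metis bij_betw_def basis_vector_mem imageE)
    have "x \<in> from_coords -` box l u \<longleftrightarrow> x \<in> box (coords l) (coords u)" for x
      by (simp only: vimage_eq mem_box_cart(1)) (simp add: mem_box(1) all from_coords_inner coords_def)
    then show ?thesis by blast
  qed
  then have "emeasure (distr lborel borel from_coords) (box l u) = emeasure lborel (box (coords l) (coords u))"
    by (simp add: emeasure_distr)
  also have "\<dots> = ennreal (\<Prod>b\<in>Basis. (coords u - coords l) \<bullet> b)"
  proof (rule emeasure_lborel_box)
    fix b :: "real ^ 'a basis_index" assume "b \<in> Basis"
    then obtain i where "b = axis i 1" by (auto simp: Basis_vec_def)
    then show "coords l \<bullet> b \<le> coords u \<bullet> b" using lu[OF basis_vector_mem] by (simp add: inner_axis coords_def)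
  qed
  also have "(\<Prod>b\<in>Basis. (coords u - coords l) \<bullet> b) = (\<Prod>i\<in>UNIV. (coords u - coords l) \<bullet> axis i 1)"
  proof -
    have "bij_betw (\<lambda>i. axis i (1::real)) UNIV (Basis :: (real ^ 'a basis_index) set)"
      by (auto simp: bij_betw_def inj_on_def Basis_vec_def axis_eq_axis)
    then show ?thesis by (rule prod.reindex_bij_betw[symmetric])
  qed
  also have "\<dots> = (\<Prod>i\<in>UNIV. (u - l) \<bullet> basis_vector i)"
    by (simp add: inner_axis coords_def inner_diff_left)
  also have "\<dots> = (\<Prod>b\<in>Basis. (u - l) \<bullet> b)"
    by (rule prod.reindex_bij_betw[OF bij_basis_vector])
  finally show "emeasure (distr lborel borel from_coords) (box l u) = ennreal (\<Prod>b\<in>Basis. (u - l) \<bullet> b)" .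
qed simp

lemma measure_coords_image:
  assumes "compact S"
  shows "measure lebesgue (coords ` S) = measure lebesgue S"
proof -
  have m: "from_coords \<in> borel_measurable (borel :: (real ^ ('a basis_index)) measure)"
    by (intro borel_measurable_continuous_onI linear_continuous_on linear_conv_bounded_linear[THEN iffD1] linear_from_coords)
  have S: "S \<in> sets borel" using assms by (simp add: borel_compact)
  have "measure lborel S = measure (distr lborel borel from_coords) S"
    by (simp flip: lborel_eq_distr_from_coords)
  also have "\<dots> = measure lborel (from_coords -` S)"
    using m S by (simp add: measure_distr)
  finally have "measure lborel (from_coords -` S) = measure lborel S" ..
  then show ?thesis
    unfolding coords_image_eq_vimage using S measurable_sets[OF m S] by simp
qed

lemma linear_image_sum_sets:
  fixes S :: "'i \<Rightarrow> 'a::real_vector set" and g :: "'a \<Rightarrow> 'b::real_vector"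
  assumes "linear g" "finite I"
  shows "g ` (\<Sum>i\<in>I. S i) = (\<Sum>i\<in>I. g ` S i)"
  using assms(2)
proof (induction I rule: finite_induct)
  case empty
  then show ?case using linear_0[OF assms(1)] by (simp add: set_zero)
next
  case (insert i I)
  have "g ` (A + B) = g ` A + g ` B" for A B
  proof
    show "g ` (A + B) \<subseteq> g ` A + g ` B"
      by (auto elim!: set_plus_elim simp: linear_add[OF assms(1)] intro!: set_plus_intro)
    show "g ` A + g ` B \<subseteq> g ` (A + B)"
      by (auto elim!: set_plus_elim simp: linear_add[OF assms(1), symmetric] intro!: imageI set_plus_intro)
  qed
  then show ?case using insert by simp
qed

abbreviation scale_set :: "real \<Rightarrow> 'a::real_vector set \<Rightarrow> 'a set" where
  "scale_set a S \<equiv> (\<lambda>x. a *\<^sub>R x) ` S"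

text \<open>The inclusion-exclusion formula for mixed volumes, total in \<open>K\<close> and
  dependent only on as many initial terms as the dimension. The empty \<open>J\<close> stands for
  the point 0, which has volume zero.\<close>

definition mixed_vol :: "(nat \<Rightarrow> 'a::euclidean_space set) \<Rightarrow> real" where
  "mixed_vol K = polarization DIM('a) (\<lambda>J. measure lebesgue (\<Sum>j\<in>J. K j))"

theorem volume_weighted_sum:
  fixes K :: "'i \<Rightarrow> 'a::euclidean_space set"
  assumes I: "finite I" and body: "\<And>i. i \<in> I \<Longrightarrow> convex_body (K i)" and t: "\<And>i. i \<in> I \<Longrightarrow> 0 \<le> t i"
  shows "measure lebesgue (\<Sum>i\<in>I. scale_set (t i) (K i)) =
    (\<Sum>f\<in>PiE {..<DIM('a)} (\<lambda>_. I). (\<Prod>j<DIM('a). t (f j)) * mixed_vol (\<lambda>j. K (f j)))"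
proof -
  let ?K = "\<lambda>i. coords ` K i"
  have lin: "bounded_linear (coords :: 'a \<Rightarrow> _)" "bounded_linear (from_coords :: _ \<Rightarrow> 'a)"
    using linear_coords linear_from_coords by (auto simp: linear_conv_bounded_linear)
  have K: "compact (K i)" "convex (K i)" "interior (K i) \<noteq> {}" if "i \<in> I" for i
    using body[OF that] by (auto simp: convex_body_def)
  have K': "compact (?K i)" "convex (?K i)" "interior (?K i) \<noteq> {}" if i: "i \<in> I" for i
  proof -
    show "compact (?K i)"
      by (intro compact_continuous_image linear_continuous_on lin K i)
    show "convex (?K i)" by (intro convex_linear_image linear_coords K i)
    have "open (from_coords -` interior (K i))"
      by (intro open_vimage open_interior linear_continuous_on lin)
    moreover have "from_coords -` interior (K i) \<subseteq> ?K i"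
      unfolding coords_image_eq_vimage using interior_subset by blast
    ultimately have "from_coords -` interior (K i) \<subseteq> interior (?K i)" by (rule interior_maximal[rotated])
    moreover have "from_coords -` interior (K i) \<noteq> {}"
      using K(3)[OF i] from_coords_coords by (metis vimage_eq ex_in_conv)
    ultimately show "interior (?K i) \<noteq> {}" by auto
  qed
  have vol: "measure lebesgue (\<Sum>i\<in>J. coords ` S i) = measure lebesgue (\<Sum>i\<in>J. S i)"
    if "finite J" "\<And>i. i \<in> J \<Longrightarrow> compact (S i)" for J :: "'j set" and S :: "'j \<Rightarrow> 'a set"
    using that by (simp flip: linear_image_sum_sets[OF linear_coords] add: measure_coords_image compact_sum_sets)
  have "measure lebesgue (\<Sum>i\<in>I. scale_set (t i) (K i)) = measure lebesgue (\<Sum>i\<in>I. coords ` scale_set (t i) (K i))"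
    using I K by (subst vol) (auto intro: compact_scaling)
  also have "\<dots> = measure lebesgue (\<Sum>i\<in>I. scale_set (t i) (?K i))"
    by (simp add: image_image linear_cmul[OF linear_coords])
  also have "\<dots> = (\<Sum>f\<in>PiE {..<DIM('a)} (\<lambda>_. I). (\<Prod>j<DIM('a). t (f j)) *
       polarization DIM('a) (\<lambda>J. measure lebesgue (\<Sum>j\<in>J. ?K (f j))))"
    using volume_weighted_sum_vec[OF I K' t] by (simp add: card_basis_index)
  also have "\<dots> = (\<Sum>f\<in>PiE {..<DIM('a)} (\<lambda>_. I). (\<Prod>j<DIM('a). t (f j)) * mixed_vol (\<lambda>j. K (f j)))"
    unfolding mixed_vol_def
    using K by (intro sum.cong arg_cong2[where f = "(*)"] polarization_cong vol) (auto intro: finite_subset simp: PiE_iff)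
  finally show ?thesis .
qed

section \<open>Symmetry and multilinearity of the polarized volume\<close>

lemma mixed_vol_cong:
  fixes K :: "nat \<Rightarrow> 'a::euclidean_space set"
  shows "(\<And>i. i < DIM('a) \<Longrightarrow> K i = L i) \<Longrightarrow> mixed_vol K = mixed_vol L"
  unfolding mixed_vol_def
  by (intro polarization_cong arg_cong[where f = "measure lebesgue"] sum.cong) auto

lemma mixed_vol_permute:
  fixes K :: "nat \<Rightarrow> 'a::euclidean_space set"
  assumes p: "p permutes {..<DIM('a)}"
  shows "mixed_vol (\<lambda>i. K (p i)) = mixed_vol K"
proof -
  let ?n = "DIM('a)"
  have inj: "inj p" using p by (rule permutes_inj)
  have "(\<Sum>J\<in>Pow {..<?n}. (- 1) ^ (?n - card J) * measure lebesgue (\<Sum>j\<in>J. K (p j))) =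
    (\<Sum>J\<in>Pow {..<?n}. (- 1) ^ (?n - card (p ` J)) * measure lebesgue (\<Sum>j\<in>p ` J. K j))"
    using inj by (intro sum.cong) (auto simp: card_image sum.reindex inj_on_subset)
  also have "\<dots> = (\<Sum>J\<in>Pow {..<?n}. (- 1) ^ (?n - card J) * measure lebesgue (\<Sum>j\<in>J. K j))"
  proof (rule sum.reindex_bij_betw)
    have "bij_betw p {..<?n} {..<?n}" using p by (rule permutes_imp_bij)
    then show "bij_betw ((`) p) (Pow {..<?n}) (Pow {..<?n})" by (rule bij_betw_Pow)
  qed
  finally show ?thesis by (simp add: mixed_vol_def polarization_def)
qed

text \<open>Convexity gives the inclusion of aS + bS in (a + b)S, by normalizing the weights to a
  convex combination. Nonemptiness matters at total weight zero, where the scaled set must be the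
  point 0 rather than empty.\<close>

lemma scale_set_sum:
  assumes "convex S" "S \<noteq> {}" "finite J" "\<And>j. j \<in> J \<Longrightarrow> 0 \<le> a j"
  shows "(\<Sum>j\<in>J. scale_set (a j) S) = scale_set (\<Sum>j\<in>J. a j) S"
  using assms(3,4)
proof (induction J rule: finite_induct)
  case empty
  then show ?case using assms(2) by (auto simp: set_zero)
next
  case (insert j J)
  define b where "b = (\<Sum>j\<in>J. a j)"
  have ab: "0 \<le> a j" "0 \<le> b" using insert by (auto simp: b_def intro: sum_nonneg)
  have "scale_set (a j) S + scale_set b S = scale_set (a j + b) S"
  proof
    show "scale_set (a j + b) S \<subseteq> scale_set (a j) S + scale_set b S"
      by (auto simp: scaleR_add_left intro: set_plus_intro)
    show "scale_set (a j) S + scale_set b S \<subseteq> scale_set (a j + b) S"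
    proof (cases "a j + b = 0")
      case True
      then have "a j = 0" "b = 0" using ab by auto
      then show ?thesis using assms(2) by (auto simp: set_plus_def)
    next
      case False
      show ?thesis
      proof
        fix z assume "z \<in> scale_set (a j) S + scale_set b S"
        then obtain x y where xy: "x \<in> S" "y \<in> S" "z = a j *\<^sub>R x + b *\<^sub>R y"
          by (auto simp: set_plus_def)
        have "(a j / (a j + b)) *\<^sub>R x + (b / (a j + b)) *\<^sub>R y \<in> S"
          using ab False by (intro convexD[OF assms(1) xy(1,2)]) (auto simp: add_divide_distrib[symmetric])
        moreover have "z = (a j + b) *\<^sub>R ((a j / (a j + b)) *\<^sub>R x + (b / (a j + b)) *\<^sub>R y)"
          using False by (simp add: xy(3) scaleR_add_right)
        ultimately show "z \<in> scale_set (a j + b) S" by blast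
      qed
    qed
  qed
  then show ?case using insert by (simp add: b_def)
qed

text \<open>The multilinear form with the mixed volumes of the \<open>K i\<close> as coefficients.
  The rows \<open>a l\<close> may have any sign here, whereas Minkowski combinations of bodies call
  for nonnegative weights.\<close>

definition mixed_form :: "'i set \<Rightarrow> ('i \<Rightarrow> 'a::euclidean_space set) \<Rightarrow> (nat \<Rightarrow> 'i \<Rightarrow> real) \<Rightarrow> real" where
  "mixed_form I K a = (\<Sum>f\<in>PiE {..<DIM('a)} (\<lambda>_. I). (\<Prod>l<DIM('a). a l (f l)) * mixed_vol (\<lambda>j. K (f j)))"

text \<open>The sum over l in J of the slots is again a combination of the \<open>K i\<close>, whose
  weights are sums of rows, so its volume is a polynomial in those sums. The coefficients are
  symmetric, and polarization returns the multilinear form.\<close>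

lemma mixed_vol_multilinear:
  fixes K :: "'i \<Rightarrow> 'a::euclidean_space set"
  assumes I: "finite I" and body: "\<And>i. i \<in> I \<Longrightarrow> convex_body (K i)"
    and a: "\<And>l i. l < DIM('a) \<Longrightarrow> i \<in> I \<Longrightarrow> 0 \<le> a l i"
  shows "mixed_vol (\<lambda>l. \<Sum>i\<in>I. scale_set (a l i) (K i)) = mixed_form I K a"
proof -
  have "mixed_vol (\<lambda>l. \<Sum>i\<in>I. scale_set (a l i) (K i)) =
    polarization DIM('a) (\<lambda>J. \<Sum>f\<in>PiE {..<DIM('a)} (\<lambda>_. I). (\<Prod>i<DIM('a). \<Sum>l\<in>J. a l (f i)) * mixed_vol (\<lambda>j. K (f j)))"
    unfolding mixed_vol_def[of "\<lambda>l. \<Sum>i\<in>I. scale_set (a l i) (K i)"]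
  proof (rule polarization_cong)
    fix J assume J: "J \<subseteq> {..<DIM('a)}"
    then have fin: "finite J" by (rule finite_subset) simp
    have nn: "0 \<le> (\<Sum>l\<in>J. a l i)" if "i \<in> I" for i
      using a J that by (intro sum_nonneg) auto
    have "(\<Sum>l\<in>J. \<Sum>i\<in>I. scale_set (a l i) (K i)) = (\<Sum>i\<in>I. \<Sum>l\<in>J. scale_set (a l i) (K i))"
      by (rule sum.swap)
    also have "\<dots> = (\<Sum>i\<in>I. scale_set (\<Sum>l\<in>J. a l i) (K i))"
    proof (rule sum.cong)
      fix i assume "i \<in> I"
      then show "(\<Sum>l\<in>J. scale_set (a l i) (K i)) = scale_set (\<Sum>l\<in>J. a l i) (K i)"
        using body[of i] a J fin by (intro scale_set_sum) (auto simp: convex_body_def)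
    qed simp
    finally show "measure lebesgue (\<Sum>l\<in>J. \<Sum>i\<in>I. scale_set (a l i) (K i)) =
      (\<Sum>f\<in>PiE {..<DIM('a)} (\<lambda>_. I). (\<Prod>i<DIM('a). \<Sum>l\<in>J. a l (f i)) * mixed_vol (\<lambda>j. K (f j)))"
      using volume_weighted_sum[where I = I and K = K, OF I body nn] by simp
  qed
  also have "\<dots> = mixed_form I K a"
    unfolding mixed_form_def
  proof (rule polarization_symmetric_form[OF I])
    fix p and f :: "nat \<Rightarrow> 'i" assume "p permutes {..<DIM('a)}"
    then show "mixed_vol (\<lambda>j. K ((f \<circ> p) j)) = mixed_vol (\<lambda>j. K (f j))"
      using mixed_vol_permute[of p "\<lambda>j. K (f j)"] by simp
  qed
  finally show ?thesis .
qed

section \<open>Mixed volumes\<close>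

text \<open>The symmetry required by \<open>mixed_volume_form\<close> ranges over all lists, so the
  default for lists of another length has to be invariant under permutations, as 0 is.\<close>

definition mixed_vol_list :: "'a::euclidean_space set list \<Rightarrow> real" where
  "mixed_vol_list Ks = (if length Ks = DIM('a) then mixed_vol ((!) Ks) else 0)"

lemma mixed_vol_list_map: "mixed_vol_list (map K [0..<DIM('a)]) = mixed_vol (K :: nat \<Rightarrow> 'a::euclidean_space set)"
  unfolding mixed_vol_list_def by simp (rule mixed_vol_cong, simp)

lemma mixed_volume_form_mixed_vol_list: "mixed_volume_form (mixed_vol_list :: 'a::euclidean_space set list \<Rightarrow> real)"
  unfolding mixed_volume_form_def
proof (intro conjI allI impI)
  fix Ks Ls :: "'a set list"
  assume eq: "mset Ks = mset Ls"
  then obtain p where p: "p permutes {..<length Ls}" "permute_list p Ls = Ks"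
    by (rule mset_eq_permutation)
  have len: "length Ks = length Ls" using eq by (rule mset_eq_length)
  show "mixed_vol_list Ks = mixed_vol_list Ls"
  proof (cases "length Ls = DIM('a)")
    case True
    have "mixed_vol ((!) Ks) = mixed_vol (\<lambda>i. Ls ! p i)"
      using p True by (intro mixed_vol_cong) (auto simp: permute_list_nth)
    also have "\<dots> = mixed_vol ((!) Ls)"
      using p True by (intro mixed_vol_permute) auto
    finally show ?thesis using len by (simp add: mixed_vol_list_def)
  qed (simp add: mixed_vol_list_def len)
next
  fix Ks :: "'a set list" and t :: "nat \<Rightarrow> real"
  assume *: "(\<forall>K\<in>set Ks. convex_body K) \<and> (\<forall>i<length Ks. 0 \<le> t i)"
  have "measure lebesgue (\<Sum>i<length Ks. scale_set (t i) (Ks ! i)) =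
    (\<Sum>f\<in>PiE {..<DIM('a)} (\<lambda>_. {..<length Ks}). (\<Prod>j<DIM('a). t (f j)) * mixed_vol (\<lambda>j. Ks ! f j))"
    using * by (intro volume_weighted_sum) auto
  also have "\<dots> = (\<Sum>f\<in>PiE {..<DIM('a)} (\<lambda>_. {..<length Ks}).
      prod_list (map t (map f [0..<DIM('a)])) * mixed_vol_list (map (\<lambda>j. Ks ! j) (map f [0..<DIM('a)])))"
  proof (intro sum.cong refl arg_cong2[where f = "(*)"])
    fix f
    show "(\<Prod>j<DIM('a). t (f j)) = prod_list (map t (map f [0..<DIM('a)]))"
      by (simp add: prod.distinct_set_conv_list[symmetric] atLeast0LessThan o_def)
    show "mixed_vol (\<lambda>j. Ks ! f j) = mixed_vol_list (map (\<lambda>j. Ks ! j) (map f [0..<DIM('a)]))"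
      using mixed_vol_list_map[of "\<lambda>j. Ks ! f j"] by (simp add: o_def)
  qed
  also have "\<dots> = (\<Sum>js | length js = DIM('a) \<and> set js \<subseteq> {..<length Ks}. prod_list (map t js) * mixed_vol_list (map (\<lambda>j. Ks ! j) js))"
    by (rule sum_lists_eq_sum_PiE[symmetric])
  finally show "measure lebesgue (\<Sum>i<length Ks. scale_set (t i) (Ks ! i)) =
    (\<Sum>js | length js = DIM('a) \<and> set js \<subseteq> {..<length Ks}. prod_list (map t js) * mixed_vol_list (map (\<lambda>j. Ks ! j) js))" .
qed

lemma mset_map_permute:
  assumes "p permutes {..<n}"
  shows "mset (map (\<lambda>i. f (p i)) [0..<n]) = mset (map f [0..<n])"
proof -
  have "mset (permute_list p (map f [0..<n])) = mset (map f [0..<n])"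
    using assms by (intro mset_permute_list) simp
  moreover have "permute_list p (map f [0..<n]) = map (\<lambda>i. f (p i)) [0..<n]"
    using assms permutes_in_image[OF assms] by (intro nth_equalityI) (auto simp: permute_list_nth)
  ultimately show ?thesis by simp
qed

text \<open>Weights 0 and 1 in Minkowski's equation give the volumes of all partial sums. Polarizing
  over these isolates the coefficient of the product of all the t i, which by symmetry of
  \<open>V\<close> is the value at \<open>Ks\<close>.\<close>

lemma mixed_volume_form_unique:
  fixes Ks :: "'a::euclidean_space set list"
  assumes V: "mixed_volume_form V" and len: "length Ks = DIM('a)" and body: "\<And>K. K \<in> set Ks \<Longrightarrow> convex_body K"
  shows "V Ks = mixed_vol_list Ks"
proof -
  let ?n = "DIM('a)" and ?F = "PiE {..<DIM('a)} (\<lambda>_. {..<DIM('a)})"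
  define c where "c f = V (map (\<lambda>i. Ks ! f i) [0..<?n])" for f
  have "mixed_vol ((!) Ks) = polarization ?n (\<lambda>J. \<Sum>f\<in>?F. (\<Prod>i<?n. \<Sum>j\<in>J. of_bool (f i = j)) * c f)"
    unfolding mixed_vol_def
  proof (rule polarization_cong)
    fix J assume J: "J \<subseteq> {..<?n}"
    have ne: "Ks ! i \<noteq> {}" if "i < ?n" for i
      using body[of "Ks ! i"] that len by (auto simp: convex_body_def)
    have fin: "finite J" using J by (rule finite_subset) simp
    \<comment> \<open>Weight 0 turns a nonempty body into the point 0, so the full sum with
      indicator weights is the partial sum.\<close>
    have "(\<Sum>j\<in>J. Ks ! j) = (\<Sum>i<?n. scale_set (of_bool (i \<in> J)) (Ks ! i))"
      using J ne by (intro sum.mono_neutral_cong_left) (auto simp: set_zero image_constant_conv)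
    also have "measure lebesgue \<dots> = (\<Sum>js | length js = ?n \<and> set js \<subseteq> {..<?n}.
       prod_list (map (\<lambda>i. of_bool (i \<in> J)) js) * V (map (\<lambda>j. Ks ! j) js))"
      using V[unfolded mixed_volume_form_def, THEN conjunct2, rule_format, of Ks "\<lambda>i. of_bool (i \<in> J)"] body len by auto
    also have "\<dots> = (\<Sum>f\<in>?F. prod_list (map (\<lambda>i. of_bool (i \<in> J)) (map f [0..<?n])) * V (map (\<lambda>j. Ks ! j) (map f [0..<?n])))"
      by (rule sum_lists_eq_sum_PiE)
    also have "\<dots> = (\<Sum>f\<in>?F. (\<Prod>i<?n. \<Sum>j\<in>J. of_bool (f i = j)) * c f)"
    proof (intro sum.cong refl arg_cong2[where f = "(*)"])
      fix f
      have "prod_list (map (\<lambda>i. of_bool (i \<in> J)) (map f [0..<?n])) = (\<Prod>i<?n. of_bool (f i \<in> J) :: real)"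
        by (simp add: prod.distinct_set_conv_list[symmetric] atLeast0LessThan o_def)
      also have "\<dots> = (\<Prod>i<?n. \<Sum>j\<in>J. of_bool (f i = j))"
      proof (rule prod.cong)
        fix i
        have "(\<Sum>j\<in>J. of_bool (f i = j)) = (\<Sum>j\<in>J. if j = f i then 1 else 0 :: real)" by (intro sum.cong) auto
        then show "of_bool (f i \<in> J) = (\<Sum>j\<in>J. of_bool (f i = j) :: real)" using fin by simp
      qed simp
      finally show "prod_list (map (\<lambda>i. of_bool (i \<in> J)) (map f [0..<?n])) = (\<Prod>i<?n. \<Sum>j\<in>J. of_bool (f i = j) :: real)" .
      show "V (map (\<lambda>j. Ks ! j) (map f [0..<?n])) = c f" by (simp add: c_def o_def)
    qed
    finally show "measure lebesgue (\<Sum>j\<in>J. Ks ! j) = (\<Sum>f\<in>?F. (\<Prod>i<?n. \<Sum>j\<in>J. of_bool (f i = j)) * c f)" .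
  qed
  also have "\<dots> = (\<Sum>f\<in>?F. (\<Prod>i<?n. of_bool (f i = i)) * c f)"
  proof (rule polarization_symmetric_form)
    fix p and f :: "nat \<Rightarrow> nat" assume "p permutes {..<?n}"
    then have "mset (map (\<lambda>i. Ks ! f (p i)) [0..<?n]) = mset (map (\<lambda>i. Ks ! f i) [0..<?n])"
      by (rule mset_map_permute)
    then show "c (f \<circ> p) = c f"
      using V by (simp add: mixed_volume_form_def c_def)
  qed simp
  also have "\<dots> = (\<Sum>f\<in>?F. if f = restrict id {..<?n} then c f else 0)"
  proof (rule sum.cong)
    fix f assume f: "f \<in> ?F"
    show "(\<Prod>i<?n. of_bool (f i = i)) * c f = (if f = restrict id {..<?n} then c f else 0)"
    proof (cases "f = restrict id {..<?n}")
      case False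
      have "\<exists>i<?n. f i \<noteq> i"
      proof (rule ccontr)
        assume "\<not> (\<exists>i<?n. f i \<noteq> i)"
        then have "f = restrict id {..<?n}"
          using f by (intro PiE_ext[where k = "{..<?n}" and s = "\<lambda>_. {..<?n}"]) auto
        with False show False ..
      qed
      then show ?thesis using False by (auto intro!: prod_zero)
    qed auto
  qed simp
  also have "\<dots> = c (restrict id {..<?n})" by (simp add: finite_PiE)
  also have "\<dots> = V Ks"
  proof -
    have "map (\<lambda>i. Ks ! restrict id {..<?n} i) [0..<?n] = Ks"
      using len by (intro nth_equalityI) auto
    then show ?thesis by (simp add: c_def)
  qed
  finally show ?thesis using len by (simp add: mixed_vol_list_def)
qed

lemma mixed_volume_eq:
  fixes Ks :: "'a::euclidean_space set list"
  assumes "length Ks = DIM('a)" "\<And>K. K \<in> set Ks \<Longrightarrow> convex_body K"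
  shows "mixed_volume Ks = mixed_vol ((!) Ks)"
proof -
  have "mixed_volume Ks = mixed_vol_list Ks"
    unfolding mixed_volume_def
    using mixed_volume_form_mixed_vol_list mixed_volume_form_unique[OF _ assms] by (intro the_equality) auto
  then show ?thesis using assms(1) by (simp add: mixed_vol_list_def)
qed

section \<open>Differences of convex bodies\<close>

lemma support_function_ge:
  "compact S \<Longrightarrow> x \<in> S \<Longrightarrow> x \<bullet> u \<le> support_function S u"
  unfolding support_function_def
  by (intro cSUP_upper bounded_imp_bdd_above compact_imp_bounded compact_continuous_image continuous_intros)

lemma support_function_le:
  "S \<noteq> {} \<Longrightarrow> (\<And>x. x \<in> S \<Longrightarrow> x \<bullet> u \<le> c) \<Longrightarrow> support_function S u \<le> c"
  unfolding support_function_def by (intro cSUP_least)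

lemma support_function_attained:
  assumes "compact S" "S \<noteq> {}"
  obtains x where "x \<in> S" "support_function S u = x \<bullet> u"
proof -
  have "continuous_on S (\<lambda>y. y \<bullet> u)" by (intro continuous_intros)
  then obtain x where "x \<in> S" "\<And>y. y \<in> S \<Longrightarrow> y \<bullet> u \<le> x \<bullet> u"
    using continuous_attains_sup[OF assms] by blast
  then have "support_function S u = x \<bullet> u"
    by (intro antisym support_function_ge support_function_le assms) auto
  then show ?thesis using that \<open>x \<in> S\<close> by blast
qed

lemma support_function_plus:
  assumes "compact S" "S \<noteq> {}" "compact T" "T \<noteq> {}"
  shows "support_function (S + T) u = support_function S u + support_function T u"
proof (rule antisym)
  show "support_function (S + T) u \<le> support_function S u + support_function T u"
    using assms by (intro support_function_le)
      (auto elim!: set_plus_elim simp: inner_add_left set_plus_def intro!: add_mono support_function_ge)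
  obtain x y where xy: "x \<in> S" "support_function S u = x \<bullet> u" "y \<in> T" "support_function T u = y \<bullet> u"
    using support_function_attained assms by metis
  have "compact (S + T)" using compact_sums[OF assms(1,3)] by (simp add: set_plus_def Bex_def) (smt (verit) Collect_cong)
  then have "(x + y) \<bullet> u \<le> support_function (S + T) u"
    using xy by (intro support_function_ge set_plus_intro)
  then show "support_function S u + support_function T u \<le> support_function (S + T) u"
    using xy by (simp add: inner_add_left)
qed

lemma support_function_scale:
  assumes "compact S" "S \<noteq> {}" "0 \<le> a"
  shows "support_function (scale_set a S) u = a * support_function S u"
proof (rule antisym)
  show "support_function (scale_set a S) u \<le> a * support_function S u"
    using assms by (intro support_function_le) (auto intro!: mult_left_mono support_function_ge)
  obtain x where x: "x \<in> S" "support_function S u = x \<bullet> u"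
    using support_function_attained assms by metis
  have "(a *\<^sub>R x) \<bullet> u \<le> support_function (scale_set a S) u"
    using x assms by (intro support_function_ge compact_scaling) auto
  then show "a * support_function S u \<le> support_function (scale_set a S) u"
    using x by simp
qed

lemma support_function_cball: "norm u = 1 \<Longrightarrow> support_function (cball 0 1) u = 1"
proof (rule antisym)
  assume u: "norm u = 1"
  show "support_function (cball 0 1) u \<le> 1"
  proof (rule support_function_le)
    fix x :: 'a assume "x \<in> cball 0 1"
    then show "x \<bullet> u \<le> 1" using norm_cauchy_schwarz[of x u] u by simp
  qed simp
  show "1 \<le> support_function (cball 0 1) u"
    using support_function_ge[of "cball 0 1" u u] u by (simp add: dot_square_norm)
qed

lemma support_function_uminus: "support_function (uminus ` S) u = support_function S (- u)"
  by (simp add: support_function_def image_image)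

text \<open>A point of \<open>S\<close> outside \<open>T\<close> is separated from \<open>T\<close>
  by a hyperplane; the unit vector opposite to the normal \<open>a\<close> is then a direction
  violating the inequality.\<close>

lemma subset_of_support_function_le:
  assumes T: "compact T" "convex T" "T \<noteq> {}" and S: "compact S"
    and le: "\<And>u. norm u = 1 \<Longrightarrow> support_function S u \<le> support_function T u"
  shows "S \<subseteq> T"
proof (rule ccontr)
  assume "\<not> S \<subseteq> T"
  then obtain z where z: "z \<in> S" "z \<notin> T" by auto
  obtain a b where ab: "a \<bullet> z < b" "\<And>x. x \<in> T \<Longrightarrow> b < a \<bullet> x"
    using separating_hyperplane_closed_point[OF T(2) compact_imp_closed[OF T(1)] z(2)] by blast
  have "a \<noteq> 0" using ab T(3) by force
  define u where "u = (- (1 / norm a)) *\<^sub>R a"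
  have u: "norm u = 1" using \<open>a \<noteq> 0\<close> by (simp add: u_def)
  obtain x where x: "x \<in> T" "support_function T u = x \<bullet> u"
    using support_function_attained[OF T(1,3)] by blast
  have "z \<bullet> u \<le> x \<bullet> u"
    using support_function_ge[OF S z(1), of u] le[OF u] x(2) by simp
  then have "a \<bullet> x \<le> a \<bullet> z"
    using \<open>a \<noteq> 0\<close> by (simp add: u_def inner_commute divide_le_cancel field_simps)
  with ab x(1) show False by force
qed

lemma convex_body_plus:
  assumes "convex_body S" "convex_body T"
  shows "convex_body (S + T)"
proof -
  \<comment> \<open>The binary sum is written as a sum over bool to reuse the lemmas on finite
    sums.\<close>
  have "compact (\<Sum>i\<in>(UNIV::bool set). if i then S else T)" "convex (\<Sum>i\<in>(UNIV::bool set). if i then S else T)"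
    using assms by (intro compact_sum_sets convex_sum_sets; simp add: convex_body_def)+
  then have cc: "compact (S + T)" "convex (S + T)" by (simp_all add: UNIV_bool add.commute)
  obtain y where y: "y \<in> T" using assms(2) interior_subset by (force simp: convex_body_def)
  have "(+) y ` interior S \<subseteq> S + T"
    using y interior_subset[of S] by (force simp: add.commute[of y])
  then have "(+) y ` interior S \<subseteq> interior (S + T)"
    by (intro interior_maximal open_translation open_interior)
  then have "interior (S + T) \<noteq> {}" using assms(1) by (auto simp: convex_body_def)
  with cc show ?thesis by (simp add: convex_body_def)
qed

lemma convex_body_scale:
  assumes "convex_body S" "0 < a"
  shows "convex_body (scale_set a S)"
proof -
  have "scale_set a (interior S) \<subseteq> interior (scale_set a S)"
    using assms(2) by (intro interior_maximal image_mono interior_subset open_scaling) auto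
  then show ?thesis using assms by (auto simp: convex_body_def compact_scaling convex_scaling)
qed

lemma convex_body_ne: "convex_body S \<Longrightarrow> S \<noteq> {}"
  by (auto simp: convex_body_def)

text \<open>Moving the subtracted terms across turns equal differences into equal support functions
  of two genuine bodies, and those determine the bodies. This cancellation makes
  \<open>mixed_volume_ext\<close> independent of the representation.\<close>

lemma plus_eq_of_support_function:
  assumes "convex_body A" "convex_body B" "convex_body C" "convex_body D"
    and eq: "\<And>u. norm u = 1 \<Longrightarrow> support_function A u - support_function B u = support_function C u - support_function D u"
  shows "C + B = A + D"
proof -
  have sf: "support_function (C + B) u = support_function (A + D) u" if "norm u = 1" for u
    using eq[OF that] assms(1-4) by (simp add: support_function_plus convex_body_ne convex_body_def[of A] convex_body_def[of B] convex_body_def[of C] convex_body_def[of D])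
  have "convex_body (C + B)" "convex_body (A + D)" using assms by (auto intro: convex_body_plus)
  then show ?thesis
    using sf by (intro subset_antisym subset_of_support_function_le) (auto simp: convex_body_def)
qed

section \<open>Additivity in one slot and independence of the representation\<close>

lemma mixed_form_add_slot:
  fixes K :: "'i \<Rightarrow> 'a::euclidean_space set"
  assumes "m < DIM('a)"
  shows "mixed_form I K (a(m := \<lambda>i. u i + w i)) = mixed_form I K (a(m := u)) + mixed_form I K (a(m := w))"
proof -
  have split: "(\<Prod>l<DIM('a). (a(m := z)) l (f l)) = z (f m) * (\<Prod>l\<in>{..<DIM('a)} - {m}. a l (f l))" for z f
    using assms by (subst prod.remove[of _ m]) (auto intro!: prod.cong)
  show ?thesis
    unfolding mixed_form_def split by (simp add: sum.distrib distrib_right)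
qed

lemma sum_scale_set_of_bool:
  assumes "finite I" "k \<in> I" "\<And>i. i \<in> I \<Longrightarrow> K i \<noteq> {}"
  shows "(\<Sum>i\<in>I. scale_set (of_bool (i = k)) (K i)) = K k"
proof -
  have "(\<Sum>i\<in>I. scale_set (of_bool (i = k)) (K i)) = (\<Sum>i\<in>{k}. K i)"
    using assms by (intro sum.mono_neutral_cong_right) (auto simp: set_zero image_constant_conv)
  then show ?thesis by simp
qed

text \<open>Both summands and the remaining slots are expressed through one family of bodies, after
  which additivity is linearity of \<open>mixed_form\<close> in row m.\<close>

lemma mixed_vol_add_slot:
  fixes X :: "nat \<Rightarrow> 'a::euclidean_space set"
  assumes X: "\<And>l. l < DIM('a) \<Longrightarrow> convex_body (X l)" and AB: "convex_body A" "convex_body B" and m: "m < DIM('a)"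
  shows "mixed_vol (X(m := A + B)) = mixed_vol (X(m := A)) + mixed_vol (X(m := B))"
proof -
  let ?n = "DIM('a)"
  \<comment> \<open>The index m holds \<open>A\<close>, the extra index just past the slots holds
    \<open>B\<close>, and every other slot is its own body with the unit row
    \<open>e l\<close>.\<close>
  define K where "K = X(m := A, ?n := B)"
  have K: "K m = A" "K ?n = B" "\<And>l. l < ?n \<Longrightarrow> l \<noteq> m \<Longrightarrow> K l = X l"
    using m by (auto simp: K_def)
  define e where "e k i = (of_bool (i = k) :: real)" for k i :: nat
  have body: "convex_body (K i)" if "i \<in> {..?n}" for i
    using that X AB by (auto simp: K_def)
  have ne: "K i \<noteq> {}" if "i \<in> {..?n}" for i using body[OF that] by (rule convex_body_ne)
  have e: "(\<Sum>i\<le>?n. scale_set (e k i) (K i)) = K k" if "k \<le> ?n" for k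
    unfolding e_def using that ne by (intro sum_scale_set_of_bool) auto
  have form: "mixed_vol (\<lambda>l. \<Sum>i\<le>?n. scale_set (a l i) (K i)) = mixed_form {..?n} K a" if "\<And>l i. 0 \<le> a l i" for a
    using that body by (intro mixed_vol_multilinear) auto
  have 1: "mixed_vol (X(m := A)) = mixed_form {..?n} K (e(m := e m))"
  proof (subst form[symmetric])
    show "mixed_vol (X(m := A)) = mixed_vol (\<lambda>l. \<Sum>i\<le>?n. scale_set ((e(m := e m)) l i) (K i))"
      using m by (intro mixed_vol_cong) (auto simp: e K)
  qed (auto simp: e_def)
  have 2: "mixed_vol (X(m := B)) = mixed_form {..?n} K (e(m := e ?n))"
  proof (subst form[symmetric])
    show "mixed_vol (X(m := B)) = mixed_vol (\<lambda>l. \<Sum>i\<le>?n. scale_set ((e(m := e ?n)) l i) (K i))"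
      using m by (intro mixed_vol_cong) (auto simp: e K)
  qed (auto simp: e_def)
  have 3: "mixed_vol (X(m := A + B)) = mixed_form {..?n} K (e(m := \<lambda>i. e m i + e ?n i))"
  proof (subst form[symmetric])
    have "(\<Sum>i\<le>?n. scale_set (e m i + e ?n i) (K i)) = (\<Sum>i\<le>?n. scale_set (e m i) (K i)) + (\<Sum>i\<le>?n. scale_set (e ?n i) (K i))"
    proof (subst sum.distrib[symmetric], rule sum.cong)
      fix i assume "i \<in> {..?n}"
      then show "scale_set (e m i + e ?n i) (K i) = scale_set (e m i) (K i) + scale_set (e ?n i) (K i)"
        using scale_set_sum[of "K i" "UNIV :: bool set" "\<lambda>b. if b then e m i else e ?n i"] body[of i] ne[of i]
        by (simp add: UNIV_bool convex_body_def e_def add.commute)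
    qed simp
    then have "(\<Sum>i\<le>?n. scale_set (e m i + e ?n i) (K i)) = A + B"
      using m by (simp add: e K)
    then show "mixed_vol (X(m := A + B)) = mixed_vol (\<lambda>l. \<Sum>i\<le>?n. scale_set ((e(m := \<lambda>i. e m i + e ?n i)) l i) (K i))"
      using m by (intro mixed_vol_cong) (auto simp: e K)
  qed (auto simp: e_def)
  show ?thesis unfolding 1 2 3 by (rule mixed_form_add_slot[OF m])
qed

definition mixed_vol_diff :: "(nat \<Rightarrow> 'a::euclidean_space set) \<Rightarrow> (nat \<Rightarrow> 'a set) \<Rightarrow> real" where
  "mixed_vol_diff K L = (\<Sum>J\<in>Pow {..<DIM('a)}. (- 1) ^ card J * mixed_vol (\<lambda>i. if i \<in> J then L i else K i))"

lemma mixed_vol_diff_cong: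
  fixes K :: "nat \<Rightarrow> 'a::euclidean_space set"
  assumes "\<And>i. i < DIM('a) \<Longrightarrow> K i = K' i" "\<And>i. i < DIM('a) \<Longrightarrow> L i = L' i"
  shows "mixed_vol_diff K L = mixed_vol_diff K' L'"
  unfolding mixed_vol_diff_def using assms
  by (intro sum.cong arg_cong2[where f = "(*)"] mixed_vol_cong) auto

text \<open>Pairing each J without m with \<open>insert m J\<close> isolates the difference of two
  mixed volumes that differ only in slot m. Additivity in that slot converts A + L m = K m + B into
  equality of these differences.\<close>

lemma mixed_vol_diff_change_slot:
  fixes K :: "nat \<Rightarrow> 'a::euclidean_space set"
  assumes body: "\<And>l. l < DIM('a) \<Longrightarrow> convex_body (K l)" "\<And>l. l < DIM('a) \<Longrightarrow> convex_body (L l)"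
    and m: "m < DIM('a)" and AB: "convex_body A" "convex_body B" and eq: "A + L m = K m + B"
  shows "mixed_vol_diff (K(m := A)) (L(m := B)) = mixed_vol_diff K L"
proof -
  let ?P = "Pow ({..<DIM('a)} - {m})"
  let ?c = "\<lambda>K L J i. if i \<in> J then L i else K i :: 'a set"
  have split: "mixed_vol_diff K L = (\<Sum>J\<in>?P. (- 1) ^ card J *
     (mixed_vol ((?c K L J)(m := K m)) - mixed_vol ((?c K L J)(m := L m))))" for K L :: "nat \<Rightarrow> 'a set"
  proof -
    have P: "Pow {..<DIM('a)} = ?P \<union> insert m ` ?P"
      using Pow_insert[of m "{..<DIM('a)} - {m}"] m by (simp add: insert_absorb)
    have inj: "inj_on (insert m) ?P" by (auto simp: inj_on_def)
    have "mixed_vol_diff K L = (\<Sum>J\<in>?P. (- 1) ^ card J * mixed_vol (?c K L J)) + (\<Sum>J\<in>insert m ` ?P. (- 1) ^ card J * mixed_vol (?c K L J))"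
      unfolding mixed_vol_diff_def P by (rule sum.union_disjoint) auto
    also have "(\<Sum>J\<in>insert m ` ?P. (- 1) ^ card J * mixed_vol (?c K L J)) = (\<Sum>J\<in>?P. - ((- 1) ^ card J * mixed_vol ((?c K L J)(m := L m))))"
      unfolding sum.reindex[OF inj] o_def
    proof (rule sum.cong)
      fix J assume "J \<in> ?P"
      then have "m \<notin> J" "finite J" by (auto intro: finite_subset)
      moreover have "?c K L (insert m J) = (?c K L J)(m := L m)" by (auto simp: fun_eq_iff)
      ultimately show "(- 1) ^ card (insert m J) * mixed_vol (?c K L (insert m J)) = - ((- 1) ^ card J * mixed_vol ((?c K L J)(m := L m)))"
        by simp
    qed simp
    also have "(\<Sum>J\<in>?P. (- 1) ^ card J * mixed_vol (?c K L J)) = (\<Sum>J\<in>?P. (- 1) ^ card J * mixed_vol ((?c K L J)(m := K m)))"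
    proof (rule sum.cong)
      fix J assume "J \<in> ?P"
      then have "?c K L J = (?c K L J)(m := K m)" by (auto simp: fun_eq_iff)
      then show "(- 1) ^ card J * mixed_vol (?c K L J) = (- 1) ^ card J * mixed_vol ((?c K L J)(m := K m))" by simp
    qed simp
    finally show ?thesis by (simp only: sum_negf sum_subtractf right_diff_distrib add_uminus_conv_diff)
  qed
  show ?thesis
    unfolding split
  proof (rule sum.cong)
    fix J assume "J \<in> ?P"
    define X where "X = ?c K L J"
    have X: "convex_body (X l)" if "l < DIM('a)" for l using body[OF that] by (auto simp: X_def)
    have "mixed_vol (X(m := A)) + mixed_vol (X(m := L m)) = mixed_vol (X(m := K m)) + mixed_vol (X(m := B))"
      using mixed_vol_add_slot[OF X AB(1) body(2)[OF m] m] mixed_vol_add_slot[OF X body(1)[OF m] AB(2) m] eq by simp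
    moreover have "(?c (K(m := A)) (L(m := B)) J)(m := Z) = X(m := Z)" for Z by (auto simp: X_def fun_eq_iff)
    ultimately show "(- 1) ^ card J * (mixed_vol ((?c (K(m := A)) (L(m := B)) J)(m := (K(m := A)) m)) - mixed_vol ((?c (K(m := A)) (L(m := B)) J)(m := (L(m := B)) m))) =
      (- 1) ^ card J * (mixed_vol ((?c K L J)(m := K m)) - mixed_vol ((?c K L J)(m := L m)))"
      by (simp add: X_def[symmetric])
  qed simp
qed

lemma mixed_vol_diff_well_defined:
  fixes K :: "nat \<Rightarrow> 'a::euclidean_space set"
  assumes body: "\<And>l. l < DIM('a) \<Longrightarrow> convex_body (K l) \<and> convex_body (L l) \<and> convex_body (K' l) \<and> convex_body (L' l)"
    and eq: "\<And>l. l < DIM('a) \<Longrightarrow> K' l + L l = K l + L' l"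
  shows "mixed_vol_diff K' L' = mixed_vol_diff K L"
proof -
  \<comment> \<open>In \<open>H m\<close> the first m slots are already exchanged, so that the slots
    are replaced one at a time.\<close>
  define H where "H m A A' = (\<lambda>i. if i < m then A' i else A i :: 'a set)" for m :: nat and A A'
  have step: "m \<le> DIM('a) \<Longrightarrow> mixed_vol_diff (H m K K') (H m L L') = mixed_vol_diff K L" for m
  proof (induction m)
    case 0
    then show ?case by (simp add: H_def)
  next
    case (Suc m)
    have s: "H (Suc m) A A' = (H m A A')(m := A' m)" for A A' by (auto simp: H_def fun_eq_iff less_Suc_eq)
    have "mixed_vol_diff (H (Suc m) K K') (H (Suc m) L L') = mixed_vol_diff (H m K K') (H m L L')"
      unfolding s using Suc.prems body eq[of m] by (intro mixed_vol_diff_change_slot) (auto simp: H_def)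
    with Suc show ?case by simp
  qed
  have "mixed_vol_diff K' L' = mixed_vol_diff (H DIM('a) K K') (H DIM('a) L L')"
    by (rule mixed_vol_diff_cong) (auto simp: H_def)
  then show ?thesis using step[of "DIM('a)"] by simp
qed

text \<open>Cancellation gives every admissible pair of lists the same value, so the definite
  description may be computed from any chosen representation.\<close>

lemma mixed_volume_ext_eq:
  fixes fs :: "('a::euclidean_space \<Rightarrow> real) list"
  assumes len: "length fs = DIM('a)"
    and body: "\<And>l. l < DIM('a) \<Longrightarrow> convex_body (K l) \<and> convex_body (L l)"
    and fs: "\<And>l u. l < DIM('a) \<Longrightarrow> norm u = 1 \<Longrightarrow> (fs ! l) u = support_function (K l) u - support_function (L l) u"
  shows "mixed_volume_ext fs = mixed_vol_diff K L"
  unfolding mixed_volume_ext_def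
proof (rule the_equality)
  have val: "(\<Sum>J\<in>Pow {..<length fs}. (- 1) ^ card J * mixed_volume (map (\<lambda>i. if i \<in> J then Ls ! i else Ks ! i) [0..<length fs])) =
    mixed_vol_diff ((!) Ks) ((!) Ls)" if "\<forall>i<length fs. convex_body (Ks ! i) \<and> convex_body (Ls ! i)" for Ks Ls :: "'a set list"
    unfolding mixed_vol_diff_def len
  proof (intro sum.cong refl arg_cong2[where f = "(*)"])
    fix J
    have "mixed_volume (map (\<lambda>i. if i \<in> J then Ls ! i else Ks ! i) [0..<DIM('a)]) = mixed_vol ((!) (map (\<lambda>i. if i \<in> J then Ls ! i else Ks ! i) [0..<DIM('a)]))"
      using that len by (intro mixed_volume_eq) auto
    also have "\<dots> = mixed_vol (\<lambda>i. if i \<in> J then Ls ! i else Ks ! i)" by (rule mixed_vol_cong) auto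
    finally show "mixed_volume (map (\<lambda>i. if i \<in> J then Ls ! i else Ks ! i) [0..<DIM('a)]) = mixed_vol (\<lambda>i. if i \<in> J then Ls ! i else Ks ! i)" .
  qed
  let ?Ks = "map K [0..<DIM('a)]" and ?Ls = "map L [0..<DIM('a)]"
  show "\<exists>Ks Ls. length Ks = length fs \<and> length Ls = length fs \<and>
     (\<forall>i<length fs. convex_body (Ks ! i) \<and> convex_body (Ls ! i) \<and>
        (\<forall>u\<in>sphere 0 1. (fs ! i) u = support_function (Ks ! i) u - support_function (Ls ! i) u)) \<and>
     mixed_vol_diff K L = (\<Sum>J\<in>Pow {..<length fs}. (- 1) ^ card J *
            mixed_volume (map (\<lambda>i. if i \<in> J then Ls ! i else Ks ! i) [0..<length fs]))"
  proof (rule exI[of _ ?Ks], rule exI[of _ ?Ls], intro conjI)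
    have "mixed_vol_diff K L = mixed_vol_diff ((!) ?Ks) ((!) ?Ls)" by (rule mixed_vol_diff_cong) auto
    then show "mixed_vol_diff K L = (\<Sum>J\<in>Pow {..<length fs}. (- 1) ^ card J *
            mixed_volume (map (\<lambda>i. if i \<in> J then ?Ls ! i else ?Ks ! i) [0..<length fs]))"
      using body len by (subst val) auto
  qed (use len body fs in auto)
  fix v
  assume "\<exists>Ks Ls. length Ks = length fs \<and> length Ls = length fs \<and>
     (\<forall>i<length fs. convex_body (Ks ! i) \<and> convex_body (Ls ! i) \<and>
        (\<forall>u\<in>sphere 0 1. (fs ! i) u = support_function (Ks ! i) u - support_function (Ls ! i) u)) \<and>
     v = (\<Sum>J\<in>Pow {..<length fs}. (- 1) ^ card J *
            mixed_volume (map (\<lambda>i. if i \<in> J then Ls ! i else Ks ! i) [0..<length fs]))"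
  then obtain Ks Ls where Ks: "\<forall>i<length fs. convex_body (Ks ! i) \<and> convex_body (Ls ! i) \<and>
        (\<forall>u\<in>sphere 0 1. (fs ! i) u = support_function (Ks ! i) u - support_function (Ls ! i) u)"
    and v: "v = (\<Sum>J\<in>Pow {..<length fs}. (- 1) ^ card J *
            mixed_volume (map (\<lambda>i. if i \<in> J then Ls ! i else Ks ! i) [0..<length fs]))"
    by blast
  have *: "\<And>i. i < DIM('a) \<Longrightarrow> convex_body (Ks ! i) \<and> convex_body (Ls ! i)"
     "\<And>i u. i < DIM('a) \<Longrightarrow> norm u = 1 \<Longrightarrow> (fs ! i) u = support_function (Ks ! i) u - support_function (Ls ! i) u"
    using Ks len by auto
  have "v = mixed_vol_diff ((!) Ks) ((!) Ls)" unfolding v using *(1) len by (intro val) simp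
  also have "\<dots> = mixed_vol_diff K L"
  proof (rule mixed_vol_diff_well_defined)
    fix l assume l: "l < DIM('a)"
    show "Ks ! l + L l = K l + Ls ! l"
      using *(1)[OF l] body[OF l] *(2)[OF l] fs[OF l] by (intro plus_eq_of_support_function) auto
  qed (use *(1) body in auto)
  finally show "v = mixed_vol_diff K L" .
qed

section \<open>Bodies of constant width\<close>

definition two_body_volume :: "'a::euclidean_space set \<Rightarrow> 'a set \<Rightarrow> nat \<Rightarrow> real" where
  "two_body_volume K B k = mixed_vol (\<lambda>j. if j < k then K else B)"

text \<open>The linear functional sending x^i to \<open>v i\<close>. With \<open>v\<close> the mixed
  volumes of two bodies, computing with linear combinations in the slots becomes multiplication of
  polynomials in one variable, of degree at most \<open>n\<close> since there are n linear
  factors.\<close>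

definition umbral :: "nat \<Rightarrow> (nat \<Rightarrow> real) \<Rightarrow> real poly \<Rightarrow> real" where
  "umbral n v p = (\<Sum>i\<le>n. Polynomial.coeff p i * v i)"

lemma umbral_sum: "umbral n v (\<Sum>x\<in>A. p x) = (\<Sum>x\<in>A. umbral n v (p x))"
  unfolding umbral_def coeff_sum sum_distrib_right by (rule sum.swap)

lemma umbral_smult: "umbral n v (Polynomial.smult c p) = c * umbral n v p"
  by (simp add: umbral_def sum_distrib_left mult.assoc)

lemma umbral_monom: "k \<le> n \<Longrightarrow> umbral n v (Polynomial.monom c k) = c * v k"
  by (simp add: umbral_def if_distrib[of "\<lambda>x. x * _"] cong: if_cong)

lemma mset_map_if_const:
  "mset (map (\<lambda>j. if P j then x else y) [0..<n]) =
    replicate_mset (card {j. j < n \<and> P j}) x + replicate_mset (n - card {j. j < n \<and> P j}) y"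
proof (induction n)
  case (Suc n)
  have "{j. j < Suc n \<and> P j} = (if P n then insert n {j. j < n \<and> P j} else {j. j < n \<and> P j})"
    by (auto simp: less_Suc_eq)
  then have c: "card {j. j < Suc n \<and> P j} = card {j. j < n \<and> P j} + of_bool (P n)" by simp
  have "card {j. j < n \<and> P j} \<le> card {..<n}" by (intro card_mono) auto
  then have "card {j. j < n \<and> P j} \<le> n" by simp
  then show ?case using Suc by (simp add: c Suc_diff_le)
qed simp

lemma mixed_vol_two_bodies:
  fixes K B :: "'a::euclidean_space set"
  shows "mixed_vol (\<lambda>j. if P j then K else B) = two_body_volume K B (card {j. j < DIM('a) \<and> P j})"
proof -
  let ?k = "card {j. j < DIM('a) \<and> P j}"
  have "?k \<le> card {..<DIM('a)}" by (intro card_mono) auto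
  then have "{j. j < DIM('a) \<and> j < ?k} = {..<?k}" by auto
  then have "mset (map (\<lambda>j. if P j then K else B) [0..<DIM('a)]) = mset (map (\<lambda>j. if j < ?k then K else B) [0..<DIM('a)])"
    unfolding mset_map_if_const by simp
  then have "mixed_vol_list (map (\<lambda>j. if P j then K else B) [0..<DIM('a)]) = mixed_vol_list (map (\<lambda>j. if j < ?k then K else B) [0..<DIM('a)])"
    using mixed_volume_form_mixed_vol_list[where 'a = 'a, unfolded mixed_volume_form_def, THEN conjunct1] by blast
  then show ?thesis unfolding mixed_vol_list_map two_body_volume_def .
qed

text \<open>Choosing \<open>True\<close> in a slot selects the coefficient of \<open>K\<close>
  together with one factor x, so the exponent counts the slots taken by \<open>K\<close>; by
  symmetry the mixed volume depends on that number only.\<close>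

lemma mixed_form_two_bodies:
  fixes K B :: "'a::euclidean_space set"
  shows "mixed_form UNIV (\<lambda>b. if b then K else B) a =
    umbral DIM('a) (two_body_volume K B) (\<Prod>l<DIM('a). [:a l False, a l True:])"
proof -
  let ?F = "PiE {..<DIM('a)} (\<lambda>_. UNIV :: bool set)"
  have "(\<Prod>l<DIM('a). [:a l False, a l True:]) = (\<Prod>l<DIM('a). \<Sum>b\<in>UNIV. Polynomial.monom (a l b) (of_bool b))"
    by (simp add: UNIV_bool monom_altdef)
  also have "\<dots> = (\<Sum>f\<in>?F. \<Prod>l<DIM('a). Polynomial.monom (a l (f l)) (of_bool (f l)))"
    by (rule prod_sum_PiE) auto
  also have "\<dots> = (\<Sum>f\<in>?F. Polynomial.monom (\<Prod>l<DIM('a). a l (f l)) (card {j. j < DIM('a) \<and> f j}))"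
  proof (rule sum.cong)
    fix f :: "nat \<Rightarrow> bool"
    have "(\<Prod>l<m. Polynomial.monom (a l (f l)) (of_bool (f l))) = Polynomial.monom (\<Prod>l<m. a l (f l)) (\<Sum>l<m. of_bool (f l))" for m
      by (induction m) (simp_all add: mult_monom)
    moreover have "(\<Sum>l<DIM('a). of_bool (f l)) = card {j. j < DIM('a) \<and> f j}"
      by (simp add: of_bool_def sum.If_cases Int_def)
    ultimately show "(\<Prod>l<DIM('a). Polynomial.monom (a l (f l)) (of_bool (f l))) = Polynomial.monom (\<Prod>l<DIM('a). a l (f l)) (card {j. j < DIM('a) \<and> f j})"
      by simp
  qed simp
  finally have "umbral DIM('a) (two_body_volume K B) (\<Prod>l<DIM('a). [:a l False, a l True:]) =
    (\<Sum>f\<in>?F. umbral DIM('a) (two_body_volume K B) (Polynomial.monom (\<Prod>l<DIM('a). a l (f l)) (card {j. j < DIM('a) \<and> f j})))"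
    by (simp only: umbral_sum)
  also have "\<dots> = (\<Sum>f\<in>?F. (\<Prod>l<DIM('a). a l (f l)) * two_body_volume K B (card {j. j < DIM('a) \<and> f j}))"
  proof (rule sum.cong)
    fix f :: "nat \<Rightarrow> bool"
    have "card {j. j < DIM('a) \<and> f j} \<le> card {..<DIM('a)}" by (intro card_mono) auto
    then show "umbral DIM('a) (two_body_volume K B) (Polynomial.monom (\<Prod>l<DIM('a). a l (f l)) (card {j. j < DIM('a) \<and> f j})) =
      (\<Prod>l<DIM('a). a l (f l)) * two_body_volume K B (card {j. j < DIM('a) \<and> f j})" by (intro umbral_monom) simp
  qed simp
  finally show ?thesis by (simp add: mixed_form_def mixed_vol_two_bodies)
qed

lemma prod_diff_expand:
  fixes x y :: "nat \<Rightarrow> 'b::comm_ring_1"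
  shows "(\<Prod>l<n. x l - y l) = (\<Sum>J\<in>Pow {..<n}. (- 1) ^ card J * (\<Prod>l<n. if l \<in> J then y l else x l))"
proof -
  have "(\<Prod>l<n. - y l + x l) = (\<Sum>J\<in>Pow {..<n}. (\<Prod>l\<in>J. - y l) * (\<Prod>l\<in>{..<n} - J. x l))"
    by (rule prod_add) simp
  also have "\<dots> = (\<Sum>J\<in>Pow {..<n}. (- 1) ^ card J * (\<Prod>l<n. if l \<in> J then y l else x l))"
  proof (rule sum.cong)
    fix J assume J: "J \<in> Pow {..<n}"
    have "(\<Prod>l<n. if l \<in> J then y l else x l) = (\<Prod>l\<in>{..<n} - J. if l \<in> J then y l else x l) * (\<Prod>l\<in>J. if l \<in> J then y l else x l)"
      using J by (intro prod.subset_diff) auto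
    also have "\<dots> = (\<Prod>l\<in>{..<n} - J. x l) * (\<Prod>l\<in>J. y l)" by (intro arg_cong2[where f = "(*)"] prod.cong) auto
    finally show "(\<Prod>l\<in>J. - y l) * (\<Prod>l\<in>{..<n} - J. x l) = (- 1) ^ card J * (\<Prod>l<n. if l \<in> J then y l else x l)"
      by (simp add: prod_uminus mult_ac)
  qed simp
  finally show ?thesis by (simp add: add.commute[of "- _"])
qed

lemma mixed_form_diff:
  fixes K :: "'i \<Rightarrow> 'a::euclidean_space set"
  assumes "finite I"
  shows "(\<Sum>J\<in>Pow {..<DIM('a)}. (- 1) ^ card J * mixed_form I K (\<lambda>l. if l \<in> J then b l else a l)) = mixed_form I K (\<lambda>l i. a l i - b l i)"
proof -
  have "(\<Sum>J\<in>Pow {..<DIM('a)}. (- 1) ^ card J * mixed_form I K (\<lambda>l. if l \<in> J then b l else a l)) =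
    (\<Sum>f\<in>PiE {..<DIM('a)} (\<lambda>_. I). (\<Sum>J\<in>Pow {..<DIM('a)}. (- 1) ^ card J * (\<Prod>l<DIM('a). if l \<in> J then b l (f l) else a l (f l))) * mixed_vol (\<lambda>j. K (f j)))"
    unfolding mixed_form_def sum_distrib_left sum_distrib_right
    by (subst sum.swap) (simp add: mult.assoc if_distrib[of "\<lambda>g. g _"] cong: if_cong)
  then show ?thesis by (simp only: mixed_form_def prod_diff_expand)
qed

text \<open>The function \<open>\<alpha> h\<^sub>K + \<beta> h\<^sub>B\<close> corresponds to the linear factor \<open>\<alpha> x + \<beta>\<close>, and
  \<open>x\<^sup>k\<close> is evaluated to \<open>V(K[k], B[n-k])\<close>.\<close>

lemma mixed_volume_ext_two_bodies:
  fixes K B :: "'a::euclidean_space set" and fs :: "('a \<Rightarrow> real) list"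
  assumes K: "convex_body K" and B: "convex_body B" and len: "length fs = DIM('a)"
    and fs: "\<And>l u. l < DIM('a) \<Longrightarrow> norm u = 1 \<Longrightarrow> (fs ! l) u = \<alpha> l * support_function K u + \<beta> l * support_function B u"
  shows "mixed_volume_ext fs = umbral DIM('a) (two_body_volume K B) (\<Prod>l<DIM('a). [:\<beta> l, \<alpha> l:])"
proof -
  let ?KB = "\<lambda>b. if b then K else B"
  \<comment> \<open>Positive and negative parts are separated to have nonnegative weights. The 1
    added to the weight of \<open>B\<close> on both sides cancels in the difference and guarantees
    nonempty interior even if the weight of \<open>K\<close> is zero.\<close>
  define a where "a l b = (if b then max (\<alpha> l) 0 else max (\<beta> l) 0 + 1)" for l b
  define a' where "a' l b = (if b then max (- \<alpha> l) 0 else max (- \<beta> l) 0 + 1)" for l b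
  define comb where "comb c = (\<Sum>b\<in>UNIV. scale_set (c b) (?KB b))" for c
  have comb: "comb c = scale_set (c True) K + scale_set (c False) B" for c
    by (simp add: comb_def UNIV_bool add.commute)
  have props: "compact (scale_set x K)" "compact (scale_set x B)" "scale_set x K \<noteq> {}" "scale_set x B \<noteq> {}" for x
    using K B convex_body_ne[OF K] convex_body_ne[OF B] by (auto simp: convex_body_def compact_scaling)
  have body: "convex_body (comb c)" if "0 \<le> c True" "0 < c False" for c
  proof (cases "c True = 0")
    case True
    then have "scale_set (c True) K = 0" using convex_body_ne[OF K] by (auto simp: set_zero)
    then show ?thesis using that B by (simp add: comb convex_body_scale)
  next
    case False
    then show ?thesis using that K B by (simp add: comb convex_body_plus convex_body_scale)
  qed
  have sf: "support_function (comb c) u = c True * support_function K u + c False * support_function B u"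
    if "0 \<le> c True" "0 \<le> c False" for c u
    using that K B convex_body_ne[OF K] convex_body_ne[OF B]
    by (simp add: comb support_function_plus props support_function_scale convex_body_def)
  have nonneg: "0 \<le> a l b" "0 \<le> a' l b" for l b by (auto simp: a_def a'_def)
  have "mixed_volume_ext fs = mixed_vol_diff (\<lambda>l. comb (a l)) (\<lambda>l. comb (a' l))"
  proof (rule mixed_volume_ext_eq[OF len])
    show "convex_body (comb (a l)) \<and> convex_body (comb (a' l))" for l
      by (intro conjI body) (auto simp: a_def a'_def)
    fix l and u :: 'a assume "l < DIM('a)" "norm u = 1"
    moreover have d: "\<alpha> l = a l True - a' l True" "\<beta> l = a l False - a' l False" by (auto simp: a_def a'_def)
    ultimately show "(fs ! l) u = support_function (comb (a l)) u - support_function (comb (a' l)) u"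
      by (simp only: fs d sf[OF nonneg(1) nonneg(1)] sf[OF nonneg(2) nonneg(2)]) (simp add: algebra_simps)
  qed
  also have "\<dots> = (\<Sum>J\<in>Pow {..<DIM('a)}. (- 1) ^ card J * mixed_form UNIV ?KB (\<lambda>l. if l \<in> J then a' l else a l))"
    unfolding mixed_vol_diff_def
  proof (intro sum.cong refl arg_cong2[where f = "(*)"])
    fix J
    have "mixed_form UNIV ?KB (\<lambda>l. if l \<in> J then a' l else a l) = mixed_vol (\<lambda>l. comb (if l \<in> J then a' l else a l))"
      unfolding comb_def using K B nonneg by (intro mixed_vol_multilinear[symmetric]) auto
    also have "(\<lambda>l. comb (if l \<in> J then a' l else a l)) = (\<lambda>l. if l \<in> J then comb (a' l) else comb (a l))" by (auto simp: fun_eq_iff)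
    finally show "mixed_vol (\<lambda>i. if i \<in> J then comb (a' i) else comb (a i)) = mixed_form UNIV ?KB (\<lambda>l. if l \<in> J then a' l else a l)" ..
  qed
  also have "\<dots> = mixed_form UNIV ?KB (\<lambda>l b. a l b - a' l b)" by (rule mixed_form_diff) simp
  also have "\<dots> = umbral DIM('a) (two_body_volume K B) (\<Prod>l<DIM('a). [:\<beta> l, \<alpha> l:])"
  proof -
    have "a l True - a' l True = \<alpha> l" "a l False - a' l False = \<beta> l" for l by (auto simp: a_def a'_def)
    then show ?thesis unfolding mixed_form_two_bodies by simp
  qed
  finally show ?thesis .
qed

section \<open>Reflection and the vanishing of odd terms\<close>

lemma measure_lebesgue_uminus_image: "measure lebesgue (uminus ` S) = measure lebesgue (S :: 'a::euclidean_space set)"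
  using measure_lebesgue_affine[of "-1" 0 S] by simp

text \<open>Minkowski sums commute with reflection, which preserves volume, and \<open>B\<close> is
  its own reflection.\<close>

lemma two_body_volume_uminus:
  fixes K B :: "'a::euclidean_space set"
  assumes "uminus ` B = B"
  shows "two_body_volume (uminus ` K) B k = two_body_volume K B k"
  unfolding two_body_volume_def mixed_vol_def
proof (rule polarization_cong)
  fix J assume "J \<subseteq> {..<DIM('a)}"
  then have fin: "finite J" by (rule finite_subset) simp
  have "(\<Sum>j\<in>J. if j < k then uminus ` K else B) = (\<Sum>j\<in>J. uminus ` (if j < k then K else B))"
    using assms by (intro sum.cong) auto
  also have "\<dots> = uminus ` (\<Sum>j\<in>J. if j < k then K else B)"
    by (rule linear_image_sum_sets[symmetric, OF linear_uminus fin])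
  finally show "measure lebesgue (\<Sum>j\<in>J. if j < k then uminus ` K else B) = measure lebesgue (\<Sum>j\<in>J. if j < k then K else B)"
    by (simp only: measure_lebesgue_uminus_image)
qed

lemma convex_body_uminus: "convex_body K \<Longrightarrow> convex_body (uminus ` K)"
  by (auto simp: convex_body_def compact_negations convex_negations interior_negations)

lemma convex_body_cball: "convex_body (cball (0::'a::euclidean_space) 1)"
  by (simp add: convex_body_def)

lemma prod_if_less_power: "k \<le> n \<Longrightarrow> (\<Prod>l<n. if l < k then p else 1) = (p :: 'b::comm_monoid_mult) ^ k"
proof -
  assume "k \<le> n"
  then have "(\<Prod>l<n. if l < k then p else 1) = (\<Prod>l<k. p)"
    by (intro prod.mono_neutral_cong_right) auto
  then show ?thesis by simp
qed

text \<open>The constant function 1 is 0 h_K + 1 h_B for the unit ball B, so the slots not filled by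
  h contribute the factor 1.\<close>

lemma mixed_quermass_umbral:
  fixes K :: "'a::euclidean_space set"
  assumes K: "convex_body K" and k: "k \<le> DIM('a)"
    and h: "\<And>u. norm u = 1 \<Longrightarrow> h u = a * support_function K u + b"
  shows "mixed_quermass k h = umbral DIM('a) (two_body_volume K (cball 0 1)) ([:b, a:] ^ k)"
proof -
  have "mixed_quermass k h = umbral DIM('a) (two_body_volume K (cball 0 1))
      (\<Prod>l<DIM('a). [:if l < k then b else 1, if l < k then a else 0:])"
    unfolding mixed_quermass_def
    using k h by (intro mixed_volume_ext_two_bodies K convex_body_cball) (auto simp: nth_append support_function_cball)
  also have "(\<Prod>l<DIM('a). [:if l < k then b else 1, if l < k then a else 0:]) = (\<Prod>l<DIM('a). if l < k then [:b, a:] else 1)"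
    by (intro prod.cong) (auto simp: one_pCons)
  finally show ?thesis by (simp only: prod_if_less_power[OF k])
qed

text \<open>Writing h as h_K - r and as r - h_(-K) evaluates the same quantity through the same
  functional, because reflection does not change mixed volumes with the ball. The polynomials are
  k-th powers of opposite linear factors, so for odd k the value equals its negative.\<close>

lemma mixed_quermass_odd:
  fixes K :: "'a::euclidean_space set"
  assumes K: "convex_body K" and k: "k \<le> DIM('a)" "odd k"
    and h: "\<And>u. norm u = 1 \<Longrightarrow> support_function K u = r + h u" "\<And>u. norm u = 1 \<Longrightarrow> h (- u) = - h u"
  shows "mixed_quermass k h = 0"
proof -
  let ?v = "two_body_volume K (cball 0 1)"
  have "mixed_quermass k h = umbral DIM('a) ?v ([:- r, 1:] ^ k)"
    using h by (intro mixed_quermass_umbral K k) simp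
  moreover have "mixed_quermass k h = umbral DIM('a) (two_body_volume (uminus ` K) (cball 0 1)) ([:r, - 1:] ^ k)"
    using h(1)[of "- _"] h(2) by (intro mixed_quermass_umbral convex_body_uminus K k) (simp add: support_function_uminus)
  moreover have "two_body_volume (uminus ` K) (cball 0 1) = ?v"
  proof (rule ext, rule two_body_volume_uminus, intro subset_antisym subsetI)
    fix x :: 'a assume "x \<in> cball 0 1"
    then show "x \<in> uminus ` cball 0 1" by (intro image_eqI[of _ _ "- x"]) auto
  qed auto
  moreover have "[:r, - 1:] ^ k = Polynomial.smult (- 1) ([:- r, 1:] ^ k)"
  proof -
    have "[:r, - 1:] ^ k = (- [:- r, 1:]) ^ k" by simp
    also have "\<dots> = - ([:- r, 1:] ^ k)" by (rule power_minus_odd[OF k(2)])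
    finally show ?thesis by simp
  qed
  ultimately show ?thesis by (simp only: umbral_smult)
qed

lemma mixed_vol_const:
  fixes K :: "'a::euclidean_space set"
  assumes "convex_body K"
  shows "mixed_vol (\<lambda>_. K) = measure lebesgue K"
proof -
  \<comment> \<open>One body with weight 1: the only map into a one-point index set gives the only
    term.\<close>
  have "measure lebesgue (\<Sum>i\<in>{()}. scale_set 1 K) =
    (\<Sum>f\<in>PiE {..<DIM('a)} (\<lambda>_. {()}). (\<Prod>j<DIM('a). 1) * mixed_vol (\<lambda>j. K))"
    by (rule volume_weighted_sum) (use assms in auto)
  then show ?thesis by (simp add: card_PiE)
qed

theorem constant_width_volume:
  fixes K :: "'a::euclidean_space set"
  assumes K: "convex_body K" and n: "DIM('a) = 2 * m" "m \<ge> 2"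
    and h: "\<And>u. norm u = 1 \<Longrightarrow> support_function K u = r + h u" "\<And>u. norm u = 1 \<Longrightarrow> h (- u) = - h u"
  shows "measure lebesgue K =
      r / (real DIM('a) - 2) * surface_area K
      - 2 * measure lebesgue (cball (0::'a) 1) / (real DIM('a) - 2) * r ^ DIM('a)
      + 2 / (real DIM('a) - 2) *
          (\<Sum>p = 2..m - 1. (real p - 1) * real (DIM('a) choose (2 * p)) * r ^ (DIM('a) - 2 * p)
             * mixed_quermass (2 * p) h)
      + mixed_quermass DIM('a) h"
proof -
  let ?n = "DIM('a)" and ?B = "cball (0::'a) 1"
  let ?v = "two_body_volume K ?B"
  define Q where "Q k = mixed_quermass k h" for k
  have Q: "Q k = umbral ?n ?v ([:- r, 1:] ^ k)" if "k \<le> ?n" for k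
    unfolding Q_def using h that by (intro mixed_quermass_umbral K) simp_all
  have Qodd: "Q k = 0" if "k \<le> ?n" "odd k" for k
    unfolding Q_def using mixed_quermass_odd[OF K that h] .
  \<comment> \<open>Binomial expansion of x = (x - r) + r, where the powers of x - r evaluate to
    \<open>Q\<close>.\<close>
  have v: "?v k = (\<Sum>j\<le>k. real (k choose j) * r ^ (k - j) * Q j)" if k: "k \<le> ?n" for k
  proof -
    have "Polynomial.monom 1 k = ([:- r, 1:] + [:r:]) ^ k" by (simp add: monom_altdef)
    also have "\<dots> = (\<Sum>j\<le>k. Polynomial.smult (real (k choose j) * r ^ (k - j)) ([:- r, 1:] ^ j))"
      unfolding binomial_ring by (intro sum.cong) (auto simp: of_nat_poly poly_const_pow mult.commute smult_smult)
    finally have "umbral ?n ?v (Polynomial.monom 1 k) = (\<Sum>j\<le>k. real (k choose j) * r ^ (k - j) * Q j)"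
      using k by (simp add: umbral_sum umbral_smult Q)
    then show ?thesis using k by (simp add: umbral_monom)
  qed
  have v0: "?v 0 = measure lebesgue ?B"
    using mixed_vol_const[OF convex_body_cball] by (simp add: two_body_volume_def)
  have Q0: "Q 0 = measure lebesgue ?B"
    using v[of 0] v0 by simp
  have vn: "?v ?n = measure lebesgue K"
    unfolding mixed_vol_const[OF K, symmetric] two_body_volume_def by (rule mixed_vol_cong) simp
  have S: "surface_area K = ?n * ?v (?n - 1)"
  proof -
    have "mixed_volume (replicate (?n - 1) K @ [?B]) = mixed_vol ((!) (replicate (?n - 1) K @ [?B]))"
      using K convex_body_cball by (intro mixed_volume_eq) auto
    also have "\<dots> = ?v (?n - 1)"
      unfolding two_body_volume_def by (rule mixed_vol_cong) (auto simp: nth_append)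
    finally show ?thesis by (simp add: surface_area_def)
  qed
  have even_sum: "(\<Sum>j\<le>?n. f j * Q j) = (\<Sum>p\<le>m. f (2 * p) * Q (2 * p))" for f :: "nat \<Rightarrow> real"
  proof -
    have "(\<Sum>p\<le>m. f (2 * p) * Q (2 * p)) = (\<Sum>j\<in>(*) 2 ` {..m}. f j * Q j)"
      by (subst sum.reindex) (auto simp: inj_on_def)
    also have "\<dots> = (\<Sum>j\<le>?n. f j * Q j)"
    proof (rule sum.mono_neutral_left)
      show "\<forall>j\<in>{..?n} - (*) 2 ` {..m}. f j * Q j = 0"
      proof
        fix j assume j: "j \<in> {..?n} - (*) 2 ` {..m}"
        then have "odd j" using n(1) by (auto elim!: evenE)
        then show "f j * Q j = 0" using j Qodd by simp
      qed
    qed (use n in auto)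
    finally show ?thesis ..
  qed
  have rS: "r * surface_area K = (\<Sum>j\<le>?n. (real (?n - j) * real (?n choose j) * r ^ (?n - j)) * Q j)"
  proof -
    have "r * surface_area K = (\<Sum>j\<le>?n - 1. (real (?n - j) * real (?n choose j) * r ^ (?n - j)) * Q j)"
      unfolding S v[OF diff_le_self] sum_distrib_left
    proof (rule sum.cong)
      fix j assume "j \<in> {..?n - 1}"
      then have j: "j \<le> ?n - 1" "j < ?n" using n by auto
      have "r * r ^ (?n - 1 - j) = r ^ (?n - j)"
      proof -
        have "?n - j = Suc (?n - 1 - j)" using j by simp
        then show ?thesis by (simp only: power_Suc)
      qed
      \<comment> \<open>Absorption: n C(n-1, j) = (n - j) C(n, j).\<close>
      moreover have "real ?n * real ((?n - 1) choose j) = real (?n - j) * real (?n choose j)"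
        using binomial_absorb_comp[of ?n j] by (simp flip: of_nat_mult)
      ultimately show "r * (real ?n * (real (?n - 1 choose j) * r ^ (?n - 1 - j) * Q j)) =
          real (?n - j) * real (?n choose j) * r ^ (?n - j) * Q j"
        by (metis (no_types, opaque_lifting) mult.assoc mult.left_commute)
    qed simp
    \<comment> \<open>The added term j = n carries the factor n - n = 0; it lines this sum up with
      the one for the volume.\<close>
    also have "\<dots> = (\<Sum>j\<le>?n. (real (?n - j) * real (?n choose j) * r ^ (?n - j)) * Q j)"
      by (rule sum.mono_neutral_left) auto
    finally show ?thesis .
  qed
  \<comment> \<open>Subtracting leaves the coefficient (n - 2) - (n - 2p) = 2(p - 1): it gives the
    ball for p = 0, removes p = 1, and equals n - 2 at p = m, hence the coefficient one after
    division.\<close>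
  define g where "g p = (real p - 1) * real (?n choose (2 * p)) * r ^ (?n - 2 * p) * Q (2 * p)" for p
  have "(real ?n - 2) * measure lebesgue K - r * surface_area K =
    (\<Sum>p\<le>m. ((real ?n - 2) - real (?n - 2 * p)) * real (?n choose (2 * p)) * r ^ (?n - 2 * p) * Q (2 * p))"
    unfolding rS vn[symmetric] v[OF order_refl] sum_distrib_left even_sum
    unfolding sum_subtractf[symmetric]
    using even_sum[of "\<lambda>j. (real ?n - 2) * (real (?n choose j) * r ^ (?n - j))"]
    by (simp add: sum_subtractf[symmetric] algebra_simps)
  also have "\<dots> = (\<Sum>p\<le>m. 2 * g p)"
  proof (rule sum.cong)
    fix p assume "p \<in> {..m}"
    then have "real (?n - 2 * p) = real ?n - 2 * real p" using n by (simp add: of_nat_diff)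
    then show "((real ?n - 2) - real (?n - 2 * p)) * real (?n choose (2 * p)) * r ^ (?n - 2 * p) * Q (2 * p) = 2 * g p"
      by (simp add: g_def algebra_simps)
  qed simp
  also have "\<dots> = 2 * (g 0 + g 1 + (\<Sum>p = 2..m - 1. g p) + g m)"
  proof -
    have "{..m} = insert 0 (insert 1 (insert m {2..m - 1}))" using n by auto
    then show ?thesis using n by (simp add: sum_distrib_left[symmetric])
  qed
  also have "g 0 = - (measure lebesgue ?B * r ^ ?n)" by (simp add: g_def Q0)
  also have "g 1 = 0" by (simp add: g_def)
  also have "g m = (real m - 1) * Q ?n" using n by (simp add: g_def)
  finally have "(real ?n - 2) * measure lebesgue K = r * surface_area K
      - 2 * measure lebesgue ?B * r ^ ?n + 2 * (\<Sum>p = 2..m - 1. g p) + (real ?n - 2) * Q ?n"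
    using n by (simp add: algebra_simps)
  moreover have "real ?n - 2 \<noteq> 0" using n by simp
  ultimately have "measure lebesgue K = (r * surface_area K
      - 2 * measure lebesgue ?B * r ^ ?n + 2 * (\<Sum>p = 2..m - 1. g p) + (real ?n - 2) * Q ?n) / (real ?n - 2)"
    by (simp add: field_simps)
  also have "\<dots> = r / (real ?n - 2) * surface_area K - 2 * measure lebesgue ?B / (real ?n - 2) * r ^ ?n
     + 2 / (real ?n - 2) * (\<Sum>p = 2..m - 1. g p) + Q ?n"
    using \<open>real ?n - 2 \<noteq> 0\<close> by (simp add: add_divide_distrib diff_divide_distrib)
  finally show ?thesis by (simp only: g_def Q_def)
qed

section \<open>The degree of the antipodal map\<close>

lemma continuous_map_nsphere_swap:
  assumes "k \<le> p"
  shows "continuous_map (nsphere p) (nsphere p) (\<lambda>x i. x (Transposition.transpose 0 k i))"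
proof -
  have "(\<Sum>i\<le>p. x (Transposition.transpose 0 k i) ^ 2) = (\<Sum>i\<le>p. x i ^ 2)" for x :: "nat \<Rightarrow> real"
    using sum.permute[of "Transposition.transpose 0 k" "{..p}" "\<lambda>i. x i ^ 2"] assms
    by (simp add: o_def permutes_swap_id)
  moreover have "x (Transposition.transpose 0 k i) = 0" if "\<forall>i>p. x i = 0" "i > p" for x :: "nat \<Rightarrow> real" and i
    using that assms by (simp add: Transposition.transpose_def)
  ultimately show ?thesis
    using continuous_map_nsphere_projection[of p]
    by (auto simp: nsphere continuous_map_in_subtopology continuous_map_componentwise_UNIV)
qed

text \<open>The reflection in coordinate k is the reflection in coordinate 0 conjugated by a
  transposition s. Since s is an involution its degree squares to 1, and so it drops out without
  being computed.\<close>

lemma Brouwer_degree2_coordinate_reflection: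
  assumes "k \<le> p"
  shows "Brouwer_degree2 p (\<lambda>x i. if i = k then - x i else x i) = - 1"
proof -
  define s where "s = (\<lambda>(x :: nat \<Rightarrow> real) i. x (Transposition.transpose 0 k i))"
  define r where "r = (\<lambda>(x :: nat \<Rightarrow> real) i. if i = 0 then - x i else x i)"
  have s: "continuous_map (nsphere p) (nsphere p) s"
    unfolding s_def by (rule continuous_map_nsphere_swap[OF assms])
  have r: "continuous_map (nsphere p) (nsphere p) r"
    unfolding r_def by (rule continuous_map_nsphere_reflection)
  have ss: "s \<circ> s = id" by (simp add: s_def fun_eq_iff)
  have "Brouwer_degree2 p s * Brouwer_degree2 p s = 1"
    using Brouwer_degree2_compose[OF s s] by (simp add: ss)
  moreover have "Brouwer_degree2 p (s \<circ> (r \<circ> s)) = Brouwer_degree2 p s * (Brouwer_degree2 p r * Brouwer_degree2 p s)"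
    by (simp add: Brouwer_degree2_compose continuous_map_compose[OF s r] r s)
  moreover have "Brouwer_degree2 p r = - 1" unfolding r_def by (rule Brouwer_degree2_reflection)
  moreover have "s \<circ> (r \<circ> s) = (\<lambda>x i. if i = k then - x i else x i)"
    by (auto simp: s_def r_def fun_eq_iff Transposition.transpose_def)
  ultimately show ?thesis by simp
qed

text \<open>Negation is a composite of p + 1 coordinate reflections, \<open>f k\<close> being the
  negation of the first k coordinates. On the sphere the coordinates beyond p are zero, so
  \<open>f (Suc p)\<close> agrees with full negation there.\<close>

lemma Brouwer_degree2_neg: "Brouwer_degree2 p (\<lambda>x i. - x i) = (- 1) ^ Suc p"
proof -
  define f where "f k = (\<lambda>(x :: nat \<Rightarrow> real) i. if i < k then - x i else x i)" for k :: nat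
  have "k \<le> Suc p \<Longrightarrow> continuous_map (nsphere p) (nsphere p) (f k) \<and> Brouwer_degree2 p (f k) = (- 1) ^ k" for k
  proof (induction k)
    case 0
    have "f 0 = id" by (simp add: f_def fun_eq_iff)
    then show ?case by (simp only: Brouwer_degree2_id continuous_map_id power_0 simp_thms)
  next
    case (Suc k)
    let ?r = "\<lambda>(x :: nat \<Rightarrow> real) i. if i = k then - x i else x i"
    have "f (Suc k) = ?r \<circ> f k" by (auto simp: f_def fun_eq_iff less_Suc_eq)
    moreover have r: "continuous_map (nsphere p) (nsphere p) ?r" by (rule continuous_map_nsphere_reflection)
    moreover have "Brouwer_degree2 p ?r = - 1" using Suc.prems by (intro Brouwer_degree2_coordinate_reflection) simp
    moreover have "continuous_map (nsphere p) (nsphere p) (f k)" "Brouwer_degree2 p (f k) = (- 1) ^ k"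
      using Suc by auto
    ultimately show ?case
      by (simp only: Brouwer_degree2_compose[OF _ r] continuous_map_compose[OF _ r] power_Suc simp_thms)
  qed
  then have "Brouwer_degree2 p (f (Suc p)) = (- 1) ^ Suc p" by blast
  also have "Brouwer_degree2 p (f (Suc p)) = Brouwer_degree2 p (\<lambda>x i. - x i)"
    by (rule Brouwer_degree2_eq) (auto simp: f_def nsphere fun_eq_iff)
  finally show ?thesis by simp
qed

text \<open>\<open>nsphere\<close> consists of real sequences, \<open>unit_sphere\<close> of vectors
  in an arbitrary Euclidean space. Oddness of f is recorded because it carries negation of sequences
  to the antipodal map.\<close>

lemma linear_homeomorphism_nsphere_sphere:
  obtains f :: "(nat \<Rightarrow> real) \<Rightarrow> 'a::euclidean_space" and g
  where "homeomorphic_maps (nsphere (DIM('a) - 1)) (unit_sphere :: 'a topology) f g"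
    and "\<And>v. f (\<lambda>i. - v i) = - f v"
proof -
  let ?n = "DIM('a)"
  have n: "{..?n - 1} = {..<?n}" using DIM_positive[where 'a = 'a] by (auto simp del: DIM_positive)
  obtain e :: "nat \<Rightarrow> 'a" where e: "bij_betw e {..<?n} Basis"
    using ex_bij_betw_nat_finite[of "Basis :: 'a set"] by (auto simp: atLeast0LessThan)
  then have eB: "e i \<in> Basis" if "i < ?n" for i using that by (auto simp: bij_betw_def)
  have ee: "e i \<bullet> e j = of_bool (i = j)" if "i < ?n" "j < ?n" for i j
    using e that eB by (auto simp: inner_Basis bij_betw_def inj_on_def)
  define f where "f v = (\<Sum>i<?n. v i *\<^sub>R e i)" for v :: "nat \<Rightarrow> real"
  define g where "g x = (\<lambda>i. if i < ?n then x \<bullet> e i else 0)" for x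
  have fe: "f v \<bullet> e j = v j" if "j < ?n" for v j
  proof -
    have "f v \<bullet> e j = (\<Sum>i<?n. if i = j then v i else 0)"
      unfolding f_def inner_sum_left using that by (intro sum.cong) (auto simp: ee)
    then show ?thesis using that by simp
  qed
  have fg: "f (g x) = x" for x
  proof -
    have "f (g x) = (\<Sum>i<?n. (x \<bullet> e i) *\<^sub>R e i)" by (simp add: f_def g_def)
    also have "\<dots> = (\<Sum>b\<in>Basis. (x \<bullet> b) *\<^sub>R b)" by (rule sum.reindex_bij_betw[OF e])
    finally show ?thesis by (simp add: euclidean_representation)
  qed
  have nf: "(norm (f v))\<^sup>2 = (\<Sum>i<?n. (v i)\<^sup>2)" for v
  proof -
    have "f v \<bullet> f v = (\<Sum>i<?n. v i * (f v \<bullet> e i))"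
      by (subst (2) f_def) (simp add: inner_sum_right)
    also have "\<dots> = (\<Sum>i<?n. (v i)\<^sup>2)" by (simp add: fe power2_eq_square)
    finally show ?thesis by (simp only: power2_norm_eq_inner)
  qed
  have cf: "continuous_map (nsphere (?n - 1)) euclidean f"
    unfolding f_def
  proof (rule continuous_map_sum)
    fix i
    have "continuous_map euclideanreal euclidean (\<lambda>t. t *\<^sub>R e i)" by (auto intro!: continuous_intros)
    from continuous_map_compose[OF continuous_map_nsphere_projection this]
    show "continuous_map (nsphere (?n - 1)) euclidean (\<lambda>v. v i *\<^sub>R e i)" by (simp add: o_def)
  qed simp
  have f: "continuous_map (nsphere (?n - 1)) (unit_sphere :: 'a topology) f"
  proof -
    have "norm (f v) = 1" if "v \<in> topspace (nsphere (?n - 1))" for v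
    proof -
      have "(norm (f v))\<^sup>2 = 1" using that nf[of v] by (simp add: nsphere n[unfolded One_nat_def])
      then show ?thesis by (simp add: power2_eq_1_iff) (metis norm_not_less_zero zero_less_one neg_0_less_iff_less less_numeral_extra(1) neg_less_0_iff_less)
    qed
    then show ?thesis using cf by (auto simp: continuous_map_in_subtopology)
  qed
  have gs: "(\<Sum>i\<le>?n - 1. (g x i)\<^sup>2) = (norm x)\<^sup>2" for x
    unfolding n nf[of "g x", symmetric] fg ..
  have g: "continuous_map (unit_sphere :: 'a topology) (nsphere (?n - 1)) g"
  proof -
    have "continuous_map (unit_sphere :: 'a topology) euclideanreal (\<lambda>x. g x i)" for i
      by (auto simp: g_def intro!: continuous_intros)
    moreover have "g x i = 0" if "i > ?n - 1" for x i using that by (auto simp: g_def)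
    ultimately show ?thesis using gs
      by (auto simp: nsphere continuous_map_in_subtopology continuous_map_componentwise_UNIV)
  qed
  have gf: "g (f v) = v" if "v \<in> topspace (nsphere (?n - 1))" for v
  proof
    fix i
    have "v i = 0" if "i \<ge> ?n"
      using \<open>v \<in> _\<close> that DIM_positive[where 'a = 'a] by (simp add: nsphere del: DIM_positive)
    then show "g (f v) i = v i" by (auto simp: g_def fe)
  qed
  show ?thesis
  proof (rule that)
    show "homeomorphic_maps (nsphere (?n - 1)) (unit_sphere :: 'a topology) f g"
      using f g gf fg by (simp add: homeomorphic_maps_def)
    show "f (\<lambda>i. - v i) = - f v" for v by (simp add: f_def sum_negf)
  qed
qed

text \<open>In nonzero degree reduced and unreduced homology agree, so the results on
  \<open>nsphere\<close> transfer along the odd homeomorphism, which conjugates the antipodal map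
  into negation of sequences.\<close>

lemma homology_unit_sphere:
  assumes "DIM('a::euclidean_space) \<ge> 2"
  shows "homology_group (int (DIM('a) - 1)) (unit_sphere :: 'a topology) \<cong> integer_group"
    and "c \<in> carrier (homology_group (int (DIM('a) - 1)) (unit_sphere :: 'a topology)) \<Longrightarrow>
      hom_induced (int (DIM('a) - 1)) (unit_sphere :: 'a topology) {} unit_sphere {} uminus c =
        c [^]\<^bsub>homology_group (int (DIM('a) - 1)) (unit_sphere :: 'a topology)\<^esub> ((- 1) ^ DIM('a) :: int)"
proof -
  let ?d = "DIM('a) - 1" and ?S = "unit_sphere :: 'a topology"
  let ?N = "nsphere ?d" and ?HS = "homology_group (int ?d) ?S" and ?HN = "homology_group (int ?d) (nsphere ?d)"
  have d: "int ?d \<noteq> 0" "Suc ?d = DIM('a)" using assms by auto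
  obtain f :: "(nat \<Rightarrow> real) \<Rightarrow> 'a" and g
    where fg: "homeomorphic_maps ?N ?S f g" and odd: "\<And>v. f (\<lambda>i. - v i) = - f v"
    using linear_homeomorphism_nsphere_sphere[where 'a = 'a] by blast
  have cont: "continuous_map ?N ?S f" "continuous_map ?S ?N g"
    and gf: "\<And>x. x \<in> topspace ?N \<Longrightarrow> g (f x) = x" and fg': "\<And>y. y \<in> topspace ?S \<Longrightarrow> f (g y) = y"
    using fg by (auto simp: homeomorphic_maps_def)
  have rHN: "reduced_homology_group (int ?d) ?N = ?HN" by (rule un_reduced_homology_group[OF d(1)])
  have "?HS \<cong> ?HN"
    using homeomorphic_maps_imp_homeomorphic_space[OF fg, THEN iffD1[OF homeomorphic_space_sym]]
    by (rule homeomorphic_space_imp_isomorphic_homology_groups)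
  also have "?HN \<cong> integer_group"
    using reduced_homology_group_nsphere(1)[of ?d] unfolding rHN .
  finally show "?HS \<cong> integer_group" .
  assume c: "c \<in> carrier ?HS"
  let ?fs = "hom_induced (int ?d) ?N {} ?S {} f" and ?gs = "hom_induced (int ?d) ?S {} ?N {} g"
  let ?neg = "\<lambda>(x :: nat \<Rightarrow> real) i. - x i"
  have cneg: "continuous_map ?N ?N ?neg"
  proof -
    have "continuous_map ?N euclideanreal (\<lambda>x. - x i)" for i
      by (intro continuous_map_minus continuous_map_nsphere_projection)
    then show ?thesis
      by (auto simp: nsphere continuous_map_in_subtopology continuous_map_componentwise_UNIV)
  qed
  have gc: "?gs c \<in> carrier ?HN" by (rule hom_induced_carrier)
  have "?fs (?gs c) = hom_induced (int ?d) ?S {} ?S {} (f \<circ> g) c"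
    using cont by (intro hom_induced_compose') auto
  also have "\<dots> = c"
    by (rule hom_induced_id_gen[OF continuous_map_compose[OF cont(2,1)] _ c]) (metis comp_apply fg')
  finally have fgc: "?fs (?gs c) = c" .
  have "hom_induced (int ?d) ?S {} ?S {} uminus c = hom_induced (int ?d) ?S {} ?S {} ((f \<circ> ?neg) \<circ> g) c"
    by (rule fun_cong[OF hom_induced_eq]) (simp add: odd fg')
  also have "\<dots> = hom_induced (int ?d) ?N {} ?S {} (f \<circ> ?neg) (?gs c)"
    using cont cneg by (intro hom_induced_compose'[symmetric] continuous_map_compose) auto
  also have "\<dots> = ?fs (hom_induced (int ?d) ?N {} ?N {} ?neg (?gs c))"
    using cont cneg by (intro hom_induced_compose'[symmetric]) auto
  also have "hom_induced (int ?d) ?N {} ?N {} ?neg (?gs c) = ?gs c [^]\<^bsub>?HN\<^esub> Brouwer_degree2 ?d ?neg"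
    using Brouwer_degree2[of "?gs c" ?d ?neg] gc unfolding rHN by blast
  also have "?fs (?gs c [^]\<^bsub>?HN\<^esub> Brouwer_degree2 ?d ?neg) = ?fs (?gs c) [^]\<^bsub>?HS\<^esub> Brouwer_degree2 ?d ?neg"
    using gc by (intro hom_int_pow[OF hom_induced_hom]) auto
  finally show "hom_induced (int ?d) ?S {} ?S {} uminus c = c [^]\<^bsub>?HS\<^esub> ((- 1) ^ DIM('a) :: int)"
    by (simp only: fgc Brouwer_degree2_neg d(2))
qed

section \<open>Local homology of the sphere\<close>

text \<open>Moving along great circles towards \<open>-x\<close> lowers the height over \<open>x\<close>.\<close>

lemma contractible_below:
  fixes A :: "'a::euclidean_space set"
  assumes A: "A \<subseteq> sphere 0 1" and x: "norm x = 1" "x \<notin> A"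
    and down: "\<And>u w. u \<in> A \<Longrightarrow> norm w = 1 \<Longrightarrow> w \<bullet> x \<le> u \<bullet> x \<Longrightarrow> w \<in> A"
  shows "contractible A"
proof -
  \<comment> \<open>\<open>z\<close> runs along the segment from u to -x and \<open>h\<close> is its
    radial projection; the segment misses the origin because u is not x.\<close>
  define z where "z t u = (1 - t) *\<^sub>R u - t *\<^sub>R x" for t u
  define h where "h = (\<lambda>(t, u). (1 / norm (z t u)) *\<^sub>R z t u)"
  have nu: "norm u = 1" "u \<noteq> x" if "u \<in> A" for u using that A x by auto
  have height: "\<bar>u \<bullet> x\<bar> \<le> 1" if "u \<in> A" for u
    using Cauchy_Schwarz_ineq2[of u x] nu(1)[OF that] x by simp
  have z0: "z t u \<noteq> 0" if "u \<in> A" "t \<in> {0..1}" for t u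
  proof
    assume "z t u = 0"
    then have e: "(1 - t) *\<^sub>R u = t *\<^sub>R x" by (simp add: z_def)
    then have "norm ((1 - t) *\<^sub>R u) = norm (t *\<^sub>R x)" by simp
    then have t: "t = 1 / 2" using that x nu by simp
    have "(1 / 2 :: real) *\<^sub>R u = (1 / 2) *\<^sub>R x" using e unfolding t by simp
    then show False using nu[OF that(1)] by simp
  qed
  have "h (t, u) \<in> A" if u: "u \<in> A" and t: "t \<in> {0..1}" for t u
  proof (rule down[OF u])
    let ?s = "u \<bullet> x" and ?N = "norm (z t u)"
    have N: "?N > 0" using z0[OF u t] by simp
    show "norm (h (t, u)) = 1" using N by (simp add: h_def)
    \<comment> \<open>After division by the norm this says that the height does not rise. For
      nonpositive s it suffices that the norm is at most 1; for positive s the norm is bounded below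
      by u . z.\<close>
    have "(1 - t) * ?s - t \<le> ?s * ?N"
    proof (cases "?s \<le> 0")
      case True
      have "?N \<le> norm ((1 - t) *\<^sub>R u) + norm (t *\<^sub>R x)" unfolding z_def by (rule norm_triangle_ineq4)
      then have "?N \<le> 1" using t x nu[OF u] by simp
      then have "?s * 1 \<le> ?s * ?N" using True by (intro mult_left_mono_neg) auto
      moreover have "t * ?s \<ge> t * (- 1)" using height[OF u] t by (intro mult_left_mono) auto
      ultimately show ?thesis by (simp add: algebra_simps)
    next
      case False
      have "u \<bullet> z t u \<le> norm u * ?N" by (rule norm_cauchy_schwarz)
      then have "(1 - t) - t * ?s \<le> ?N"
        using nu[OF u] by (simp add: z_def inner_diff_right dot_square_norm)
      then have "?s * ((1 - t) - t * ?s) \<le> ?s * ?N" using False by (intro mult_left_mono) auto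
      moreover have "t * (?s * ?s) \<le> t * 1"
        using height[OF u] t abs_square_le_1[of ?s] by (intro mult_left_mono) (auto simp: power2_eq_square)
      ultimately show ?thesis by (simp add: algebra_simps)
    qed
    moreover have "z t u \<bullet> x = (1 - t) * ?s - t" using x by (simp add: z_def inner_diff_left dot_square_norm)
    ultimately show "h (t, u) \<bullet> x \<le> ?s" using N by (simp add: h_def divide_le_eq)
  qed
  then have img: "h ` ({0..1} \<times> A) \<subseteq> A" by auto
  have cont: "continuous_on ({0..1} \<times> A) h"
    unfolding h_def case_prod_unfold z_def
    using z0 by (intro continuous_intros) (auto simp: z_def)
  have "homotopic_with_canon (\<lambda>x. True) A A id (\<lambda>u. - x)"
  proof (subst homotopic_with, simp, intro exI[of _ h] conjI ballI)
    show "continuous_map (prod_topology (top_of_set {0..1}) (top_of_set A)) (top_of_set A) h"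
      using cont img by (auto simp: image_subset_iff_funcset)
  qed (use x(1) nu(1) in \<open>auto simp: h_def z_def\<close>)
  then show ?thesis unfolding contractible_def by blast
qed

text \<open>\<open>A\<close> is contractible by \<open>contractible_below\<close>, so passing to the
  pair changes nothing in positive degree. The condition on heights holds both for the complement of
  a point and for the complement of a cap.\<close>

lemma iso_homology_sphere_relative:
  fixes A :: "'a::euclidean_space set"
  assumes n: "DIM('a) \<ge> 2" and A: "A \<subseteq> sphere 0 1" and x: "norm x = 1" "x \<notin> A" and ne: "A \<noteq> {}"
    and down: "\<And>u w. u \<in> A \<Longrightarrow> norm w = 1 \<Longrightarrow> w \<bullet> x \<le> u \<bullet> x \<Longrightarrow> w \<in> A"
  shows "hom_induced (int (DIM('a) - 1)) (unit_sphere :: 'a topology) {} unit_sphere A id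
    \<in> iso (homology_group (int (DIM('a) - 1)) unit_sphere) (relative_homology_group (int (DIM('a) - 1)) unit_sphere A)"
proof -
  have "int (DIM('a) - 1) \<noteq> 0" using n by simp
  then have r: "reduced_homology_group (int (DIM('a) - 1)) (unit_sphere :: 'a topology) = homology_group (int (DIM('a) - 1)) unit_sphere"
    by (rule un_reduced_homology_group)
  have "subtopology (unit_sphere :: 'a topology) A = top_of_set A"
    using A by (simp add: subtopology_subtopology Int_absorb1)
  then have "contractible_space (subtopology (unit_sphere :: 'a topology) A)"
    using contractible_below[OF A x down] by simp
  moreover have "topspace (unit_sphere :: 'a topology) \<inter> A \<noteq> {}" using A ne by auto
  ultimately show ?thesis
    using iso_reduced_homology_by_contractible[of "unit_sphere :: 'a topology" A "int (DIM('a) - 1)"] r by simp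
qed

section \<open>Orientations of the sphere\<close>

text \<open>Excising the complement of \<open>W\<close> needs its closure inside the interior of the
  complement of \<open>B\<close>. That set is closed as \<open>W\<close> is open, and the closed set
  \<open>C\<close> between \<open>B\<close> and \<open>W\<close> provides the room.\<close>

lemma iso_excision_open:
  assumes "openin Y W" "closedin Y C" "B \<subseteq> C" "C \<subseteq> W"
  shows "hom_induced p (subtopology Y W) (W - B) Y (topspace Y - B) id \<in>
    iso (relative_homology_group p (subtopology Y W) (W - B)) (relative_homology_group p Y (topspace Y - B))"
proof -
  have W: "W \<subseteq> topspace Y" using assms(1) by (rule openin_subset)
  have "Y closure_of (topspace Y - W) = topspace Y - W"
    using assms(1) by (intro closure_of_closedin) (simp add: closedin_def Diff_Diff_Int inf.absorb2 W)
  also have "\<dots> \<subseteq> Y interior_of (topspace Y - B)"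
    using assms by (intro subset_trans[OF _ interior_of_maximal[of "topspace Y - C"]]) auto
  finally have "Y closure_of (topspace Y - W) \<subseteq> Y interior_of (topspace Y - B)" .
  from homology_excision_axiom[OF this Diff_subset[of "topspace Y" B], of p]
  have "hom_induced p (subtopology Y (topspace Y - (topspace Y - W))) (topspace Y - B - (topspace Y - W)) (subtopology Y (topspace Y)) (topspace Y - B) id
    \<in> iso (relative_homology_group p (subtopology Y (topspace Y - (topspace Y - W))) (topspace Y - B - (topspace Y - W)))
          (relative_homology_group p (subtopology Y (topspace Y)) (topspace Y - B))" .
  moreover have "topspace Y - (topspace Y - W) = W" "topspace Y - B - (topspace Y - W) = W - B" using W by auto
  ultimately show ?thesis by simp
qed

lemma generate_singleton_iso:
  assumes "group G" "group H" "f \<in> iso G H" "a \<in> carrier G"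
  shows "carrier H = generate H {f a} \<longleftrightarrow> carrier G = generate G {a}"
proof -
  have hom: "f \<in> hom G H" and bij: "bij_betw f (carrier G) (carrier H)" using assms(3) by (auto simp: iso_def)
  interpret group_hom G H f
    using assms hom by (simp add: group_hom_def group_hom_axioms_def)
  have "generate H {f a} = f ` generate G {a}"
    using generate_img[of "{a}"] assms(4) by simp
  moreover have "carrier H = f ` carrier G" using bij by (simp add: bij_betw_def)
  moreover have "generate G {a} \<subseteq> carrier G" using assms(4) by (intro G.generate_incl) simp
  ultimately show ?thesis
    using bij by (auto simp: bij_betw_def inj_on_image_eq_iff)
qed

section \<open>The antipodal double cover\<close>

abbreviation antipodal_class :: "'a::euclidean_space \<Rightarrow> 'a set" where
  "antipodal_class u \<equiv> {u, - u}"

lemma homeomorphic_map_uminus: "homeomorphic_map (unit_sphere :: 'a::euclidean_space topology) unit_sphere uminus"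
proof -
  have "continuous_map (unit_sphere :: 'a topology) unit_sphere uminus"
    by (auto intro!: continuous_intros)
  then have "homeomorphic_maps (unit_sphere :: 'a topology) unit_sphere uminus uminus"
    by (simp add: homeomorphic_maps_def)
  then show ?thesis unfolding homeomorphic_map_maps by blast
qed

lemma quotient_map_projective_space: "quotient_map unit_sphere (projective_space :: 'a::euclidean_space set topology) antipodal_class"
  unfolding projective_space_def by (rule quotient_map_quotient_topology)

lemma topspace_projective_space: "topspace (projective_space :: 'a::euclidean_space set topology) = antipodal_class ` sphere 0 1"
  by (simp add: projective_space_def)

lemma antipodal_class_eq_iff: "antipodal_class u = antipodal_class v \<longleftrightarrow> u = v \<or> u = - v"
  by (auto simp: doubleton_eq_iff)

lemma vimage_antipodal_class:
  assumes "U \<subseteq> sphere (0::'a::euclidean_space) 1"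
  shows "{x \<in> topspace unit_sphere. antipodal_class x \<in> antipodal_class ` U} = U \<union> uminus ` U"
proof (intro subset_antisym subsetI)
  fix x assume "x \<in> {x \<in> topspace (unit_sphere :: 'a topology). antipodal_class x \<in> antipodal_class ` U}"
  then obtain u where "u \<in> U" "antipodal_class x = antipodal_class u" by auto
  then show "x \<in> U \<union> uminus ` U" unfolding antipodal_class_eq_iff by auto
next
  fix x assume "x \<in> U \<union> uminus ` U"
  then obtain u where u: "u \<in> U" "x = u \<or> x = - u" by auto
  then have "antipodal_class x = antipodal_class u" "x \<in> sphere 0 1" using assms by auto
  then show "x \<in> {x \<in> topspace unit_sphere. antipodal_class x \<in> antipodal_class ` U}" using u by auto
qed

lemma open_map_antipodal_class: "open_map unit_sphere (projective_space :: 'a::euclidean_space set topology) antipodal_class"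
  unfolding open_map_def
proof (intro allI impI)
  fix U :: "'a set" assume U: "openin unit_sphere U"
  then have s: "U \<subseteq> sphere 0 1" using openin_subset[OF U] by simp
  then have "openin unit_sphere (uminus ` U)"
    using U homeomorphic_map_openness[OF homeomorphic_map_uminus, of U] by simp
  then have "openin unit_sphere {x \<in> topspace unit_sphere. antipodal_class x \<in> antipodal_class ` U}"
    unfolding vimage_antipodal_class[OF s] using U by (rule openin_Un[rotated])
  moreover have "antipodal_class ` U \<subseteq> topspace projective_space"
    unfolding topspace_projective_space using s by (rule image_mono)
  ultimately show "openin projective_space (antipodal_class ` U)"
    using quotient_map_projective_space[where 'a = 'a, unfolded quotient_map_def, THEN conjunct2, rule_format, of "antipodal_class ` U"] by blast
qed

text \<open>Excision in projective space asks for a closed set between the images of B and W, which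
  is obtained as the image of a closed set upstairs.\<close>

lemma closed_map_antipodal_class: "closed_map unit_sphere (projective_space :: 'a::euclidean_space set topology) antipodal_class"
  unfolding closed_map_def
proof (intro allI impI)
  fix U :: "'a set" assume U: "closedin unit_sphere U"
  then have s: "U \<subseteq> sphere 0 1" using closedin_subset[OF U] by simp
  then have "closedin unit_sphere (uminus ` U)"
    using U homeomorphic_map_closedness[OF homeomorphic_map_uminus, of U] by simp
  then have "closedin unit_sphere {x \<in> topspace unit_sphere. antipodal_class x \<in> antipodal_class ` U}"
    unfolding vimage_antipodal_class[OF s] using U by (rule closedin_Un[rotated])
  moreover have "antipodal_class ` U \<subseteq> topspace projective_space"
    unfolding topspace_projective_space using s by (rule image_mono)
  ultimately show "closedin projective_space (antipodal_class ` U)"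
    using quotient_map_projective_space[where 'a = 'a, unfolded quotient_map_closedin, THEN conjunct2, rule_format, of "antipodal_class ` U"] by blast
qed

lemma continuous_map_antipodal_class: "continuous_map unit_sphere (projective_space :: 'a::euclidean_space set topology) antipodal_class"
  using quotient_map_projective_space by (rule quotient_imp_continuous_map)

text \<open>The parameter \<open>ty\<close> pins down the type of the ambient space. The bound on
  \<open>d\<close> makes the sphere connected and its top degree positive.\<close>

locale sphere_cover =
  fixes d :: nat and ty :: "'a::euclidean_space itself"
  assumes dim: "DIM('a) = Suc d" and d_pos: "d \<ge> 1"
begin

abbreviation S :: "'a set" where "S \<equiv> sphere 0 1"
abbreviation X :: "'a topology" where "X \<equiv> unit_sphere"
abbreviation P :: "'a set topology" where "P \<equiv> projective_space"
abbreviation "q \<equiv> antipodal_class :: 'a \<Rightarrow> 'a set"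
abbreviation "HX A \<equiv> relative_homology_group (int d) X A"
abbreviation "HP A \<equiv> relative_homology_group (int d) P A"
abbreviation "rest A A' \<equiv> hom_induced (int d) X A X A' id"
abbreviation "restP A A' \<equiv> hom_induced (int d) P A P A' id"
abbreviation "neg A A' \<equiv> hom_induced (int d) X A X A' uminus"
abbreviation "cap x c \<equiv> {u \<in> S. c < u \<bullet> x}"

lemma dim_minus_1: "DIM('a) - 1 = d"
  using dim by simp

lemma continuous_map_neg: "continuous_map X X uminus"
  using homeomorphic_map_uminus homeomorphic_imp_continuous_map by blast

lemma openin_cap: "openin X (cap x c)"
proof -
  have "open {u. c < u \<bullet> x}" by (intro open_Collect_less continuous_intros)
  then have "openin X (S \<inter> {u. c < u \<bullet> x})" by (rule openin_open_Int)
  then show ?thesis by (simp only: Collect_conj_eq Collect_mem_eq)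
qed

lemma closedin_closed_cap: "closedin X {u \<in> S. c \<le> u \<bullet> x}"
proof -
  have "closed {u. c \<le> u \<bullet> x}" by (intro closed_Collect_le continuous_intros)
  then have "closedin X (S \<inter> {u. c \<le> u \<bullet> x})" by (rule closedin_closed_Int)
  then show ?thesis by (simp only: Collect_conj_eq Collect_mem_eq)
qed

lemma centre_mem_cap: "x \<in> S \<Longrightarrow> c < 1 \<Longrightarrow> x \<in> cap x c"
  by (simp add: dot_square_norm)

lemma cap_neighbourhood:
  assumes "openin X U" "x \<in> U"
  obtains c where "1 / 2 \<le> c" "c < 1" "cap x c \<subseteq> U"
proof -
  have x: "x \<in> S" using assms openin_subset by fastforce
  obtain e where e: "e > 0" "\<And>u. u \<in> S \<Longrightarrow> dist u x < e \<Longrightarrow> u \<in> U"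
    using assms unfolding openin_euclidean_subtopology_iff by blast
  \<comment> \<open>As |u - x|^2 = 2 - 2 (u . x), heights above 1 - e^2 / 2 lie within distance e.
    The bound 1/2 keeps the cap strictly inside a hemisphere.\<close>
  define c where "c = max (1 / 2) (1 - e\<^sup>2 / 2)"
  show ?thesis
  proof (rule that)
    show "1 / 2 \<le> c" "c < 1" using e(1) by (auto simp: c_def)
    show "cap x c \<subseteq> U"
    proof
      fix u assume u: "u \<in> cap x c"
      have "(norm (u - x))\<^sup>2 = 2 - 2 * (u \<bullet> x)"
        using u x dot_norm_neg[of u x] by simp
      also have "\<dots> < e\<^sup>2" using u by (simp add: c_def)
      finally have "norm (u - x) < e" using e(1) by (simp add: power_less_imp_less_base)
      then show "u \<in> U" using e(2) u by (simp add: dist_norm)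
    qed
  qed
qed

lemma iso_rest_cap:
  assumes "x \<in> S" "- 1 \<le> c" "c < 1"
  shows "rest {} (S - cap x c) \<in> iso (HX {}) (HX (S - cap x c))"
proof -
  have "- x \<in> S - cap x c" using assms by (simp add: dot_square_norm)
  then have "S - cap x c \<noteq> {}" by blast
  then show ?thesis
    using assms dim d_pos by (intro iso_homology_sphere_relative[where 'a = 'a, unfolded dim_minus_1]) (auto simp: dot_square_norm)
qed

lemma iso_rest_point:
  assumes "x \<in> S"
  shows "rest {} (S - {x}) \<in> iso (HX {}) (HX (S - {x}))"
proof -
  have lt: "u \<bullet> x < 1" if "u \<in> S" "u \<noteq> x" for u
  proof -
    have "(norm (u - x))\<^sup>2 = 2 - 2 * (u \<bullet> x)"
      using that assms dot_norm_neg[of u x] by simp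
    moreover have "0 < (norm (u - x))\<^sup>2" using that by simp
    ultimately show ?thesis by simp
  qed
  have "- x \<noteq> x"
  proof
    assume "- x = x"
    then have "(- x) \<bullet> x = x \<bullet> x" by (rule arg_cong)
    then show False using assms by (simp add: dot_square_norm)
  qed
  then have "- x \<in> S - {x}" using assms by simp
  then have "S - {x} \<noteq> {}" by blast
  moreover have "w \<in> S - {x}" if "u \<in> S - {x}" "norm w = 1" "w \<bullet> x \<le> u \<bullet> x" for u w
    using that lt[of u] assms by (auto simp: dot_square_norm)
  ultimately show ?thesis
    using assms dim d_pos by (intro iso_homology_sphere_relative[where 'a = 'a, unfolded dim_minus_1]) auto
qed

lemma rest_rest: "A \<subseteq> A' \<Longrightarrow> A' \<subseteq> A'' \<Longrightarrow> rest A' A'' (rest A A' a) = rest A A'' a"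
  by (subst hom_induced_compose') auto

lemma restP_restP: "A \<subseteq> A' \<Longrightarrow> A' \<subseteq> A'' \<Longrightarrow> restP A' A'' (restP A A' a) = restP A A'' a"
  by (subst hom_induced_compose') auto

lemma ex_fundamental_class:
  "\<exists>c\<in>carrier (HX {}). bij_betw (\<lambda>k::int. c [^]\<^bsub>HX {}\<^esub> k) UNIV (carrier (HX {}))"
proof -
  have "HX {} \<cong> integer_group"
    using homology_unit_sphere(1)[where 'a = 'a] dim d_pos by simp
  then have "integer_group \<cong> HX {}" by (rule group.iso_sym[rotated]) simp
  then obtain f where f: "f \<in> iso integer_group (HX {})" by (auto simp: is_iso_def)
  then have hom: "f \<in> hom integer_group (HX {})" and bij: "bij_betw f UNIV (carrier (HX {}))"
    by (auto simp: iso_def)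
  have "f k = f 1 [^]\<^bsub>HX {}\<^esub> k" for k :: int
    using hom_int_pow[OF hom, of 1 k] by simp
  then have "f = (\<lambda>k. f 1 [^]\<^bsub>HX {}\<^esub> k)" by (rule ext)
  moreover have "f 1 \<in> carrier (HX {})" using bij by (auto simp: bij_betw_def)
  ultimately show ?thesis using bij by metis
qed

definition fundamental_class :: "'a chain set" where
  "fundamental_class = (SOME c. c \<in> carrier (HX {}) \<and> bij_betw (\<lambda>k::int. c [^]\<^bsub>HX {}\<^esub> k) UNIV (carrier (HX {})))"

lemma fundamental_class: "fundamental_class \<in> carrier (HX {})"
  "bij_betw (\<lambda>k::int. fundamental_class [^]\<^bsub>HX {}\<^esub> k) UNIV (carrier (HX {}))"
  using someI_ex[OF ex_fundamental_class[unfolded Bex_def]] unfolding fundamental_class_def by auto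

definition local_class :: "'a set \<Rightarrow> 'a chain set" where
  "local_class A = rest {} A fundamental_class"

lemma local_class_carrier: "local_class A \<in> carrier (HX A)"
  unfolding local_class_def by (rule hom_induced_carrier)

lemma rest_local_class: "A \<subseteq> A' \<Longrightarrow> rest A A' (local_class A) = local_class A'"
  unfolding local_class_def by (rule rest_rest) auto

lemma rest_pow: "a \<in> carrier (HX A) \<Longrightarrow> rest A A' (a [^]\<^bsub>HX A\<^esub> (k::int)) = rest A A' a [^]\<^bsub>HX A'\<^esub> k"
  by (intro hom_int_pow hom_induced_hom) auto

lemma neg_pow: "a \<in> carrier (HX A) \<Longrightarrow> neg A A' (a [^]\<^bsub>HX A\<^esub> (k::int)) = neg A A' a [^]\<^bsub>HX A'\<^esub> k"
  by (intro hom_int_pow hom_induced_hom) auto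

text \<open>Bijectivity assigns a unique integer exponent to every class, so orientations can be
  compared as integer-valued functions.\<close>

lemma local_class_bij:
  assumes "rest {} A \<in> iso (HX {}) (HX A)"
  shows "bij_betw (\<lambda>k::int. local_class A [^]\<^bsub>HX A\<^esub> k) UNIV (carrier (HX A))"
proof -
  have "bij_betw (rest {} A \<circ> (\<lambda>k::int. fundamental_class [^]\<^bsub>HX {}\<^esub> k)) UNIV (carrier (HX A))"
    using assms by (intro bij_betw_trans[OF fundamental_class(2)]) (auto simp: iso_def)
  then show ?thesis by (simp add: o_def rest_pow fundamental_class local_class_def)
qed

text \<open>The local class is the restriction of the fundamental class, so by naturality the
  antipodal map acts locally through its global degree.\<close>

lemma neg_local_class:
  assumes "uminus ` A \<subseteq> A'"
  shows "neg A A' (local_class A) = local_class A' [^]\<^bsub>HX A'\<^esub> ((- 1) ^ Suc d :: int)"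
proof -
  have "neg A A' (local_class A) = rest {} A' (neg {} {} fundamental_class)"
    unfolding local_class_def using assms continuous_map_neg
    by (subst hom_induced_compose'; (subst hom_induced_compose')?) auto
  also have "neg {} {} fundamental_class = fundamental_class [^]\<^bsub>HX {}\<^esub> ((- 1) ^ Suc d :: int)"
    using homology_unit_sphere(2)[where 'a = 'a, of fundamental_class] fundamental_class(1) dim d_pos by simp
  finally show ?thesis by (simp only: rest_pow[OF fundamental_class(1)] local_class_def)
qed

lemma generator_local_class_point:
  assumes "x \<in> S"
  shows "carrier (HX (S - {x})) = generate (HX (S - {x})) {local_class (S - {x})}"
proof -
  have "generate (HX (S - {x})) {local_class (S - {x})} = range (\<lambda>k::int. local_class (S - {x}) [^]\<^bsub>HX (S - {x})\<^esub> k)"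
    by (subst group.generate_pow) (auto simp: local_class_carrier)
  then show ?thesis
    using local_class_bij[OF iso_rest_point[OF assms]] by (simp add: bij_betw_def)
qed

lemma orientation_local_class: "orientation d X (\<lambda>x. local_class (S - {x}))"
  unfolding orientation_def
proof (intro conjI ballI)
  fix x assume "x \<in> topspace X"
  then have x: "x \<in> S" by simp
  show "local_class (S - {x}) \<in> carrier (relative_homology_group (int d) X (topspace X - {x}))"
    using local_class_carrier by simp
  show "carrier (relative_homology_group (int d) X (topspace X - {x})) =
      generate (relative_homology_group (int d) X (topspace X - {x})) {local_class (S - {x})}"
    using generator_local_class_point[OF x] by simp
  show "\<exists>U. openin X U \<and> x \<in> U \<and>
      (\<exists>c\<in>carrier (relative_homology_group (int d) X (topspace X - U)).
         \<forall>y\<in>U. hom_induced (int d) X (topspace X - U) X (topspace X - {y}) id c = local_class (S - {y}))"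
  \<comment> \<open>One global class induces all local ones, so the whole sphere serves as
    neighbourhood.\<close>
  proof (intro exI[of _ S] conjI bexI[of _ fundamental_class])
    show "openin X S" using openin_topspace[of X] by simp
  qed (use x fundamental_class in \<open>auto simp: local_class_def\<close>)
qed

text \<open>On a small cap the orientation comes from one class, and restriction to points preserves
  exponents, so the exponent is locally constant, hence constant on the connected sphere. It is
  nonzero because the trivial class does not generate an infinite cyclic group.\<close>

lemma orientation_eq_power:
  assumes "orientation d X \<mu>"
  shows "\<exists>k :: int. k \<noteq> 0 \<and> (\<forall>x\<in>S. \<mu> x = local_class (S - {x}) [^]\<^bsub>HX (S - {x})\<^esub> k)"
proof -
  let ?l = "\<lambda>x. local_class (S - {x})"
  have \<mu>: "\<mu> x \<in> carrier (HX (S - {x}))" "carrier (HX (S - {x})) = generate (HX (S - {x})) {\<mu> x}" if "x \<in> S" for x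
    using assms that unfolding orientation_def by auto
  have bij: "bij_betw (\<lambda>k::int. ?l x [^]\<^bsub>HX (S - {x})\<^esub> k) UNIV (carrier (HX (S - {x})))" if "x \<in> S" for x
    by (rule local_class_bij[OF iso_rest_point[OF that]])
  have "\<forall>x\<in>S. \<exists>k::int. \<mu> x = ?l x [^]\<^bsub>HX (S - {x})\<^esub> k"
    using \<mu>(1) bij unfolding bij_betw_def by blast
  then obtain \<epsilon> :: "'a \<Rightarrow> int" where \<epsilon>: "\<And>x. x \<in> S \<Longrightarrow> \<mu> x = ?l x [^]\<^bsub>HX (S - {x})\<^esub> \<epsilon> x" by metis
  have "\<epsilon> constant_on S"
  proof (rule locally_constant_imp_constant)
    show "connected S" using dim d_pos by (intro connected_sphere) simp
    fix x assume x: "x \<in> S"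
    have "\<exists>U. openin X U \<and> x \<in> U \<and> (\<exists>c\<in>carrier (HX (S - U)). \<forall>y\<in>U. rest (S - U) (S - {y}) c = \<mu> y)"
      using assms[unfolded orientation_def, THEN conjunct2, rule_format, of x] x by simp
    then obtain U c where U: "openin X U" "x \<in> U" and c: "c \<in> carrier (HX (S - U))"
        "\<And>y. y \<in> U \<Longrightarrow> rest (S - U) (S - {y}) c = \<mu> y"
      by blast
    obtain b where b: "1 / 2 \<le> b" "b < 1" "cap x b \<subseteq> U" using cap_neighbourhood[OF U] .
    define A where "A = S - cap x b"
    have "rest {} A \<in> iso (HX {}) (HX A)" unfolding A_def using b by (intro iso_rest_cap x) auto
    then have "carrier (HX A) = range (\<lambda>k::int. local_class A [^]\<^bsub>HX A\<^esub> k)"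
      using local_class_bij[of A] by (simp add: bij_betw_def)
    moreover have "rest (S - U) A c \<in> carrier (HX A)" by (rule hom_induced_carrier)
    ultimately obtain k :: int where k: "rest (S - U) A c = local_class A [^]\<^bsub>HX A\<^esub> k" by blast
    have "\<epsilon> y = k" if y: "y \<in> cap x b" for y
    proof -
      have yS: "y \<in> S" using y by simp
      have "\<mu> y = rest (S - U) (S - {y}) c" using y b(3) c(2)[of y] by auto
      also have "\<dots> = rest A (S - {y}) (rest (S - U) A c)"
        using y b(3) by (intro rest_rest[symmetric]) (auto simp: A_def)
      also have "\<dots> = rest A (S - {y}) (local_class A) [^]\<^bsub>HX (S - {y})\<^esub> k"
        unfolding k by (rule rest_pow[OF local_class_carrier])
      also have "rest A (S - {y}) (local_class A) = ?l y"
        using y by (intro rest_local_class) (auto simp: A_def)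
      finally have "?l y [^]\<^bsub>HX (S - {y})\<^esub> \<epsilon> y = ?l y [^]\<^bsub>HX (S - {y})\<^esub> k" using \<epsilon>[OF yS] by simp
      then show ?thesis using bij[OF yS] by (auto simp: bij_betw_def dest: injD)
    qed
    moreover have "x \<in> cap x b" using centre_mem_cap x b(2) .
    ultimately show "\<exists>T. openin (top_of_set S) T \<and> x \<in> T \<and> (\<forall>y\<in>T. \<epsilon> y = \<epsilon> x)"
      using openin_cap[of b x] by (intro exI[of _ "cap x b"]) auto
  qed
  then obtain k where k: "\<And>x. x \<in> S \<Longrightarrow> \<epsilon> x = k" by (auto simp: constant_on_def)
  have "k \<noteq> 0"
  proof
    assume "k = 0"
    obtain x :: 'a where x: "x \<in> S" using vector_choose_size[of 1] by auto
    interpret G: group "HX (S - {x})" by simp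
    have "\<mu> x = \<one>\<^bsub>HX (S - {x})\<^esub>" using \<epsilon>[OF x] k[OF x] \<open>k = 0\<close> by simp
    then have "carrier (HX (S - {x})) = {\<one>\<^bsub>HX (S - {x})\<^esub>}" using \<mu>(2)[OF x] G.generate_one by simp
    then have "?l x [^]\<^bsub>HX (S - {x})\<^esub> (0::int) = ?l x [^]\<^bsub>HX (S - {x})\<^esub> (1::int)"
      using local_class_carrier[of "S - {x}"] by simp
    moreover have "inj (\<lambda>k::int. ?l x [^]\<^bsub>HX (S - {x})\<^esub> k)" using bij[OF x] by (simp add: bij_betw_def)
    ultimately have "(0::int) = 1" by (rule injD[rotated])
    then show False by simp
  qed
  then show ?thesis using \<epsilon> k by (intro exI[of _ k]) auto
qed

lemma orientation_preserving_uminus: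
  assumes "odd d"
  shows "orientation_preserving d X uminus"
  unfolding orientation_preserving_def
proof (intro conjI allI impI ballI)
  show "homeomorphic_map X X uminus" by (rule homeomorphic_map_uminus)
  show "orientable d X" using orientation_local_class by (auto simp: orientable_def)
  fix \<mu> x assume \<mu>: "orientation d X \<mu>" and "x \<in> topspace X"
  then have x: "x \<in> S" "- x \<in> S" by auto
  obtain k :: int where "\<forall>x\<in>S. \<mu> x = local_class (S - {x}) [^]\<^bsub>HX (S - {x})\<^esub> k"
    using orientation_eq_power[OF \<mu>] by blast
  then have k: "\<mu> x = local_class (S - {x}) [^]\<^bsub>HX (S - {x})\<^esub> k" if "x \<in> S" for x using that by blast
  have "neg (S - {x}) (S - {- x}) (\<mu> x) = neg (S - {x}) (S - {- x}) (local_class (S - {x})) [^]\<^bsub>HX (S - {- x})\<^esub> k"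
    using x by (simp add: k neg_pow local_class_carrier)
  also have "neg (S - {x}) (S - {- x}) (local_class (S - {x})) = local_class (S - {- x})"
    using assms by (subst neg_local_class) (auto simp: group.int_pow_1[OF group_relative_homology_group local_class_carrier])
  finally show "hom_induced (int d) X (topspace X - {x}) X (topspace X - {- x}) uminus (\<mu> x) = \<mu> (- x)"
    using x by (simp add: k)
qed

end

section \<open>Orientations of projective space\<close>

context sphere_cover
begin

abbreviation "HW W B \<equiv> relative_homology_group (int d) (subtopology X W) (W - B)"
abbreviation "to_sphere W B \<equiv> hom_induced (int d) (subtopology X W) (W - B) X (S - B) id"
abbreviation "to_proj W B \<equiv> hom_induced (int d) (subtopology X W) (W - B) P (topspace P - q ` B) q"

text \<open>\<open>W\<close> contains no antipodal pair, so q is injective on it; the closed set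
  between \<open>B\<close> and \<open>W\<close> is what excision requires upstairs and, through its
  image, downstairs.\<close>

definition evenly_covered :: "'a set \<Rightarrow> 'a set \<Rightarrow> bool" where
  "evenly_covered W B \<longleftrightarrow> openin X W \<and> (\<forall>u\<in>W. - u \<notin> W) \<and> (\<exists>C. closedin X C \<and> B \<subseteq> C \<and> C \<subseteq> W)"

text \<open>The isomorphism between the local homology groups of the sphere and of projective space
  along \<open>B\<close>, as a relation: both sides receive a class of the evenly covered set \<open>W\<close>.\<close>

definition corresponds :: "'a set \<Rightarrow> 'a set \<Rightarrow> 'a chain set \<Rightarrow> 'a set chain set \<Rightarrow> bool" where
  "corresponds W B a b \<longleftrightarrow> (\<exists>e\<in>carrier (HW W B).
     to_sphere W B e = a \<and>
     to_proj W B e = b)"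

lemma openin_image_class: "openin X U \<Longrightarrow> openin P (q ` U)"
  using open_map_antipodal_class[where 'a = 'a] unfolding open_map_def by blast

lemma closedin_image_class: "closedin X U \<Longrightarrow> closedin P (q ` U)"
  using closed_map_antipodal_class[where 'a = 'a] unfolding closed_map_def by blast

lemma evenly_covered_subset: "evenly_covered W B \<Longrightarrow> W \<subseteq> S" "evenly_covered W B \<Longrightarrow> B \<subseteq> W"
  unfolding evenly_covered_def using openin_subset by fastforce+

lemma inj_on_evenly_covered: "evenly_covered W B \<Longrightarrow> inj_on q W"
  unfolding evenly_covered_def by (intro inj_onI) (metis antipodal_class_eq_iff add.inverse_inverse)

lemma iso_upstairs:
  assumes "evenly_covered W B"
  shows "to_sphere W B \<in>
    iso (HW W B) (HX (S - B))"
  using assms iso_excision_open[of X W _ B "int d"] unfolding evenly_covered_def by auto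

text \<open>q is open and injective on \<open>W\<close>, hence a homeomorphism onto an open set, and
  excision in projective space replaces that open set by the whole space.\<close>

lemma iso_downstairs:
  assumes e: "evenly_covered W B"
  shows "to_proj W B \<in>
    iso (HW W B) (HP (topspace P - q ` B))"
proof -
  obtain C where W: "openin X W" and C: "closedin X C" "B \<subseteq> C" "C \<subseteq> W"
    using e unfolding evenly_covered_def by blast
  have WS: "W \<subseteq> S" and BW: "B \<subseteq> W" and inj: "inj_on q W"
    using evenly_covered_subset[OF e] inj_on_evenly_covered[OF e] by auto
  let ?XW = "subtopology X W" and ?PW = "subtopology P (q ` W)"
  have top: "topspace ?XW = W" "topspace ?PW = q ` W"
    using WS by (auto simp: topspace_projective_space)
  have qW: "openin P (q ` W)" using W by (rule openin_image_class)
  have hom: "homeomorphic_map ?XW ?PW q"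
  proof (rule bijective_open_imp_homeomorphic_map)
    show "continuous_map ?XW ?PW q"
      by (rule continuous_map_into_subtopology[OF continuous_map_from_subtopology[OF continuous_map_antipodal_class]]) auto
    show "open_map ?XW ?PW q"
      unfolding open_map_def
    proof (intro allI impI)
      fix U assume U: "openin ?XW U"
      then have "openin X U" "U \<subseteq> W" using W by (auto simp: openin_open_subtopology)
      then show "openin ?PW (q ` U)"
        using qW openin_image_class by (auto simp: openin_open_subtopology)
    qed
  qed (use top inj in auto)
  have img: "q ` (W - B) = q ` W - q ` B"
    by (rule inj_on_image_set_diff[OF inj Diff_subset BW])
  have 1: "hom_induced (int d) ?XW (W - B) ?PW (q ` W - q ` B) q \<in>
     iso (relative_homology_group (int d) ?XW (W - B)) (relative_homology_group (int d) ?PW (q ` W - q ` B))"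
    using hom img by (intro homeomorphic_map_relative_homology_iso) (simp_all only: top Diff_subset)
  have 2: "hom_induced (int d) ?PW (q ` W - q ` B) P (topspace P - q ` B) id \<in>
     iso (relative_homology_group (int d) ?PW (q ` W - q ` B)) (HP (topspace P - q ` B))"
  proof (rule iso_excision_open[OF qW])
    show "closedin P (q ` C)" using C(1) by (rule closedin_image_class)
  qed (use C in auto)
  have "hom_induced (int d) ?XW (W - B) P (topspace P - q ` B) (id \<circ> q) =
    hom_induced (int d) ?PW (q ` W - q ` B) P (topspace P - q ` B) id \<circ> hom_induced (int d) ?XW (W - B) ?PW (q ` W - q ` B) q"
  proof (rule hom_induced_compose)
    show "continuous_map ?XW ?PW q" using hom by (rule homeomorphic_imp_continuous_map)
    show "q \<in> W - B \<rightarrow> q ` W - q ` B" using img by blast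
    show "id \<in> q ` W - q ` B \<rightarrow> topspace P - q ` B" using WS by (auto simp: topspace_projective_space)
  qed simp
  then show ?thesis using iso_set_trans[OF 1 2] by simp
qed

lemma corresponds_carrier:
  assumes "corresponds W B a b"
  shows "a \<in> carrier (HX (S - B))" "b \<in> carrier (HP (topspace P - q ` B))"
  using assms unfolding corresponds_def by (auto intro: hom_induced_carrier)

lemma corresponds_ex_down:
  assumes "evenly_covered W B" "a \<in> carrier (HX (S - B))"
  shows "\<exists>b. corresponds W B a b"
proof -
  let ?G = "HW W B"
  have "to_sphere W B ` carrier ?G = carrier (HX (S - B))"
    using iso_upstairs[OF assms(1)] unfolding iso_def bij_betw_def by blast
  then obtain e where "e \<in> carrier ?G" "to_sphere W B e = a"
    using assms(2) by (elim equalityE) blast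
  then show ?thesis unfolding corresponds_def by blast
qed

lemma corresponds_ex_up:
  assumes "evenly_covered W B" "b \<in> carrier (HP (topspace P - q ` B))"
  shows "\<exists>a. corresponds W B a b"
proof -
  let ?G = "HW W B"
  have "to_proj W B ` carrier ?G = carrier (HP (topspace P - q ` B))"
    using iso_downstairs[OF assms(1)] unfolding iso_def bij_betw_def by blast
  then obtain e where "e \<in> carrier ?G" "to_proj W B e = b"
    using assms(2) by (elim equalityE) blast
  then show ?thesis unfolding corresponds_def by blast
qed

lemma corresponds_unique_down:
  assumes "evenly_covered W B" "corresponds W B a b" "corresponds W B a b'"
  shows "b = b'"
proof -
  let ?G = "HW W B"
  have inj: "inj_on (to_sphere W B) (carrier ?G)"
    using iso_upstairs[OF assms(1)] by (simp add: iso_def bij_betw_def)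
  obtain e where e: "e \<in> carrier ?G" "to_sphere W B e = a" "to_proj W B e = b"
    using assms(2) unfolding corresponds_def by blast
  obtain e' where e': "e' \<in> carrier ?G" "to_sphere W B e' = a" "to_proj W B e' = b'"
    using assms(3) unfolding corresponds_def by blast
  have "e = e'" by (rule inj_onD[OF inj _ e(1) e'(1)]) (simp only: e e')
  then show ?thesis using e e' by simp
qed

lemma corresponds_unique_up:
  assumes "evenly_covered W B" "corresponds W B a b" "corresponds W B a' b"
  shows "a = a'"
proof -
  let ?G = "HW W B"
  have inj: "inj_on (to_proj W B) (carrier ?G)"
    using iso_downstairs[OF assms(1)] by (simp add: iso_def bij_betw_def)
  obtain e where e: "e \<in> carrier ?G" "to_sphere W B e = a" "to_proj W B e = b"
    using assms(2) unfolding corresponds_def by blast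
  obtain e' where e': "e' \<in> carrier ?G" "to_sphere W B e' = a'" "to_proj W B e' = b"
    using assms(3) unfolding corresponds_def by blast
  have "e = e'" by (rule inj_onD[OF inj _ e(1) e'(1)]) (simp only: e e')
  then show ?thesis using e e' by simp
qed

lemma corresponds_generator:
  assumes "evenly_covered W B" "corresponds W B a b"
  shows "carrier (HX (S - B)) = generate (HX (S - B)) {a} \<longleftrightarrow>
    carrier (HP (topspace P - q ` B)) = generate (HP (topspace P - q ` B)) {b}"
proof -
  obtain e where e: "e \<in> carrier (HW W B)"
     "to_sphere W B e = a"
     "to_proj W B e = b"
    using assms(2) unfolding corresponds_def by blast
  show ?thesis
    using generate_singleton_iso[OF _ _ iso_upstairs[OF assms(1)] e(1)]
      generate_singleton_iso[OF _ _ iso_downstairs[OF assms(1)] e(1)] e(2,3) by simp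
qed

lemma evenly_covered_funcset:
  assumes "evenly_covered W B"
  shows "q \<in> W - B \<rightarrow> topspace P - q ` B"
proof
  fix u assume u: "u \<in> W - B"
  then have "q u \<notin> q ` B"
    using inj_on_evenly_covered[OF assms] evenly_covered_subset[OF assms] by (auto dest: inj_onD)
  then show "q u \<in> topspace P - q ` B"
    using u evenly_covered_subset[OF assms] by (auto simp: topspace_projective_space)
qed

lemma continuous_map_subspace_id: "W' \<subseteq> W \<Longrightarrow> continuous_map (subtopology X W') (subtopology X W) id"
  by (rule continuous_map_into_subtopology[OF continuous_map_from_subtopology[OF continuous_map_id]]) auto

lemma continuous_map_subspace_class: "continuous_map (subtopology X W) P q"
  by (intro continuous_map_from_subtopology continuous_map_antipodal_class)

lemma continuous_map_subspace_incl: "continuous_map (subtopology X W) X id"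
  by (rule continuous_map_from_subtopology[OF continuous_map_id])

lemma corresponds_mono:
  assumes W: "evenly_covered W B" and "W' \<subseteq> W" "corresponds W' B a b"
  shows "corresponds W B a b"
proof -
  obtain e where e: "e \<in> carrier (HW W' B)"
     "to_sphere W' B e = a"
     "to_proj W' B e = b"
    using assms(3) unfolding corresponds_def by blast
  let ?i = "hom_induced (int d) (subtopology X W') (W' - B) (subtopology X W) (W - B) id"
  have i: "id \<in> W' - B \<rightarrow> W - B" "id \<in> W - B \<rightarrow> S - B"
    using assms(2) evenly_covered_subset(1)[OF W] by auto
  show ?thesis
    unfolding corresponds_def
  proof (intro bexI[of _ "?i e"] conjI)
    show "to_sphere W B (?i e) = a"
      using e(2) hom_induced_compose'[OF continuous_map_subspace_id[OF assms(2)] i(1) continuous_map_subspace_incl i(2), of "int d" e]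
      by (simp only: id_o)
    show "to_proj W B (?i e) = b"
      using e(3) hom_induced_compose'[OF continuous_map_subspace_id[OF assms(2)] i(1) continuous_map_subspace_class evenly_covered_funcset[OF W], of "int d" e]
      by (simp only: o_id)
  qed (rule hom_induced_carrier)
qed

text \<open>Restriction to a smaller set can be performed on the class of \<open>W\<close> itself,
  and naturality carries it to both sides. This transports the local coherence of
  orientations.\<close>

lemma corresponds_restrict:
  assumes W: "evenly_covered W B" and "corresponds W B a b" and B': "evenly_covered W B'" "B' \<subseteq> B"
  shows "corresponds W B' (rest (S - B) (S - B') a) (restP (topspace P - q ` B) (topspace P - q ` B') b)"
proof -
  obtain e where e: "e \<in> carrier (HW W B)"
     "to_sphere W B e = a"
     "to_proj W B e = b"
    using assms(2) unfolding corresponds_def by blast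
  let ?i = "hom_induced (int d) (subtopology X W) (W - B) (subtopology X W) (W - B') id"
  have i: "id \<in> W - B \<rightarrow> W - B'" "id \<in> W - B \<rightarrow> S - B" "id \<in> W - B' \<rightarrow> S - B'" "id \<in> S - B \<rightarrow> S - B'"
      "id \<in> topspace P - q ` B \<rightarrow> topspace P - q ` B'"
    using B'(2) evenly_covered_subset(1)[OF W] by auto
  note cW = continuous_map_subspace_id[OF subset_refl, of W]
  show ?thesis
    unfolding corresponds_def
  proof (intro bexI[of _ "?i e"] conjI)
    have "to_sphere W B' (?i e) = hom_induced (int d) (subtopology X W) (W - B) X (S - B') (id \<circ> id) e"
      by (rule hom_induced_compose'[OF cW i(1) continuous_map_subspace_incl i(3)])
    also have "\<dots> = rest (S - B) (S - B') (to_sphere W B e)"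
      by (rule hom_induced_compose'[OF continuous_map_subspace_incl i(2) continuous_map_id i(4), symmetric])
    finally show "to_sphere W B' (?i e) = rest (S - B) (S - B') a"
      unfolding e(2) .
    have "to_proj W B' (?i e) = hom_induced (int d) (subtopology X W) (W - B) P (topspace P - q ` B') (q \<circ> id) e"
      by (rule hom_induced_compose'[OF cW i(1) continuous_map_subspace_class evenly_covered_funcset[OF B'(1)]])
    also have "\<dots> = hom_induced (int d) (subtopology X W) (W - B) P (topspace P - q ` B') (id \<circ> q) e" by (simp only: id_o o_id)
    also have "\<dots> = restP (topspace P - q ` B) (topspace P - q ` B') (to_proj W B e)"
      by (rule hom_induced_compose'[OF continuous_map_subspace_class evenly_covered_funcset[OF W] continuous_map_id i(5), symmetric])
    finally show "to_proj W B' (?i e) = restP (topspace P - q ` B) (topspace P - q ` B') b"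
      unfolding e(3) .
  qed (rule hom_induced_carrier)
qed

lemma evenly_covered_neg:
  assumes "evenly_covered W B"
  shows "evenly_covered (uminus ` W) (uminus ` B)"
proof -
  obtain C where W: "openin X W" "\<And>u. u \<in> W \<Longrightarrow> - u \<notin> W" and C: "closedin X C" "B \<subseteq> C" "C \<subseteq> W"
    using assms unfolding evenly_covered_def by blast
  have "openin X (uminus ` W)"
    using W(1) homeomorphic_map_openness_eq[OF homeomorphic_map_uminus] by blast
  moreover have "closedin X (uminus ` C)"
    using C(1) homeomorphic_map_closedness_eq[OF homeomorphic_map_uminus] by blast
  ultimately show ?thesis
    unfolding evenly_covered_def using W(2) C by (auto intro!: exI[of _ "uminus ` C"])
qed

lemma image_antipodal_class_neg: "q ` uminus ` B = q ` B"
  by (simp add: image_image insert_commute)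

text \<open>Since q composed with the antipodal map is q, moving the class of \<open>W\<close> to
  the antipodal set changes the spherical side by the antipodal map and leaves the projective side
  fixed.\<close>

lemma corresponds_neg:
  assumes W: "evenly_covered W B" and "corresponds W B a b"
  shows "corresponds (uminus ` W) (uminus ` B) (neg (S - B) (S - uminus ` B) a) b"
proof -
  let ?W = "uminus ` W" and ?B = "uminus ` B"
  obtain e where e: "e \<in> carrier (HW W B)"
     "to_sphere W B e = a"
     "to_proj W B e = b"
    using assms(2) unfolding corresponds_def by blast
  note W' = evenly_covered_neg[OF W]
  let ?i = "hom_induced (int d) (subtopology X W) (W - B) (subtopology X ?W) (?W - ?B) uminus"
  have i: "uminus \<in> W - B \<rightarrow> ?W - ?B" "id \<in> W - B \<rightarrow> S - B" "id \<in> ?W - ?B \<rightarrow> S - ?B" "uminus \<in> S - B \<rightarrow> S - ?B"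
    using evenly_covered_subset(1)[OF W] by auto
  have c: "continuous_map (subtopology X W) (subtopology X ?W) uminus"
    by (rule continuous_map_into_subtopology[OF continuous_map_from_subtopology[OF continuous_map_neg]]) auto
  show ?thesis
    unfolding corresponds_def
  proof (intro bexI[of _ "?i e"] conjI)
    have "to_sphere ?W ?B (?i e) = hom_induced (int d) (subtopology X W) (W - B) X (S - ?B) (id \<circ> uminus) e"
      by (rule hom_induced_compose'[OF c i(1) continuous_map_subspace_incl i(3)])
    also have "\<dots> = hom_induced (int d) (subtopology X W) (W - B) X (S - ?B) (uminus \<circ> id) e" by (simp only: id_o o_id)
    also have "\<dots> = neg (S - B) (S - ?B) (to_sphere W B e)"
      by (rule hom_induced_compose'[OF continuous_map_subspace_incl i(2) continuous_map_neg i(4), symmetric])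
    finally show "to_sphere ?W ?B (?i e) = neg (S - B) (S - ?B) a"
      unfolding e(2) .
    have "to_proj ?W ?B (?i e) = hom_induced (int d) (subtopology X W) (W - B) P (topspace P - q ` ?B) (q \<circ> uminus) e"
      by (rule hom_induced_compose'[OF c i(1) continuous_map_subspace_class evenly_covered_funcset[OF W']])
    also have "q \<circ> uminus = q" by (auto simp: fun_eq_iff)
    finally show "to_proj ?W ?B (?i e) = b"
      unfolding image_antipodal_class_neg e(3) .
  qed (rule hom_induced_carrier)
qed

lemma evenly_covered_cap:
  assumes "0 < c"
  shows "evenly_covered (cap x 0) (cap x c)"
  unfolding evenly_covered_def
  using openin_cap[of 0 x] closedin_closed_cap[of c x] assms
  by (auto intro!: exI[of _ "{u \<in> S. c \<le> u \<bullet> x}"])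

lemma evenly_covered_point:
  assumes "openin X W" "\<And>u. u \<in> W \<Longrightarrow> - u \<notin> W" "y \<in> W"
  shows "evenly_covered W {y}"
proof -
  have "y \<in> S" using assms openin_subset[OF assms(1)] by auto
  then have "closedin X {y}" by (intro closed_subset) auto
  then show ?thesis unfolding evenly_covered_def using assms by (intro conjI ballI exI[of _ "{y}"]) auto
qed

lemma evenly_covered_cap_point: "0 \<le> c \<Longrightarrow> y \<in> cap x c \<Longrightarrow> evenly_covered (cap x 0) {y}"
  by (rule evenly_covered_point[OF openin_cap]) auto

text \<open>A class on the intersection of the two neighbourhoods yields the same pair in both, so
  the correspondence at a point does not depend on the neighbourhood.\<close>

lemma corresponds_point_change:
  assumes W: "evenly_covered W {y}" and W': "evenly_covered W' {y}" and ab: "corresponds W {y} a b"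
  shows "corresponds W' {y} a b"
proof -
  have WW: "evenly_covered (W \<inter> W') {y}"
    using W W' evenly_covered_subset[OF W] evenly_covered_subset[OF W']
    by (intro evenly_covered_point) (auto simp: evenly_covered_def)
  obtain b' where b': "corresponds (W \<inter> W') {y} a b'"
    using corresponds_ex_down[OF WW corresponds_carrier(1)[OF ab]] by blast
  have "corresponds W {y} a b'" by (rule corresponds_mono[OF W _ b']) simp
  then have "b' = b" using corresponds_unique_down[OF W] ab by blast
  moreover have "corresponds W' {y} a b'" by (rule corresponds_mono[OF W' _ b']) simp
  ultimately show ?thesis by simp
qed

lemma corresponds_point_neg:
  assumes W: "evenly_covered W {y}" and W': "evenly_covered W' {- y}" and ab: "corresponds W {y} a b"
  shows "corresponds W' {- y} (neg (S - {y}) (S - {- y}) a) b"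
  using corresponds_neg[OF W ab] evenly_covered_neg[OF W] W'
  by (auto intro: corresponds_point_change)

text \<open>The local classes of the sphere are pushed down. For odd d the antipodal map carries the
  class at y to the class at -y, so both preimages of a point give the same class; coherence near a
  point comes from one class on a cap.\<close>

lemma orientable_projective_space:
  assumes "odd d"
  shows "orientable d P"
proof -
  let ?l = "\<lambda>y. local_class (S - {y})"
  define rel where "rel p b \<longleftrightarrow> (\<exists>W y. q y = p \<and> evenly_covered W {y} \<and> corresponds W {y} (?l y) b)" for p b
  have unique: "b = b'" if b: "rel p b" and b': "rel p b'" for p b b'
  proof -
    obtain W y where W: "q y = p" "evenly_covered W {y}" "corresponds W {y} (?l y) b" using b unfolding rel_def by blast
    obtain W' y' where W': "q y' = p" "evenly_covered W' {y'}" "corresponds W' {y'} (?l y') b'" using b' unfolding rel_def by blast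
    have "q y' = q y" using W(1) W'(1) by simp
    then consider "y' = y" | "y' = - y" unfolding antipodal_class_eq_iff by blast
    then show ?thesis
    proof cases
      case 1
      then have "corresponds W {y} (?l y) b'" using corresponds_point_change[OF W'(2) _ W'(3)] W(2) by simp
      then show ?thesis using corresponds_unique_down[OF W(2,3)] by blast
    next
      case 2
      have "neg (S - {y}) (S - {- y}) (?l y) = ?l (- y)"
        using assms by (subst neg_local_class) (auto simp: group.int_pow_1[OF group_relative_homology_group local_class_carrier])
      moreover have "corresponds W' {y'} (neg (S - {y}) (S - {- y}) (?l y)) b"
        using corresponds_point_neg[OF W(2) _ W(3)] W'(2) 2 by simp
      ultimately show ?thesis using corresponds_unique_down[OF W'(2)] W'(3) 2 by simp
    qed
  qed
  define \<nu> where "\<nu> p = (THE b. rel p b)" for p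
  have \<nu>: "\<nu> p = b" if "rel p b" for p b
    unfolding \<nu>_def using that unique by (intro the_equality) auto
  have "orientation d P \<nu>"
    unfolding orientation_def
  proof (intro conjI ballI)
    fix p assume "p \<in> topspace P"
    then obtain x where x: "x \<in> S" "p = q x" by (auto simp: topspace_projective_space)
    have W: "evenly_covered (cap x 0) {x}" by (rule evenly_covered_cap_point[of 0]) (use x centre_mem_cap in auto)
    obtain b where b: "corresponds (cap x 0) {x} (?l x) b"
      using corresponds_ex_down[OF W local_class_carrier] by blast
    then have "rel p b" unfolding rel_def using W x by blast
    then have \<nu>p: "\<nu> p = b" by (rule \<nu>)
    have qx: "q ` {x} = {p}" using x by simp
    show "\<nu> p \<in> carrier (HP (topspace P - {p}))"
      using corresponds_carrier(2)[OF b] unfolding \<nu>p qx .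
    show "carrier (HP (topspace P - {p})) = generate (HP (topspace P - {p})) {\<nu> p}"
      using corresponds_generator[OF W b] generator_local_class_point[OF x(1)] unfolding \<nu>p qx by blast
    \<comment> \<open>Any height strictly between 0 and 1 works: the closed cap then lies in the
      open hemisphere \<open>cap x 0\<close>, and x lies in the open cap.\<close>
    let ?B = "cap x (1 / 2)"
    have WB: "evenly_covered (cap x 0) ?B" by (rule evenly_covered_cap) simp
    obtain c where c: "corresponds (cap x 0) ?B (local_class (S - ?B)) c"
      using corresponds_ex_down[OF WB local_class_carrier] by blast
    have loc: "restP (topspace P - q ` ?B) (topspace P - {q y}) c = \<nu> (q y)" if y: "y \<in> ?B" for y
    proof -
      have Wy: "evenly_covered (cap x 0) {y}" by (rule evenly_covered_cap_point[OF _ y]) simp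
      have "corresponds (cap x 0) {y} (rest (S - ?B) (S - {y}) (local_class (S - ?B))) (restP (topspace P - q ` ?B) (topspace P - q ` {y}) c)"
        using y by (intro corresponds_restrict[OF WB c Wy]) auto
      moreover have "rest (S - ?B) (S - {y}) (local_class (S - ?B)) = ?l y"
        using y by (intro rest_local_class) auto
      ultimately have "rel (q y) (restP (topspace P - q ` ?B) (topspace P - q ` {y}) c)"
        unfolding rel_def using Wy by auto
      then show ?thesis using \<nu> by simp
    qed
    show "\<exists>U. openin P U \<and> p \<in> U \<and> (\<exists>c\<in>carrier (HP (topspace P - U)). \<forall>y\<in>U. restP (topspace P - U) (topspace P - {y}) c = \<nu> y)"
    proof (intro exI[of _ "q ` ?B"] conjI bexI[of _ c] ballI)
      show "openin P (q ` ?B)" by (intro openin_image_class openin_cap)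
      show "p \<in> q ` ?B" unfolding x(2) by (rule imageI, rule centre_mem_cap[OF x(1)]) simp
      show "c \<in> carrier (HP (topspace P - q ` ?B))" by (rule corresponds_carrier(2)[OF c])
      fix p' assume "p' \<in> q ` ?B"
      then obtain y where y: "y \<in> ?B" and p': "p' = q y" by (rule imageE)
      show "restP (topspace P - q ` ?B) (topspace P - {p'}) c = \<nu> p'"
        unfolding p' by (rule loc[OF y])
    qed
  qed
  then show ?thesis unfolding orientable_def by blast
qed

text \<open>An orientation of projective space lifts to one of the sphere that the antipodal map preserves.
  In even dimension that contradicts the degree \<open>-1\<close> of the antipodal map.\<close>

lemma not_orientable_projective_space:
  assumes "even d"
  shows "\<not> orientable d P"
proof
  assume "orientable d P"
  then obtain \<nu> where \<nu>: "orientation d P \<nu>" unfolding orientable_def by blast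
  have \<nu>_carrier: "\<nu> (q x) \<in> carrier (HP (topspace P - {q x}))"
    and \<nu>_gen: "carrier (HP (topspace P - {q x})) = generate (HP (topspace P - {q x})) {\<nu> (q x)}"
    and \<nu>_loc: "\<exists>U. openin P U \<and> q x \<in> U \<and> (\<exists>c\<in>carrier (HP (topspace P - U)). \<forall>y\<in>U. restP (topspace P - U) (topspace P - {y}) c = \<nu> y)"
    if "x \<in> S" for x
    using \<nu> that unfolding orientation_def topspace_projective_space by auto
  have hemi: "evenly_covered (cap x 0) {x}" if "x \<in> S" for x
    by (rule evenly_covered_cap_point[of 0]) (use that centre_mem_cap in auto)
  have "\<exists>a. corresponds (cap x 0) {x} a (\<nu> (q x))" if "x \<in> S" for x
    by (rule corresponds_ex_up[OF hemi[OF that]]) (use \<nu>_carrier[OF that] in simp)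
  then obtain \<mu> where \<mu>: "corresponds (cap x 0) {x} (\<mu> x) (\<nu> (q x))" if "x \<in> S" for x by metis
  \<comment> \<open>The lifted class does not depend on the hemisphere used to define it.\<close>
  have \<mu>': "\<mu> y = a" if W: "evenly_covered W {y}" and a: "corresponds W {y} a (\<nu> (q y))" for W y a
  proof -
    have y: "y \<in> S" using evenly_covered_subset[OF W] by auto
    then have "corresponds W {y} (\<mu> y) (\<nu> (q y))" using corresponds_point_change[OF hemi W] \<mu> by blast
    then show ?thesis using corresponds_unique_up[OF W] a by blast
  qed
  have "orientation d X \<mu>"
    unfolding orientation_def
  proof (intro conjI ballI)
    fix x assume "x \<in> topspace X"
    then have x: "x \<in> S" by simp
    show "\<mu> x \<in> carrier (HX (topspace X - {x}))"
      using corresponds_carrier(1)[OF \<mu>[OF x]] by simp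
    show "carrier (HX (topspace X - {x})) = generate (HX (topspace X - {x})) {\<mu> x}"
      using corresponds_generator[OF hemi[OF x] \<mu>[OF x]] \<nu>_gen[OF x] by simp
    obtain V c where V: "openin P V" "q x \<in> V" and c: "c \<in> carrier (HP (topspace P - V))"
        "\<And>y. y \<in> V \<Longrightarrow> restP (topspace P - V) (topspace P - {y}) c = \<nu> y"
      using \<nu>_loc[OF x] by blast
    have "openin X {u \<in> topspace X. q u \<in> V}"
      using V(1) by (intro openin_continuous_map_preimage[OF continuous_map_antipodal_class])
    then obtain r where r: "1 / 2 \<le> r" "r < 1" "cap x r \<subseteq> {u \<in> topspace X. q u \<in> V}"
      by (rule cap_neighbourhood) (use x V(2) in auto)
    define B where "B = cap x r"
    have WB: "evenly_covered (cap x 0) B" unfolding B_def using r by (intro evenly_covered_cap) simp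
    have qB: "q ` B \<subseteq> V" using r(3) by (auto simp: B_def)
    define c' where "c' = restP (topspace P - V) (topspace P - q ` B) c"
    have "c' \<in> carrier (HP (topspace P - q ` B))" unfolding c'_def by (rule hom_induced_carrier)
    then obtain a where a: "corresponds (cap x 0) B a c'" using corresponds_ex_up[OF WB] by blast
    have loc: "rest (S - B) (S - {y}) a = \<mu> y" if y: "y \<in> B" for y
    proof -
      have Wy: "evenly_covered (cap x 0) {y}" using y r(1) by (intro evenly_covered_cap_point[of r]) (auto simp: B_def)
      have "corresponds (cap x 0) {y} (rest (S - B) (S - {y}) a) (restP (topspace P - q ` B) (topspace P - q ` {y}) c')"
        using y by (intro corresponds_restrict[OF WB a Wy]) auto
      moreover have "restP (topspace P - q ` B) (topspace P - q ` {y}) c' = restP (topspace P - V) (topspace P - q ` {y}) c"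
        unfolding c'_def using y qB by (intro restP_restP) auto
      moreover have "\<dots> = \<nu> (q y)" using c(2)[of "q y"] y qB by auto
      ultimately have "corresponds (cap x 0) {y} (rest (S - B) (S - {y}) a) (\<nu> (q y))" by simp
      then show ?thesis using \<mu>'[OF Wy] by simp
    qed
    show "\<exists>U. openin X U \<and> x \<in> U \<and> (\<exists>c\<in>carrier (HX (topspace X - U)). \<forall>y\<in>U. rest (topspace X - U) (topspace X - {y}) c = \<mu> y)"
    proof (intro exI[of _ B] conjI bexI[of _ a] ballI)
      show "openin X B" unfolding B_def by (rule openin_cap)
      show "x \<in> B" unfolding B_def using centre_mem_cap[OF x r(2)] .
      show "a \<in> carrier (HX (topspace X - B))" using corresponds_carrier(1)[OF a] by simp
    qed (use loc in simp)
  qed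
  then obtain k :: int where k: "k \<noteq> 0" "\<forall>x\<in>S. \<mu> x = local_class (S - {x}) [^]\<^bsub>HX (S - {x})\<^esub> k"
    using orientation_eq_power by blast
  obtain x :: 'a where x: "x \<in> S" using vector_choose_size[of 1] by auto
  then have x': "- x \<in> S" by simp
  let ?H = "HX (S - {- x})" and ?l = "local_class (S - {- x})"
  \<comment> \<open>The class at q x lifts to both x and -x, so the antipodal map takes \<mu> x to
    \<mu> (- x); its degree -1 turns the common exponent k into -k.\<close>
  have "corresponds (cap (- x) 0) {- x} (neg (S - {x}) (S - {- x}) (\<mu> x)) (\<nu> (q x))"
    by (rule corresponds_point_neg[OF hemi[OF x] hemi[OF x'] \<mu>[OF x]])
  also have "q x = q (- x)" by auto
  finally have "\<mu> (- x) = neg (S - {x}) (S - {- x}) (\<mu> x)" by (rule \<mu>'[OF hemi[OF x']])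
  also have "\<dots> = neg (S - {x}) (S - {- x}) (local_class (S - {x})) [^]\<^bsub>?H\<^esub> k"
    using k(2) x by (simp add: neg_pow local_class_carrier)
  also have "neg (S - {x}) (S - {- x}) (local_class (S - {x})) = ?l [^]\<^bsub>?H\<^esub> (- 1 :: int)"
    using assms by (subst neg_local_class) auto
  also have "(?l [^]\<^bsub>?H\<^esub> (- 1 :: int)) [^]\<^bsub>?H\<^esub> k = ?l [^]\<^bsub>?H\<^esub> (- k)"
    by (simp add: group.int_pow_pow local_class_carrier)
  finally have "?l [^]\<^bsub>?H\<^esub> k = ?l [^]\<^bsub>?H\<^esub> (- k)" using k(2) x' by simp
  moreover have "inj (\<lambda>k::int. ?l [^]\<^bsub>?H\<^esub> k)"
    using local_class_bij[OF iso_rest_point[OF x']] by (simp add: bij_betw_def)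
  ultimately have "k = - k" by (rule injD[rotated])
  then show False using k(1) by simp
qed

end

theorem corollary10p2:
  fixes K :: "'a::euclidean_space set" and h :: "'a \<Rightarrow> real" and r :: real and n :: nat
  assumes "n = DIM('a)" and "n \<ge> 2"
    and "convex_body K" and "r > 0" and "constant_width K (2 * r)"
    and "\<forall>u\<in>sphere 0 1. support_function K u = r + h u"
    and "\<forall>u\<in>sphere 0 1. h (- u) = - h u"
  shows "(\<forall>m. n = 2 * m \<and> n \<ge> 4 \<longrightarrow>
            measure lebesgue K =
              r / (real n - 2) * surface_area K
              - 2 * measure lebesgue (cball (0::'a) 1) / (real n - 2) * r ^ n
              + 2 / (real n - 2) *
                  (\<Sum>p = 2..m - 1. (real p - 1) * real (n choose (2 * p)) * r ^ (n - 2 * p)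
                     * mixed_quermass (2 * p) h)
              + mixed_volume_ext (replicate n h)
            \<and> gauss_cover_volume h = mixed_volume_ext (replicate n h)
            \<and> projective_volume h = 1 / 2 * mixed_volume_ext (replicate n h)
            \<and> orientable (n - 1) (projective_space :: 'a set topology)
            \<and> orientation_preserving (n - 1) (unit_sphere :: 'a topology) uminus)
       \<and> (odd n \<longrightarrow>
            mixed_volume_ext (replicate n h) = 0
            \<and> \<not> orientable (n - 1) (projective_space :: 'a set topology))"
proof -
  \<comment> \<open>The sphere has dimension n - 1, of parity opposite to n, so even n is the
    orientable case.\<close>
  interpret sphere_cover "n - 1" "TYPE('a)"
    using assms(1,2) by unfold_locales auto
  have h: "support_function K u = r + h u" "h (- u) = - h u" if "norm u = 1" for u
    using assms(6,7) that by auto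
  have quermass: "mixed_volume_ext (replicate DIM('a) h) = mixed_quermass DIM('a) h"
    by (simp add: mixed_quermass_def)
  show ?thesis
  proof (intro conjI allI impI)
    fix m assume m: "n = 2 * m \<and> n \<ge> 4"
    then show "measure lebesgue K =
              r / (real n - 2) * surface_area K
              - 2 * measure lebesgue (cball (0::'a) 1) / (real n - 2) * r ^ n
              + 2 / (real n - 2) *
                  (\<Sum>p = 2..m - 1. (real p - 1) * real (n choose (2 * p)) * r ^ (n - 2 * p)
                     * mixed_quermass (2 * p) h)
              + mixed_volume_ext (replicate n h)"
      unfolding assms(1) quermass by (intro constant_width_volume[OF assms(3) _ _ h]) auto
    show "gauss_cover_volume h = mixed_volume_ext (replicate n h)"
      by (simp add: gauss_cover_volume_def assms(1))
    then show "projective_volume h = 1 / 2 * mixed_volume_ext (replicate n h)"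
      by (simp add: projective_volume_def)
    have "odd (n - 1)" using m by auto
    then show "orientable (n - 1) P" "orientation_preserving (n - 1) X uminus"
      by (rule orientable_projective_space, rule orientation_preserving_uminus)
  next
    assume n: "odd n"
    show "mixed_volume_ext (replicate n h) = 0"
      unfolding assms(1) quermass using n assms(1) by (intro mixed_quermass_odd[OF assms(3) _ _ h]) auto
    show "\<not> orientable (n - 1) P"
      using n assms(2) by (intro not_orientable_projective_space) auto
  qed
qed

end
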